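(* Let $q\geq 3$ be a prime number. For each prime number $p$ consider the polynomial $f_p(t):=t^q-p$. Then $$ \liminf_{x\to\infty}\frac{1}{\pi(x)}\#\{p\leq x: p \text{ prime and } f_p(t) \text{ is monogenic}\}\geq\frac{q-1}{q}. $$
   Context: $\pi(x)$ denotes the number of primes less than $x$. A number field $K$ with ring of integers $\mathcal{O}_K$ is called monogenic if there exists $\alpha\in\mathcal{O}_K$ such that $\mathcal{O}_K=\mathbb{Z}[\alpha]$. A monic irreducible polynomial $f(t)\in\mathbb{Z}[t]$ is called monogenic if the number field $\mathbb{Q}[t]/(f(t))\cong\mathbb{Q}(\alpha)$ is monogenic, where $\alpha$ is a root of $f(t)$ (the element generating the ring of integers is not required to be $\alpha$ itself). *)

theory Defs
  imports
    "HOL-Algebra.Algebraic_Closure_Type"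
    "HOL-Algebra.Generated_Fields"
    "HOL-Library.Extended_Real"
begin

abbreviation complex_ring :: "complex ring"
  where "complex_ring \<equiv> ring_of_type_algebra"

text \<open>
  A number field is represented by an embedded copy inside the complex numbers. Monogenicity is
  invariant under isomorphism, so the choice of the embedding is immaterial.
\<close>

definition number_field :: "complex set \<Rightarrow> bool"
  where "number_field K \<longleftrightarrow>
    subfield K complex_ring \<and> ring.finite_dimension complex_ring \<rat> K"

definition ring_of_integers :: "complex set \<Rightarrow> complex set"
  where "ring_of_integers K = {x \<in> K. algebraic_int x}"

text \<open>
  \<^term>\<open>generate_ring R {\<theta>}\<close> is the least subring (with \<open>1\<close>) containing \<open>\<theta>\<close>, that is, \<open>\<int>[\<theta>]\<close>.
\<close>

definition monogenic_field :: "complex set \<Rightarrow> bool"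
  where "monogenic_field K \<longleftrightarrow>
    number_field K \<and>
    (\<exists>\<theta>\<in>ring_of_integers K. ring_of_integers K = generate_ring complex_ring {\<theta>})"

text \<open>
  The field \<open>\<rat>[t]/(f)\<close> is represented by \<open>\<rat>(\<alpha>)\<close>, where \<open>\<alpha>\<close> is a complex root of \<open>f\<close>. A monic
  irreducible \<open>f\<close> has positive degree, hence a root, and its roots generate isomorphic fields, so it
  makes no difference whether one quantifies over \<open>\<alpha>\<close> universally or existentially.
\<close>

definition monogenic_poly :: "int poly \<Rightarrow> bool"
  where "monogenic_poly f \<longleftrightarrow>
    lead_coeff f = 1 \<and> irreducible f \<and>
    (\<forall>\<alpha>::complex. poly (map_poly of_int f) \<alpha> = 0 \<longrightarrow>
      monogenic_field (generate_field complex_ring {\<alpha>}))"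

text \<open>The inequality is strict: \<open>x\<close> itself is not counted.\<close>

definition prime_pi :: "real \<Rightarrow> nat"
  where "prime_pi x = card {p::nat. prime p \<and> real p < x}"

end

theory Submission
  imports
    Defs
    "Jordan_Normal_Form.Char_Poly"
    "HOL-Number_Theory.Number_Theory"
    "HOL-Complex_Analysis.Complex_Analysis"
    "HOL-Real_Asymp.Real_Asymp"
begin

text \<open>
  Let p be a prime different from q and let \<alpha> be a complex number with \<alpha>^q = p. If
  p^(q-1) is not congruent to 1 modulo q^2, then the ring of integers of Q(\<alpha>) is Z[\<alpha>]
  (lemma \<open>monogenic_pure_poly\<close>), so it remains to see that the primes violating this
  condition have upper density at most 1/q among all primes.

  The algebraic half. An integer of Q(\<alpha>) is g(\<alpha>) for a rational polynomial g of degree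
  below q, and all its conjugates g(\<alpha> \<zeta>^k), \<zeta> a primitive q-th root of unity, are integral.
  Their discrete Fourier transform isolates q a_i \<alpha>^i, where a_i is the i-th coefficient of g;
  its q-th power (q a_i)^q p^i is a rational integer, and i < q then forces q a_i to be an integer.
  Hence q is the only possible denominator (\<open>coeff_times_degree_integral\<close>). To exclude
  it, expand q g(\<alpha>) in powers of \<eta> = p - \<alpha>. The norm of \<eta> is p^q - p, which q divides exactly once, and \<eta>^q / q is
  integral. If some coefficient of the expansion were prime to q, the lowest such coefficient b
  would make b \<eta>^(q-1) / q integral, but the norm of this number has a q in its denominator
  (\<open>dvd_coeffs_if_quotient_integral\<close>).

  The analytic half. The Fermat quotient (n^(q-1) - 1)/q modulo q turns multiplication into
  addition, so composing it with the additive characters of Z/q gives characters \<chi> modulo q^2 of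
  order q, whose common kernel consists of the n with n^(q-1) congruent to 1 modulo q^2. Since q is
  odd, both \<chi> and \<chi>^2 are nonprincipal, so L(s,\<chi>) and L(s,\<chi>^2) are holomorphic for
  Re s > 0, and the inequality 3 + 4 cos \<theta> + cos 2\<theta> \<ge> 0 shows that L(s,\<chi>) has no zero with
  Re s \<ge> 1 (\<open>L_nonzero\<close>). Newman's contour argument (\<open>newman_tauberian\<close>) applied to
  1/L(s,\<chi>), the Dirichlet series of \<mu>(n) \<chi>(n), gives that the sum of \<mu>(n) \<chi>(n) over n \<le> N is
  o(N). The hyperbola method carries this over to the sum of \<chi>(n) \<Lambda>(n), because \<Lambda> is the
  Dirichlet convolution of \<mu> and the logarithm (\<open>mean_chi_mangoldt_tendsto_0\<close>). Orthogonality
  of the characters bounds the part of Chebyshev's function coming from the kernel by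
  (\<psi>(N) + o(N))/q, and the estimates N/4 \<le> \<psi>(N) \<le> \<pi>(N) log N turn this into a statement on
  numbers of primes (\<open>eventually_density_kernel_primes\<close>).
\<close>

section \<open>Algebraic integers form a ring\<close>

text \<open>
  The vector of the v i is an eigenvector of the integer matrix A with eigenvalue z, so z is a
  root of the monic integer polynomial char_poly A.
\<close>
lemma algebraic_int_if_maps_lattice_to_itself:
  fixes v :: "nat \<Rightarrow> complex" and A :: "nat \<Rightarrow> nat \<Rightarrow> int"
  assumes eq: "\<And>i. i < n \<Longrightarrow> z * v i = (\<Sum>j<n. of_int (A i j) * v j)"
  assumes nz: "k < n" "v k \<noteq> 0"
  shows "algebraic_int z"
proof -
  define M :: "int mat" where "M = Matrix.mat n n (\<lambda>(i,j). A i j)"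
  define w where "w = Matrix.vec n v"
  have M: "M \<in> carrier_mat n n" and w: "w \<in> carrier_vec n"
    by (auto simp: M_def w_def)
  have "of_int_hom.mat_hom M *\<^sub>v w = z \<cdot>\<^sub>v w"
    by (rule eq_vecI) (auto simp: M_def w_def scalar_prod_def eq atLeast0LessThan)
  moreover have "w \<noteq> 0\<^sub>v n"
  proof
    assume "w = 0\<^sub>v n"
    hence "vec_index w k = 0" using nz(1) by simp
    thus False using nz by (simp add: w_def)
  qed
  ultimately have "eigenvector (of_int_hom.mat_hom M :: complex mat) w z"
    using M w by (auto simp: eigenvector_def)
  hence "eigenvalue (of_int_hom.mat_hom M :: complex mat) z"
    by (auto simp: eigenvalue_def)
  hence "poly (of_int_poly (char_poly M)) z = 0"
    using M by (subst (asm) eigenvalue_root_char_poly[where n = n])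
      (auto simp: of_int_hom.char_poly_hom[OF M])
  moreover have "monic (char_poly M)"
    using degree_monic_char_poly[OF M] by auto
  ultimately show ?thesis
    unfolding algebraic_int_altdef_ipoly by blast
qed

text \<open>
  The lattice generated by v 0, ..., v (n - 1); its generators may be linearly dependent.
\<close>
definition int_span :: "nat \<Rightarrow> (nat \<Rightarrow> complex) \<Rightarrow> complex set" where
  "int_span n v = range (\<lambda>c. \<Sum>k<n. of_int (c k) * v k)"

lemma int_span_0: "0 \<in> int_span n v"
  unfolding int_span_def by (rule range_eqI[of _ _ "\<lambda>_. 0"]) simp

lemma int_span_base:
  assumes "k < n" shows "v k \<in> int_span n v"
  unfolding int_span_def
proof (rule range_eqI[of _ _ "\<lambda>i. if i = k then 1 else 0"])
  have "(\<Sum>i<n. of_int (if i = k then 1 else 0) * v i) = (\<Sum>i<n. if i = k then v i else 0)"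
    by (intro sum.cong) auto
  thus "v k = (\<Sum>i<n. of_int (if i = k then 1 else 0) * v i)"
    using assms by simp
qed

lemma int_span_add:
  assumes "a \<in> int_span n v" "b \<in> int_span n v"
  shows "a + b \<in> int_span n v"
proof -
  obtain c d where "a = (\<Sum>k<n. of_int (c k) * v k)" "b = (\<Sum>k<n. of_int (d k) * v k)"
    using assms by (auto simp: int_span_def)
  hence "a + b = (\<Sum>k<n. of_int (c k + d k) * v k)"
    by (simp add: sum.distrib ring_distribs)
  thus ?thesis unfolding int_span_def by (rule range_eqI[of _ _ "\<lambda>k. c k + d k"])
qed

lemma int_span_scale:
  assumes "a \<in> int_span n v"
  shows "of_int r * a \<in> int_span n v"
proof -
  obtain c where "a = (\<Sum>k<n. of_int (c k) * v k)"
    using assms by (auto simp: int_span_def)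
  hence "of_int r * a = (\<Sum>k<n. of_int (r * c k) * v k)"
    by (simp add: sum_distrib_left mult.assoc)
  thus ?thesis unfolding int_span_def by (rule range_eqI[of _ _ "\<lambda>k. r * c k"])
qed

lemma int_span_sum:
  assumes "\<And>i. i \<in> I \<Longrightarrow> f i \<in> int_span n v"
  shows "(\<Sum>i\<in>I. of_int (c i) * f i) \<in> int_span n v"
  using assms
  by (induction I rule: infinite_finite_induct) (auto intro: int_span_0 int_span_add int_span_scale)

lemma int_span_mult_closed:
  assumes "\<And>k. k < n \<Longrightarrow> x * v k \<in> int_span n v" "a \<in> int_span n v"
  shows "x * a \<in> int_span n v"
proof -
  obtain c where "a = (\<Sum>k<n. of_int (c k) * v k)"
    using assms by (auto simp: int_span_def)
  hence "x * a = (\<Sum>k<n. of_int (c k) * (x * v k))"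
    by (simp add: sum_distrib_left algebra_simps)
  thus ?thesis using assms(1) by (auto intro: int_span_sum)
qed

lemma algebraic_int_if_int_span_closed:
  assumes "\<And>k. k < n \<Longrightarrow> z * v k \<in> int_span n v" "k < n" "v k \<noteq> 0"
  shows "algebraic_int z"
proof -
  have "\<exists>c. \<forall>k<n. z * v k = (\<Sum>j<n. of_int (c k j) * v j)"
    using assms(1) by (subst choice_iff' [symmetric]) (auto simp: int_span_def image_iff)
  then obtain c where "\<And>k. k < n \<Longrightarrow> z * v k = (\<Sum>j<n. of_int (c k j) * v j)"
    by blast
  from algebraic_int_if_maps_lattice_to_itself[OF this assms(2,3)] show ?thesis .
qed

lemma algebraic_int_power_relation:
  assumes "algebraic_int (x :: complex)"
  obtains m c where "m > 0" "x ^ m = (\<Sum>i<m. of_int (c i) * x ^ i)"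
proof -
  obtain P where P: "poly (of_int_poly P) x = 0" "monic P"
    using assms unfolding algebraic_int_altdef_ipoly by blast
  define m where "m = Polynomial.degree P"
  have "0 = (\<Sum>i\<le>m. of_int (poly.coeff P i) * x ^ i)"
    using P(1) by (simp add: poly_altdef m_def)
  also have "\<dots> = (\<Sum>i<m. of_int (poly.coeff P i) * x ^ i) + x ^ m"
    using P(2) by (simp add: lessThan_Suc_atMost[symmetric] m_def)
  finally have eq: "x ^ m = (\<Sum>i<m. of_int (- poly.coeff P i) * x ^ i)"
    by (simp add: sum_negf eq_neg_iff_add_eq_0 add.commute)
  have "m > 0"
    using eq by (cases m) auto
  thus ?thesis using eq that[of m "\<lambda>i. - poly.coeff P i"] by blast
qed

text \<open>
  Multiplication by x and by y maps the lattice spanned by the monomials x^i y^j, with i and j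
  below the degrees of monic equations for x and y, into itself. Hence so does multiplication by x
  + y and by x y. The monomials are enumerated by k = i + m j.
\<close>
lemma algebraic_int_add_mult:
  assumes "algebraic_int (x :: complex)" "algebraic_int y"
  shows "algebraic_int (x + y)" "algebraic_int (x * y)"
proof -
  obtain m c where m: "m > 0" and xm: "x ^ m = (\<Sum>i<m. of_int (c i) * x ^ i)"
    using algebraic_int_power_relation[OF assms(1)] by blast
  obtain n d where n: "n > 0" and yn: "y ^ n = (\<Sum>i<n. of_int (d i) * y ^ i)"
    using algebraic_int_power_relation[OF assms(2)] by blast
  define v where "v k = x ^ (k mod m) * y ^ (k div m)" for k
  let ?L = "int_span (m * n) v"
  have mem: "x ^ i * y ^ j \<in> ?L" if "i < m" "j < n" for i j
  proof -
    have "i + j * m < m * n"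
    proof -
      have "i + j * m < Suc j * m" using that by simp
      also have "\<dots> \<le> n * m" using that by (intro mult_right_mono) auto
      finally show ?thesis by (simp add: mult.commute)
    qed
    moreover have "v (i + j * m) = x ^ i * y ^ j"
      using that by (simp add: v_def)
    ultimately show ?thesis using int_span_base by metis
  qed
  \<comment> \<open>every index below m n encodes a pair of exponents below m and n\<close>
  have idx: "k mod m < m" "k div m < n" if "k < m * n" for k
    using that m by (auto simp: less_mult_imp_div_less mult.commute)
  have x: "x * v k \<in> ?L" if k: "k < m * n" for k
  proof (cases "Suc (k mod m) < m")
    case True
    have "x * v k = x ^ Suc (k mod m) * y ^ (k div m)" by (simp add: v_def)
    thus ?thesis using mem[OF True idx(2)[OF k]] by presburger
  next
    case False
    hence "m = Suc (k mod m)" using idx(1)[OF k] by linarith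
    hence "x * v k = x ^ m * y ^ (k div m)" 
      by (metis v_def mult.assoc power_Suc)
    also have "\<dots> = (\<Sum>i<m. of_int (c i) * (x ^ i * y ^ (k div m)))"
      by (simp add: xm sum_distrib_right mult.assoc)
    also have "\<dots> \<in> ?L" by (intro int_span_sum mem idx k) auto
    finally show ?thesis .
  qed
  have y: "y * v k \<in> ?L" if k: "k < m * n" for k
  proof (cases "Suc (k div m) < n")
    case True
    have "y * v k = x ^ (k mod m) * y ^ Suc (k div m)" by (simp add: v_def)
    thus ?thesis using mem[OF idx(1)[OF k] True] by presburger
  next
    case False
    hence "n = Suc (k div m)" using idx(2)[OF k] by linarith
    hence "y * v k = x ^ (k mod m) * y ^ n" 
      by (metis v_def mult.left_commute power_Suc)
    also have "\<dots> = (\<Sum>i<n. of_int (d i) * (x ^ (k mod m) * y ^ i))"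
      by (simp add: yn sum_distrib_left mult_ac)
    also have "\<dots> \<in> ?L" by (intro int_span_sum mem idx k) auto
    finally show ?thesis .
  qed
  have nz: "0 < m * n" "v 0 \<noteq> 0" using m n by (auto simp: v_def)
  show "algebraic_int (x + y)"
    by (rule algebraic_int_if_int_span_closed[where n = "m * n" and v = v and k = 0, OF _ nz])
       (simp add: ring_distribs int_span_add x y)
  show "algebraic_int (x * y)"
    by (rule algebraic_int_if_int_span_closed[where n = "m * n" and v = v and k = 0, OF _ nz])
       (simp add: mult.assoc int_span_mult_closed[OF x] y)
qed

lemma algebraic_int_sum:
  "(\<And>i. i \<in> I \<Longrightarrow> algebraic_int (f i :: complex)) \<Longrightarrow> algebraic_int (\<Sum>i\<in>I. f i)"
  by (induction I rule: infinite_finite_induct) (auto intro: algebraic_int_add_mult)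

lemma algebraic_int_prod:
  "(\<And>i. i \<in> I \<Longrightarrow> algebraic_int (f i :: complex)) \<Longrightarrow> algebraic_int (\<Prod>i\<in>I. f i)"
  using algebraic_int_of_int[of 1]
  by (induction I rule: infinite_finite_induct) (auto intro: algebraic_int_add_mult)

lemma algebraic_int_power: "algebraic_int (x :: complex) \<Longrightarrow> algebraic_int (x ^ n)"
  using algebraic_int_of_int[of 1]
  by (induction n) (auto intro: algebraic_int_add_mult)

lemma algebraic_int_if_power:
  assumes "n > 0" "algebraic_int ((x :: complex) ^ n)"
  shows "algebraic_int x"
  by (rule algebraic_int_root[OF assms(2), of "Polynomial.monom 1 n"])
     (use assms(1) in \<open>auto simp: degree_monom_eq poly_monom\<close>)

lemma algebraic_int_poly:
  "algebraic_int (x :: complex) \<Longrightarrow> algebraic_int (poly (of_int_poly p) x)"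
  unfolding poly_altdef
  by (intro algebraic_int_sum algebraic_int_add_mult algebraic_int_power) auto

section \<open>The polynomial t^q - p and its conjugate roots\<close>

text \<open>
  Compare p-adic valuations: q v(r) = e.
\<close>
lemma exponent_dvd_if_rational_power_eq:
  fixes p q e :: nat and r :: rat
  assumes "prime p" and r: "r ^ q = of_nat p ^ e"
  shows "q dvd e"
proof -
  obtain a b where ab: "r = of_int a / of_int b" "b > 0" "coprime a b"
    using quotient_of_div[of r "fst (quotient_of r)" "snd (quotient_of r)"]
      quotient_of_denom_pos' quotient_of_coprime by (metis prod.collapse)
  have "(of_int (a ^ q) :: rat) = of_int (int p ^ e * b ^ q)"
    using r ab by (simp add: power_divide field_simps)
  hence eq: "a ^ q = int p ^ e * b ^ q" by (simp only: of_int_eq_iff)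
  have p: "prime (int p)" "int p \<noteq> 0" using assms by auto
  have "a \<noteq> 0 \<or> q = 0"
  proof (rule ccontr)
    assume "\<not> (a \<noteq> 0 \<or> q = 0)"
    hence "int p ^ e * b ^ q = 0" using eq by (simp add: power_0_left)
    thus False using p ab(2) by simp
  qed
  thus ?thesis
  proof
    assume "a \<noteq> 0"
    hence "q * multiplicity (int p) a = multiplicity (int p) (a ^ q)"
      using p by (simp add: prime_elem_multiplicity_power_distrib)
    also have "\<dots> = e + q * multiplicity (int p) b"
      using p ab(2) by (simp add: eq prime_elem_multiplicity_mult_distrib prime_elem_multiplicity_power_distrib)
    finally show ?thesis by (metis dvd_add_left_iff dvd_triv_left)
  next
    assume "q = 0"
    hence "int p ^ e = 1" using eq by simp
    hence "e = 0" using p prime_gt_1_int[of "int p"] by (metis one_less_power bot_nat_0.not_eq_extremum less_irrefl)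
    thus ?thesis by simp
  qed
qed

text \<open>
  The p-adic valuation of r is at least -i/q > -1, and no other prime can occur in the denominator
  of r.
\<close>
lemma rational_is_int_if_scaled_power_is_int:
  fixes p q i :: nat and r :: rat
  assumes "prime p" "i < q" and r: "r ^ q * of_nat p ^ i \<in> \<int>"
  shows "r \<in> \<int>"
proof -
  obtain a b where ab: "r = of_int a / of_int b" "b > 0" "coprime a b"
    using quotient_of_div[of r "fst (quotient_of r)" "snd (quotient_of r)"]
      quotient_of_denom_pos' quotient_of_coprime by (metis prod.collapse)
  obtain n where n: "r ^ q * of_nat p ^ i = of_int n" using r by (auto elim: Ints_cases)
  have "(of_int (a ^ q * int p ^ i) :: rat) = of_int (n * b ^ q)"
    using n ab by (simp add: power_divide field_simps)
  hence "a ^ q * int p ^ i = n * b ^ q" by (simp only: of_int_eq_iff)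
  hence "b ^ q dvd int p ^ i"
    using ab(3) by (metis coprime_commute coprime_dvd_mult_right_iff coprime_power_left_iff
        coprime_power_right_iff dvd_triv_right)
  moreover have "b = 1" if dvd: "b ^ q dvd int p ^ i"
  proof (rule ccontr)
    assume "b \<noteq> 1"
    have pp: "prime (int p)" using assms by simp
    have "b dvd int p ^ i" using dvd assms(2) dvd_trans[OF dvd_power[of q b] dvd] by simp
    then obtain k where k: "normalize b = int p ^ k" 
      using divides_primepow[OF pp] by blast
    hence "b = int p ^ k" using ab(2) by simp
    with \<open>b \<noteq> 1\<close> have "int p dvd b" by (cases k) auto
    hence "int p ^ q dvd int p ^ i" using dvd dvd_power_same dvd_trans by blast
    hence "p ^ q dvd p ^ i" by (metis of_nat_power of_nat_dvd_iff)
    hence "q \<le> i" using power_dvd_imp_le prime_gt_1_nat[OF assms(1)] by blast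
    thus False using assms(2) by simp
  qed
  ultimately show ?thesis using ab by simp
qed

abbreviation eval_rat :: "rat poly \<Rightarrow> complex \<Rightarrow> complex" where
  "eval_rat g x \<equiv> poly (map_poly of_rat g) x"

interpretation of_rat_complex: field_hom "of_rat :: rat \<Rightarrow> complex"
  by unfold_locales (auto simp: of_rat_add of_rat_mult)

interpretation of_rat_complex_poly: map_poly_inj_comm_ring_hom "of_rat :: rat \<Rightarrow> complex" ..

lemma degree_pure_poly:
  "q > 0 \<Longrightarrow> Polynomial.degree (Polynomial.monom (1::'a::{comm_ring_1}) q - [:c:]) = q"
  using degree_add_eq_left[of "- [:c:]" "Polynomial.monom 1 q"] by (simp add: degree_monom_eq del: minus_pCons)

lemma norm_of_rat_complex: "cmod (of_rat r) = of_rat \<bar>r\<bar>"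
proof -
  have "r = of_int (fst (quotient_of r)) / of_int (snd (quotient_of r))"
    by (rule quotient_of_div) simp
  then obtain a b where "r = of_int a / of_int b" by blast
  thus ?thesis by (simp add: of_rat_divide norm_divide abs_divide flip: of_int_abs)
qed

text \<open>
  All complex roots of t^q - p have absolute value p^(1/q), so the constant term c of a monic
  divisor of degree e satisfies |c|^q = p^e. As c is rational, q divides e.
\<close>
lemma monic_divisor_of_pure_poly_trivial:
  fixes p q :: nat and d :: "rat poly"
  assumes "prime p" "q > 0" and d: "d dvd Polynomial.monom 1 q - [:of_nat p:]" "monic d"
  shows "Polynomial.degree d = 0 \<or> Polynomial.degree d = q"
proof -
  let ?P = "Polynomial.monom 1 q - [:of_nat p:] :: rat poly"
  let ?dc = "map_poly of_rat d :: complex poly"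
  define e where "e = Polynomial.degree d"
  have degP: "Polynomial.degree ?P = q"
    using assms(2) by (rule degree_pure_poly)
  have "?P \<noteq> 0" using degP assms(2) by auto
  hence "e \<le> q" unfolding e_def using d(1) degP by (metis dvd_imp_degree_le)
  have root: "cmod z ^ q = real p" if "poly ?dc z = 0" for z
  proof -
    obtain g where "?P = d * g" using d(1) by blast
    hence "eval_rat ?P z = 0" using that by (simp add: of_rat_complex_poly.hom_mult)
    hence "z ^ q = of_nat p" 
      by (simp add: hom_distribs poly_monom)
    hence "cmod (z ^ q) = cmod (of_nat p)" by simp
    thus ?thesis by (simp add: norm_power)
  qed
  have lc: "Polynomial.lead_coeff ?dc = 1" using d(2) by simp
  obtain rt where rt': "Polynomial.smult (Polynomial.lead_coeff ?dc)
      (\<Prod>i<Polynomial.degree ?dc. [:-rt i,1:]) = ?dc" 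
    by (rule complex_poly_decompose')
  have "Polynomial.degree ?dc = e" by (simp add: e_def)
  with rt' lc have rt: "?dc = (\<Prod>i<e. [:-rt i,1:])" by (metis smult_1_left)
  have rt_root: "poly ?dc (rt i) = 0" if "i < e" for i
    unfolding rt poly_prod using that by (intro prod_zero) auto
  have "cmod (poly ?dc 0) ^ q = (\<Prod>i<e. cmod (rt i) ^ q)"
    unfolding rt poly_prod prod_norm [symmetric] prod_power_distrib by simp
  also have "\<dots> = (\<Prod>i<e. real p)"
    using root[OF rt_root] by (intro prod.cong) auto
  finally have "cmod (poly ?dc 0) ^ q = real p ^ e" by simp
  also have "poly ?dc 0 = of_rat (poly.coeff d 0)" by (simp add: poly_0_coeff_0)
  also have "cmod (of_rat (poly.coeff d 0)) = of_rat \<bar>poly.coeff d 0\<bar>" 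
    by (rule norm_of_rat_complex)
  finally have "(of_rat (\<bar>poly.coeff d 0\<bar> ^ q) :: real) = of_rat (of_nat p ^ e)"
    by (simp add: of_rat_power)
  hence "\<bar>poly.coeff d 0\<bar> ^ q = of_nat p ^ e" by (simp only: of_rat_eq_iff)
  hence "q dvd e" using exponent_dvd_if_rational_power_eq[OF assms(1)] by blast
  thus ?thesis using \<open>e \<le> q\<close> assms(2) by (auto simp: e_def dest: dvd_imp_le)
qed

text \<open>
  So t^q - p is the minimal polynomial of each of its roots.
\<close>
lemma pure_poly_dvd_if_common_root:
  fixes p q :: nat and h :: "rat poly"
  assumes "prime p" "q > 0" "\<alpha> ^ q = of_nat p" "eval_rat h \<alpha> = 0"
  shows "(Polynomial.monom 1 q - [:of_nat p:]) dvd h"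
proof -
  let ?P = "Polynomial.monom 1 q - [:of_nat p:] :: rat poly"
  define d where "d = gcd ?P h"
  have degP: "Polynomial.degree ?P = q"
    using assms(2) by (rule degree_pure_poly)
  hence P0: "?P \<noteq> 0" using assms(2) by auto
  have Pa: "eval_rat ?P \<alpha> = 0" using assms(3) by (simp add: hom_distribs poly_monom)
  obtain a b where ab: "d = a * ?P + b * h"
    unfolding d_def using bezout_coefficients_fst_snd[of ?P h] by metis
  have "eval_rat d \<alpha> = 0"
    unfolding ab using Pa assms(4) by (simp add: hom_distribs)
  moreover have "monic d" unfolding d_def using P0 poly_gcd_monic by blast
  ultimately have "Polynomial.degree d \<noteq> 0" 
    by (metis monic_degree_0 hom_distribs(1) of_rat_complex_poly.hom_one poly_1 zero_neq_one)
  hence "Polynomial.degree d = q"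
    using monic_divisor_of_pure_poly_trivial[OF assms(1,2) _ \<open>monic d\<close>] d_def by auto
  moreover obtain c where c: "?P = d * c" unfolding d_def by (meson dvdE gcd_dvd1)
  ultimately have "Polynomial.degree c = 0" using degP P0
    by (metis add_cancel_right_right degree_mult_eq mult_eq_0_iff)
  hence "is_unit c" using c P0 by (metis is_unit_iff_degree mult_zero_right)
  hence "?P dvd d" using c by (simp add: mult_unit_dvd_iff)
  thus ?thesis unfolding d_def by (meson dvd_trans gcd_dvd2)
qed

text \<open>
  A factorisation over Z is one over Q after making a factor monic, so one factor is constant; its
  leading coefficient divides 1.
\<close>
lemma irreducible_pure_poly:
  fixes p q :: nat
  assumes "prime p" "q > 0"
  shows "irreducible (Polynomial.monom 1 q - [:int p:])"
proof -
  let ?P = "Polynomial.monom 1 q - [:int p:]"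
  have degP: "Polynomial.degree ?P = q"
    using assms(2) by (rule degree_pure_poly)
  have lc: "Polynomial.lead_coeff ?P = 1"
    unfolding degP using assms(2) by (simp add: coeff_pCons split: nat.splits)
  have unit: "is_unit a" if "Polynomial.degree a = 0" "a * b = ?P" for a b
  proof -
    obtain c where c: "a = [:c:]" using \<open>Polynomial.degree a = 0\<close> degree_eq_zeroE by blast
    have "Polynomial.lead_coeff (a * b) = 1" unfolding that(2) by (rule lc)
    hence "c * Polynomial.lead_coeff b = 1" by (auto simp: c lead_coeff_mult split: if_splits)
    hence "c dvd 1" by (metis dvd_triv_left)
    thus ?thesis unfolding c by (simp add: is_unit_const_poly_iff)
  qed
  show ?thesis
  proof (rule irreducibleI)
    show "?P \<noteq> 0" using degP assms(2) by auto
    show "\<not> is_unit ?P" using degP assms(2) by (metis is_unit_polyE degree_pCons_0 less_irrefl)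
    fix a b assume ab: "?P = a * b"
    have lab: "Polynomial.lead_coeff a * Polynomial.lead_coeff b = 1"
      using lc ab by (simp add: lead_coeff_mult)
    hence dab: "Polynomial.degree a + Polynomial.degree b = q"
      using degP ab by (metis degree_mult_eq leading_coeff_0_iff mult_eq_0_iff zero_neq_one)
    define s :: rat where "s = of_int (Polynomial.lead_coeff a)"
    have s: "s \<noteq> 0" using lab s_def by auto
    define d where "d = Polynomial.smult (inverse s) (of_int_poly a)"
    have "of_int_poly ?P = (of_int_poly a * of_int_poly b :: rat poly)"
      unfolding ab by (simp add: hom_distribs)
    also have "(of_int_poly ?P :: rat poly) = Polynomial.monom 1 q - [:of_nat p:]"
      by (simp add: hom_distribs)
    finally have "(of_int_poly a :: rat poly) dvd Polynomial.monom 1 q - [:of_nat p:]"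
      by (metis dvd_triv_left)
    hence "d dvd Polynomial.monom 1 q - [:of_nat p:]"
      unfolding d_def using s by (simp add: smult_dvd_iff)
    moreover have "Polynomial.degree d = Polynomial.degree a" using s by (simp add: d_def)
    moreover have "monic d" using s by (simp add: d_def s_def)
    ultimately have "Polynomial.degree a = 0 \<or> Polynomial.degree a = q"
      using monic_divisor_of_pure_poly_trivial[OF assms] by metis
    thus "is_unit a \<or> is_unit b" 
      using dab unit[of a b] unit[of b a] ab by (auto simp: mult.commute)
  qed
qed

text \<open>
  If m is a monic integer polynomial with root g(\<alpha>), then m composed with g vanishes at
  \<alpha>, hence at every root \<beta> of the minimal polynomial of \<alpha>.
\<close>
lemma algebraic_int_conjugate:
  fixes p q :: nat
  assumes "prime p" "q > 0" "\<alpha> ^ q = of_nat p" "\<beta> ^ q = of_nat p"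
    "algebraic_int (eval_rat g \<alpha>)"
  shows "algebraic_int (eval_rat g \<beta>)"
proof -
  obtain m where m: "poly (of_int_poly m) (eval_rat g \<alpha>) = 0" "monic m"
    using assms(5) unfolding algebraic_int_altdef_ipoly by blast
  let ?h = "pcompose (of_int_poly m) g :: rat poly"
  have ev: "eval_rat ?h x = poly (of_int_poly m) (eval_rat g x)" for x
    by (induction m) (simp_all add: pcompose_pCons hom_distribs)
  have "(Polynomial.monom 1 q - [:of_nat p:]) dvd ?h"
    using m by (intro pure_poly_dvd_if_common_root[OF assms(1-3)]) (simp add: ev)
  then obtain c where "?h = (Polynomial.monom 1 q - [:of_nat p:]) * c" by blast
  moreover have "eval_rat (Polynomial.monom 1 q - [:of_nat p:]) \<beta> = 0" 
    using assms(4) by (simp add: hom_distribs poly_monom)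
  ultimately have "eval_rat ?h \<beta> = 0" by (simp add: hom_distribs)
  thus ?thesis using m ev unfolding algebraic_int_altdef_ipoly by metis
qed

section \<open>Denominators of integral elements\<close>

lemma cis_root_of_unity: "q > 0 \<Longrightarrow> cis (2 * pi * real k / real q) ^ q = 1"
  by (simp add: Complex.DeMoivre cis_multiple_2pi)

text \<open>
  Both sides are monic polynomials in x of degree q with the same q roots. For x = p and y =
  \<alpha> this computes the norm of p - \<alpha>.
\<close>
lemma prod_rotated_roots:
  fixes x y :: complex
  assumes "q > 0"
  shows "(\<Prod>k<q. (x - y * cis (2 * pi * real k / real q))) = x ^ q - y ^ q"
proof (cases "y = 0")
  case True thus ?thesis using assms by (simp add: power_0_left)
next
  case False
  let ?r = "\<lambda>k. y * cis (2 * pi * real k / real q)"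
  have inj: "inj_on ?r {..<q}"
    using bij_betw_imp_inj_on[OF Complex.bij_betw_roots_unity[OF assms]] False by (auto simp: inj_on_def)
  let ?L = "\<Prod>k<q. [:- ?r k, 1:]" and ?R = "Polynomial.monom 1 q - [:y ^ q:]"
  have degL: "Polynomial.degree ?L = q" 
    by (subst degree_prod_eq_sum_degree) auto
  have degR: "Polynomial.degree ?R = q" by (rule degree_pure_poly[OF assms])
  have "?L = ?R"
  proof (rule poly_eqI_degree_lead_coeff[where n = q and A = "?r ` {..<q}"])
    have "Polynomial.lead_coeff ?L = 1" by (subst lead_coeff_prod) auto
    hence "poly.coeff ?L q = 1" unfolding degL .
    moreover have "poly.coeff ?R q = 1"
      using assms by (simp add: coeff_pCons split: nat.splits)
    ultimately show "poly.coeff ?L q = poly.coeff ?R q" by simp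
    show "card (?r ` {..<q}) \<ge> q" using card_image[OF inj] by simp
    fix z assume "z \<in> ?r ` {..<q}"
    then obtain k where k: "k < q" "z = ?r k" by auto
    have "poly ?L z = 0" unfolding poly_prod using k by (intro prod_zero) auto
    moreover have "z ^ q = y ^ q"
      using assms by (simp add: k(2) power_mult_distrib cis_root_of_unity)
    ultimately show "poly ?L z = poly ?R z" by (simp add: poly_monom)
  qed (use degL degR in auto)
  hence "poly ?L x = poly ?R x" by simp
  thus ?thesis by (simp add: poly_prod poly_monom)
qed

lemma power_rotated_root:
  assumes "q > 0" "y ^ q = (c :: complex)"
  shows "(y * cis (2 * pi * real k / real q)) ^ q = c"
  using assms by (simp add: power_mult_distrib cis_root_of_unity)

text \<open>
  A discrete Fourier transform over the conjugates: the terms of g with exponent other than i are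
  multiplied by complete sums of nontrivial powers of a q-th root of unity, which vanish.
\<close>
lemma sum_conjugates_twisted:
  fixes g :: "rat poly"
  assumes "q > 0" "i < q" "Polynomial.degree g < q"
  shows "(\<Sum>k<q. cis (- 2 * pi * real k * real i / real q) * 
            eval_rat g (\<alpha> * cis (2 * pi * real k / real q)))
         = of_nat q * of_rat (poly.coeff g i) * \<alpha> ^ i"
proof -
  define \<zeta> where "\<zeta> = cis (2 * pi / real q)"
  have cz: "cis (2 * pi * real k / real q) = \<zeta> ^ k" for k
    unfolding \<zeta>_def Complex.DeMoivre by (rule arg_cong[of _ _ cis]) simp
  have ci: "cis (- 2 * pi * real k * real i / real q) = inverse \<zeta> ^ (k * i)" for k
    unfolding \<zeta>_def cis_inverse Complex.DeMoivre by (rule arg_cong[of _ _ cis]) simp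
  have z0: "\<zeta> \<noteq> 0" by (simp add: \<zeta>_def)
  have orth: "(\<Sum>k<q. inverse \<zeta> ^ (k * i) * \<zeta> ^ (k * j)) = (if i = j then of_nat q else 0)" if j: "j < q" for j
  proof (cases "i = j")
    case True 
    thus ?thesis using z0 by (simp add: power_mult_distrib[symmetric] )
  next
    case False
    let ?w = "inverse \<zeta> ^ i * \<zeta> ^ j"
    have "?w \<noteq> 1"
    proof
      assume "?w = 1"
      hence "\<zeta> ^ j = \<zeta> ^ i" using z0 by (simp add: field_simps power_inverse)
      moreover have "inj_on (\<lambda>k. cis (2 * pi * real k / real q)) {..<q}"
        using bij_betw_imp_inj_on[OF Complex.bij_betw_roots_unity[OF assms(1)]] .
      ultimately have "j = i" using j assms(2) unfolding cz by (auto dest: inj_onD)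
      thus False using False by simp
    qed
    moreover have zq: "\<zeta> ^ q = 1" using cis_root_of_unity[OF assms(1), of 1] by (simp add: \<zeta>_def)
    have "?w ^ q = inverse (\<zeta> ^ q) ^ i * (\<zeta> ^ q) ^ j"
      unfolding power_mult_distrib power_inverse power_mult[symmetric] by (simp add: mult.commute)
    hence "?w ^ q = 1" unfolding zq by simp
    ultimately have "(\<Sum>k<q. ?w ^ k) = 0" by (simp add: geometric_sum)
    moreover have "inverse \<zeta> ^ (k * i) * \<zeta> ^ (k * j) = ?w ^ k" for k
      by (simp add: power_mult_distrib flip: power_mult) (simp add: mult.commute)
    ultimately show ?thesis using False by simp
  qed
  have ev: "eval_rat g x = (\<Sum>j<q. of_rat (poly.coeff g j) * x ^ j)" for x
  proof -
    have "eval_rat g x = (\<Sum>j\<le>Polynomial.degree g. of_rat (poly.coeff g j) * x ^ j)"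
      by (simp add: poly_altdef)
    also have "\<dots> = (\<Sum>j<q. of_rat (poly.coeff g j) * x ^ j)"
      using assms(3) by (intro sum.mono_neutral_left) (auto simp: coeff_eq_0)
    finally show ?thesis .
  qed
  have "(\<Sum>k<q. inverse \<zeta> ^ (k * i) * eval_rat g (\<alpha> * \<zeta> ^ k))
      = (\<Sum>k<q. \<Sum>j<q. of_rat (poly.coeff g j) * \<alpha> ^ j * (inverse \<zeta> ^ (k * i) * \<zeta> ^ (k * j)))"
    by (simp add: ev sum_distrib_left power_mult_distrib mult_ac flip: power_mult)
  also have "\<dots> = (\<Sum>j<q. of_rat (poly.coeff g j) * \<alpha> ^ j * (\<Sum>k<q. inverse \<zeta> ^ (k * i) * \<zeta> ^ (k * j)))"
    by (subst sum.swap) (simp add: sum_distrib_left)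
  also have "\<dots> = (\<Sum>j<q. if i = j then of_nat q * of_rat (poly.coeff g i) * \<alpha> ^ i else 0)"
    by (intro sum.cong) (auto simp: orth)
  finally show ?thesis using assms(2) unfolding cz ci by simp
qed

lemma algebraic_int_cis_rational:
  assumes "q > 0" shows "algebraic_int (cis (- 2 * pi * real k * real i / real q))"
proof -
  let ?z = "cis (- 2 * pi * real k * real i / real q)"
  have "?z ^ q = cis (2 * pi * (- of_nat (k * i)))"
    using assms unfolding Complex.DeMoivre by (intro arg_cong[of _ _ cis]) simp
  also have "\<dots> = 1" by (rule cis_multiple_2pi) auto
  finally have "?z ^ q = 1" .
  show ?thesis by (rule algebraic_int_if_power[OF assms]) (simp only: \<open>?z ^ q = 1\<close> algebraic_int_1)
qed

lemma of_rat_in_Ints_iff: "(of_rat r :: complex) \<in> \<int> \<longleftrightarrow> r \<in> \<int>"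
proof
  assume "(of_rat r :: complex) \<in> \<int>"
  then obtain n where "(of_rat r :: complex) = of_int n" by (auto elim: Ints_cases)
  hence "(of_rat r :: complex) = of_rat (of_int n)" by simp
  hence "r = of_int n" by (simp only: of_rat_eq_iff)
  thus "r \<in> \<int>" by simp
qed (auto elim!: Ints_cases)

lemma of_rat_in_Rats: "(of_rat r :: complex) \<in> \<rat>"
  by (simp add: Rats_def)

text \<open>
  The transform of the conjugates shows that q a_i \<alpha>^i is integral; its q-th power is
  rational, hence an integer.
\<close>
lemma coeff_times_degree_integral:
  fixes g :: "rat poly"
  assumes pq: "prime p" "q > 0" "Polynomial.degree g < q" and \<alpha>: "\<alpha> ^ q = of_nat p"
    and int: "algebraic_int (eval_rat g \<alpha>)"
  shows "of_nat q * poly.coeff g i \<in> \<int>"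
proof (cases "i < q")
  case True
  let ?c = "of_nat q * poly.coeff g i"
  have "algebraic_int (of_nat q * of_rat (poly.coeff g i) * \<alpha> ^ i)"
    unfolding sum_conjugates_twisted[OF pq(2) True pq(3), symmetric]
    by (intro algebraic_int_sum algebraic_int_add_mult algebraic_int_cis_rational pq(2)
        algebraic_int_conjugate[OF pq(1,2) \<alpha> power_rotated_root[OF pq(2) \<alpha>] int])
  hence "algebraic_int ((of_nat q * of_rat (poly.coeff g i) * \<alpha> ^ i) ^ q)" by (rule algebraic_int_power)
  also have "(of_nat q * of_rat (poly.coeff g i) * \<alpha> ^ i) ^ q = of_rat (?c ^ q * of_nat p ^ i)"
    by (simp add: power_mult_distrib of_rat_mult of_rat_power flip: \<alpha> power_mult)
       (simp add: mult.commute)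
  finally have "(of_rat (?c ^ q * of_nat p ^ i) :: complex) \<in> \<int>"
    by (rule rational_algebraic_int_is_int[OF _ of_rat_in_Rats])
  thus ?thesis unfolding of_rat_in_Ints_iff
    by (rule rational_is_int_if_scaled_power_is_int[OF pq(1) True])
qed (use pq in \<open>simp add: coeff_eq_0\<close>)

section \<open>Excluding the denominator q\<close>

lemma prime_dvd_power_diff_self:
  fixes p q :: nat
  assumes "prime q"
  shows "int q dvd int p ^ q - int p"
proof (cases "q dvd p")
  case True
  have "int q dvd int p" using True by simp
  thus ?thesis using prime_gt_0_nat[OF assms] by (intro dvd_diff) (auto intro: dvd_trans[OF _ dvd_power])
next
  case False
  have "[p ^ (q - 1) = 1] (mod q)" using fermat_theorem[OF assms False] .
  hence "[p * p ^ (q - 1) = p * 1] (mod q)" by (rule cong_scalar_left)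
  moreover have "p * p ^ (q - 1) = p ^ q" using prime_gt_0_nat[OF assms] by (metis power_minus_mult mult.commute)
  ultimately have "[p ^ q = p] (mod q)" by simp
  hence "[int (p ^ q) = int p] (mod (int q))" by (simp only: cong_int_iff)
  thus ?thesis by (simp add: cong_iff_dvd_diff)
qed

text \<open>
  Modulo q, the binomial expansion of (p - \<alpha>)^q reduces to p^q - \<alpha>^q = p^q - p,
  which q divides by Fermat.
\<close>
lemma algebraic_int_shift_power_div:
  fixes p q :: nat and \<alpha> :: complex
  assumes q: "prime q" "odd q" and \<alpha>: "\<alpha> ^ q = of_nat p"
  shows "algebraic_int ((of_nat p - \<alpha>) ^ q / of_nat q)"
proof -
  have q0: "q > 0" using q prime_gt_0_nat by blast
  have int\<alpha>: "algebraic_int \<alpha>"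
    by (rule algebraic_int_if_power[OF q0]) (simp add: \<alpha>)
  have "int q dvd int p ^ q - int p" using q(1) by (rule prime_dvd_power_diff_self)
  then obtain u where u: "int p ^ q - int p = int q * u" by blast
  have binom: "\<exists>c. q choose k = q * c" if "k \<in> {0<..<q}" for k
    using dvd_choose_prime[OF _ _ _ q(1), of k] that by (auto elim!: dvdE)
  then obtain c where c: "\<And>k. k \<in> {0<..<q} \<Longrightarrow> q choose k = q * c k" by metis
  have "(of_nat p - \<alpha>) ^ q = (- \<alpha> + of_nat p) ^ q" by simp
  also have "\<dots> = (\<Sum>k\<le>q. of_nat (q choose k) * (- \<alpha>) ^ k * of_nat p ^ (q - k))"
    by (rule binomial_ring)
  also have "{..q} = insert 0 (insert q {0<..<q})" using q0 by auto
  also have "(\<Sum>k\<in>\<dots>. of_nat (q choose k) * (- \<alpha>) ^ k * of_nat p ^ (q - k))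
    = of_nat p ^ q + ((- \<alpha>) ^ q + (\<Sum>k\<in>{0<..<q}. of_nat (q choose k) * (- \<alpha>) ^ k * of_nat p ^ (q - k)))"
    using q0 by (subst sum.insert; simp)+
  also have "(- \<alpha>) ^ q = - of_nat p" using q(2) \<alpha> by (simp add: power_minus_odd)
  also have "of_nat p ^ q + (- of_nat p + (\<Sum>k\<in>{0<..<q}. of_nat (q choose k) * (- \<alpha>) ^ k * of_nat p ^ (q - k)))
     = of_int (int p ^ q - int p) + (\<Sum>k\<in>{0<..<q}. of_nat (q choose k) * (- \<alpha>) ^ k * of_nat p ^ (q - k))"
    by simp
  also have "\<dots> = of_nat q * (of_int u + (\<Sum>k\<in>{0<..<q}. of_int (int (c k)) * (- \<alpha>) ^ k * of_int (int p ^ (q - k))))"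
    unfolding u by (simp add: c sum_distrib_left algebra_simps)
  finally have "(of_nat p - \<alpha>) ^ q / of_nat q
     = of_int u + (\<Sum>k\<in>{0<..<q}. of_int (int (c k)) * (- \<alpha>) ^ k * of_int (int p ^ (q - k)))"
    using q0 by simp
  also have "algebraic_int \<dots>"
    by (intro algebraic_int_add_mult algebraic_int_sum algebraic_int_of_int algebraic_int_power
          algebraic_int_minus int\<alpha>)
  finally show ?thesis .
qed

text \<open>
  With \<eta> = p - \<alpha> and m the least index whose coefficient H_m is prime to q, multiply
  H(\<eta>)/q by \<eta>^(q-1-m). The terms below m are integral because q divides their
  coefficients, those above m because they contain \<eta>^q / q. So H_m \<eta>^(q-1) / q is
  integral, while its norm H_m^q (p^q - p)^(q-1) / q^q is not.
\<close>
lemma dvd_coeffs_if_quotient_integral: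
  fixes p q :: nat and H :: "int poly" and \<alpha> :: complex
  assumes pq: "prime p" "prime q" "odd q" and nsq: "\<not> (int q)\<^sup>2 dvd int p ^ q - int p"
    and \<alpha>: "\<alpha> ^ q = of_nat p" and deg: "Polynomial.degree H < q"
    and int: "algebraic_int (poly (of_int_poly H) (of_nat p - \<alpha>) / of_nat q)"
  shows "int q dvd poly.coeff H i"
proof (rule ccontr)
  assume "\<not> int q dvd poly.coeff H i"
  define m where "m = (LEAST i. \<not> int q dvd poly.coeff H i)"
  have m: "\<not> int q dvd poly.coeff H m" 
    unfolding m_def by (rule LeastI) fact
  have below: "int q dvd poly.coeff H j" if "j < m" for j
    using not_less_Least that unfolding m_def by blast
  have q0: "q > 0" using pq prime_gt_0_nat by blast
  have mq: "m < q"
  proof (rule ccontr)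
    assume "\<not> m < q"
    hence "poly.coeff H m = 0" using deg by (intro coeff_eq_0) simp
    thus False using m by simp
  qed
  define \<eta> where "\<eta> = of_nat p - \<alpha>"
  have int\<eta>q: "algebraic_int (\<eta> ^ q / of_nat q)"
    unfolding \<eta>_def by (rule algebraic_int_shift_power_div[OF pq(2,3) \<alpha>])
  have int\<eta>: "algebraic_int \<eta>"
  proof -
    have "algebraic_int (of_int (int q) * (\<eta> ^ q / of_nat q))"
      by (intro algebraic_int_add_mult int\<eta>q) auto
    hence "algebraic_int (\<eta> ^ q)" using q0 by simp
    thus ?thesis by (rule algebraic_int_if_power[OF q0])
  qed
  let ?t = "\<lambda>j. of_int (poly.coeff H j) * \<eta> ^ (j + (q - 1 - m)) / of_nat q"
  define y where "y = of_int (poly.coeff H m) * \<eta> ^ (q - 1) / of_nat q"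
  have terms: "algebraic_int (?t j)" if "j \<noteq> m" for j
  proof (cases "j < m")
    case True
    then obtain h where "poly.coeff H j = int q * h" using below by blast
    hence "?t j = of_int h * \<eta> ^ (j + (q - 1 - m))" using q0 by simp
    thus ?thesis by (simp add: algebraic_int_add_mult algebraic_int_power int\<eta>)
  next
    case False
    hence "j + (q - 1 - m) = (j - m - 1) + q" using that mq by simp
    hence "?t j = of_int (poly.coeff H j) * \<eta> ^ (j - m - 1) * (\<eta> ^ q / of_nat q)" 
      by (simp add: power_add)
    also have "algebraic_int \<dots>"
      by (intro algebraic_int_add_mult algebraic_int_power int\<eta> int\<eta>q) auto
    finally show ?thesis .
  qed
  have "poly (of_int_poly H) \<eta> = (\<Sum>j\<le>Polynomial.degree H. of_int (poly.coeff H j) * \<eta> ^ j)"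
    by (simp add: poly_altdef)
  also have "\<dots> = (\<Sum>j<q. of_int (poly.coeff H j) * \<eta> ^ j)"
    using deg by (intro sum.mono_neutral_left) (auto simp: coeff_eq_0)
  finally have "poly (of_int_poly H) \<eta> / of_nat q * \<eta> ^ (q - 1 - m) = (\<Sum>j<q. ?t j)"
    by (simp only: sum_divide_distrib sum_distrib_right power_add) (simp add: mult_ac)
  also have "\<dots> = ?t m + (\<Sum>j\<in>{..<q}-{m}. ?t j)"
    using mq by (subst sum.remove[of _ m]) auto
  also have "?t m = y" using mq by (simp add: y_def)
  finally have "y = poly (of_int_poly H) \<eta> / of_nat q * \<eta> ^ (q - 1 - m) + - (\<Sum>j\<in>{..<q}-{m}. ?t j)"
    by simp
  also have "algebraic_int \<dots>"
    by (intro algebraic_int_add_mult algebraic_int_minus algebraic_int_sum terms algebraic_int_power int\<eta>)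
       (use int in \<open>auto simp: \<eta>_def\<close>)
  finally have inty: "algebraic_int y" .
  \<comment> \<open>a rational polynomial with value y at the root, so that the conjugates of y can be formed\<close>
  define G :: "rat poly" where 
    "G = Polynomial.smult (of_int (poly.coeff H m) / of_nat q) ([:of_nat p, -1:] ^ (q - 1))"
  have G: "eval_rat G x = of_int (poly.coeff H m) / of_nat q * (of_nat p - x) ^ (q - 1)" for x
    by (simp add: G_def hom_distribs of_rat_divide)
  have "eval_rat G \<alpha> = y" by (simp add: G y_def \<eta>_def)
  hence conj: "algebraic_int (eval_rat G (\<alpha> * cis (2 * pi * real k / real q)))" for k
    using algebraic_int_conjugate[OF pq(1) q0 \<alpha> power_rotated_root[OF q0 \<alpha>]] inty by metis
  define N where "N = (of_int (poly.coeff H m) / of_nat q) ^ q * (of_int (int p ^ q - int p) :: rat) ^ (q - 1)"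
  have "(\<Prod>k<q. eval_rat G (\<alpha> * cis (2 * pi * real k / real q)))
     = (of_int (poly.coeff H m) / of_nat q) ^ q * (\<Prod>k<q. of_nat p - \<alpha> * cis (2 * pi * real k / real q)) ^ (q - 1)"
    unfolding G prod.distrib prod_power_distrib by simp
  also have "\<dots> = of_rat N"
    unfolding prod_rotated_roots[OF q0] \<alpha> N_def
    by (simp add: of_rat_mult of_rat_power of_rat_divide of_rat_diff)
  finally have "algebraic_int (of_rat N :: complex)" 
    using algebraic_int_prod[of "{..<q}" "\<lambda>k. eval_rat G (\<alpha> * cis (2 * pi * real k / real q))"] conj
    by simp
  hence "N \<in> \<int>"
    using rational_algebraic_int_is_int[OF _ of_rat_in_Rats] of_rat_in_Ints_iff by blast
  then obtain n where n: "N = of_int n" by (auto elim: Ints_cases)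
  have "int q dvd int p ^ q - int p" using pq(2) by (rule prime_dvd_power_diff_self)
  then obtain u where u: "int p ^ q - int p = int q * u" by blast
  have "(of_int (poly.coeff H m ^ q * u ^ (q - 1)) * of_nat q ^ (q - 1) :: rat) = of_int n * of_nat q ^ q"
    using n q0 unfolding N_def u by (simp add: power_mult_distrib power_divide field_simps)
  also have "(of_nat q :: rat) ^ q = of_nat q * of_nat q ^ (q - 1)"
    using q0 by (metis power_minus_mult mult.commute)
  finally have "(of_int (poly.coeff H m ^ q * u ^ (q - 1)) :: rat) = of_int (n * int q)"
    using q0 by simp
  \<comment> \<open>u = (p^q - p)/q is prime to q, and so is the coefficient: the factor q on the right is one too many\<close>
  hence eq: "poly.coeff H m ^ q * u ^ (q - 1) = n * int q" by (simp only: of_int_eq_iff)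
  have "prime (int q)" using pq by simp
  moreover have "int q dvd poly.coeff H m ^ q * u ^ (q - 1)" unfolding eq by simp
  ultimately have "int q dvd u" using m 
    by (metis prime_dvd_mult_iff prime_dvd_power)
  hence "int q * int q dvd int q * u" by (rule mult_dvd_mono[OF dvd_refl])
  thus False using nsq u by (simp add: power2_eq_square)
qed

lemma poly_of_int_poly_pcompose:
  fixes x :: complex
  shows "poly (of_int_poly (pcompose f r)) x = poly (of_int_poly f) (poly (of_int_poly r) x)"
  by (induction f) (simp_all add: pcompose_pCons hom_distribs)

text \<open>
  The polynomial h = q g has integer coefficients. Expanding it around p, all coefficients of the
  expansion H are divisible by q, and this property survives the substitution back, which is again
  t to p - t.
\<close>
lemma integral_element_in_int_polys:
  fixes p q :: nat and g :: "rat poly"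
  assumes pq: "prime p" "prime q" "odd q" and nsq: "\<not> (int q)\<^sup>2 dvd int p ^ q - int p"
    and \<alpha>: "\<alpha> ^ q = of_nat p" and int: "algebraic_int (eval_rat g \<alpha>)"
  obtains f :: "int poly" where "eval_rat g \<alpha> = poly (of_int_poly f) \<alpha>"
proof -
  let ?P = "Polynomial.monom 1 q - [:of_nat p:] :: rat poly"
  have q0: "q > 0" using pq prime_gt_0_nat by blast
  have degP: "Polynomial.degree ?P = q" using q0 by (rule degree_pure_poly)
  define g' where "g' = g mod ?P"
  have deg_g': "Polynomial.degree g' < q"
    unfolding g'_def using degree_mod_less'[of ?P g] degP q0 
    by (metis degree_0 degree_mod_less less_numeral_extra(3))
  have "eval_rat ?P \<alpha> = 0" using \<alpha> by (simp add: hom_distribs poly_monom)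
  moreover have "?P * (g div ?P) + g' = g" unfolding g'_def by simp
  from arg_cong[OF this, of "\<lambda>f. eval_rat f \<alpha>"]
  have "eval_rat ?P \<alpha> * eval_rat (g div ?P) \<alpha> + eval_rat g' \<alpha> = eval_rat g \<alpha>"
    by (simp only: of_rat_complex_poly.hom_add of_rat_complex_poly.hom_mult poly_add poly_mult)
  ultimately have gg': "eval_rat g \<alpha> = eval_rat g' \<alpha>" by simp
  define h where "h = map_poly floor (Polynomial.smult (of_nat q) g')"
  have coeff_h: "of_int (poly.coeff h i) = of_nat q * poly.coeff g' i" for i
    using coeff_times_degree_integral[OF pq(1) q0 deg_g' \<alpha>, of i] int gg'
    by (auto simp: h_def coeff_map_poly elim!: Ints_cases)
  have h: "of_int_poly h = Polynomial.smult (of_nat q) g'"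
    by (intro poly_eqI) (simp add: coeff_h)
  have ev_h: "poly (of_int_poly h) \<alpha> = of_nat q * eval_rat g' \<alpha>"
  proof -
    have "(of_int_poly h :: complex poly) = map_poly of_rat (of_int_poly h)"
      by (simp add: map_poly_map_poly o_def)
    thus ?thesis by (simp add: h hom_distribs)
  qed
  have "Polynomial.degree (of_int_poly h :: rat poly) < q"
    using \<open>Polynomial.degree g' < q\<close> q0 unfolding h by simp
  hence deg_h: "Polynomial.degree h < q" by simp
  define H where "H = pcompose h [:int p, -1:]"
  have hH: "h = pcompose H [:int p, -1:]"
    unfolding H_def by (simp add: pcompose_assoc[symmetric] pcompose_pCons)
  have ev_comp: "poly (of_int_poly (pcompose f [:int p, -1:])) x = poly (of_int_poly f) (of_nat p - x)" 
    for f and x :: complex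
    by (simp add: poly_of_int_poly_pcompose)
  have "int q dvd poly.coeff H i" for i
  proof (rule dvd_coeffs_if_quotient_integral[OF pq nsq \<alpha>])
    show "Polynomial.degree H < q" unfolding H_def using deg_h by simp
    have "poly (of_int_poly H) (of_nat p - \<alpha>) = of_nat q * eval_rat g' \<alpha>"
      unfolding H_def ev_comp using ev_h by simp
    thus "algebraic_int (poly (of_int_poly H) (of_nat p - \<alpha>) / of_nat q)"
      using int gg' q0 by simp
  qed
  hence "[:int q:] dvd H" by (simp add: const_poly_dvd_iff)
  then obtain H' where "H = [:int q:] * H'" by blast
  hence "h = Polynomial.smult (int q) (pcompose H' [:int p, -1:])"
    unfolding hH by (simp add: pcompose_smult)
  hence "of_nat q * eval_rat g' \<alpha> = of_nat q * poly (of_int_poly (pcompose H' [:int p, -1:])) \<alpha>"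
    using ev_h by (auto simp: hom_distribs)
  hence "eval_rat g \<alpha> = poly (of_int_poly (pcompose H' [:int p, -1:])) \<alpha>"
    using q0 gg' by simp
  thus ?thesis by (rule that)
qed

section \<open>Monogenicity of t^q - p\<close>

lemma complex_ring_simps [simp]:
  "carrier complex_ring = UNIV" "monoid.mult complex_ring = (*)" "monoid.one complex_ring = 1"
  "ring.zero complex_ring = 0" "ring.add complex_ring = (+)"
  by (auto simp: ring_of_type_algebra_def)

interpretation complex_ring: domain complex_ring
  using field_from_type_algebra by (rule field.axioms(1))

lemma complex_ring_a_inv [simp]: "a_inv complex_ring x = - x"
  using complex_ring.add.inv_equality[of "- x" x] by simp

lemma complex_ring_m_inv [simp]: "x \<noteq> 0 \<Longrightarrow> m_inv complex_ring x = inverse x"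
  using complex_ring.comm_inv_char[of x "inverse x"] by simp

lemma subfield_Rats: "subfield \<rat> complex_ring"
proof (rule field.subfieldI'[OF field_from_type_algebra])
  show "subring \<rat> complex_ring" by (rule complex_ring.subringI) auto
  fix k :: complex assume "k \<in> \<rat> - {ring.zero complex_ring}"
  thus "m_inv complex_ring k \<in> \<rat>" by auto
qed

lemma of_int_in_subring:
  assumes "subring K complex_ring"
  shows "of_int n \<in> K"
proof (induction n rule: int_induct[of _ 0])
  case base
  show ?case using subringE(2)[OF assms] by simp
next
  case (step1 i)
  thus ?case using subringE(7)[OF assms step1(2) subringE(3)[OF assms]] by simp
next
  case (step2 i)
  thus ?case using subringE(7)[OF assms step2(2) subringE(5)[OF assms subringE(3)[OF assms]]] by simp
qed

lemma generate_ring_eq_int_polys: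
  "generate_ring complex_ring {\<alpha>} = range (\<lambda>f :: int poly. poly (of_int_poly f) \<alpha>)"
proof (intro equalityI subsetI)
  fix x assume "x \<in> generate_ring complex_ring {\<alpha>}"
  thus "x \<in> range (\<lambda>f :: int poly. poly (of_int_poly f) \<alpha>)"
  proof (induction rule: generate_ring.induct)
    case one
    show ?case by (rule range_eqI[of _ _ 1]) simp
  next
    case (incl h)
    thus ?case by (intro range_eqI[of _ _ "[:0, 1:]"]) (simp add: hom_distribs)
  next
    case (a_inv h)
    then obtain f where "h = poly (of_int_poly f) \<alpha>" by auto
    thus ?case by (intro range_eqI[of _ _ "- f"]) (simp add: hom_distribs)
  next
    case (eng_add h1 h2)
    then obtain f g where "h1 = poly (of_int_poly f) \<alpha>" "h2 = poly (of_int_poly g) \<alpha>" by auto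
    thus ?case by (intro range_eqI[of _ _ "f + g"]) (simp add: hom_distribs)
  next
    case (eng_mult h1 h2)
    then obtain f g where "h1 = poly (of_int_poly f) \<alpha>" "h2 = poly (of_int_poly g) \<alpha>" by auto
    thus ?case by (intro range_eqI[of _ _ "f * g"]) (simp add: hom_distribs)
  qed
next
  have sub: "subring (generate_ring complex_ring {\<alpha>}) complex_ring"
    by (rule complex_ring.generate_ring_is_subring) simp
  note of_int = of_int_in_subring[OF sub]
  have mem: "poly (of_int_poly f) \<alpha> \<in> generate_ring complex_ring {\<alpha>}" for f
  proof (induction f)
    case 0
    show ?case using subringE(2)[OF sub] by simp
  next
    case (pCons a f)
    have "\<alpha> \<in> generate_ring complex_ring {\<alpha>}" by (rule generate_ring.incl) simp
    hence "\<alpha> * poly (of_int_poly f) \<alpha> \<in> generate_ring complex_ring {\<alpha>}"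
      using subringE(6)[OF sub _ pCons(2)] by simp
    thus ?case using subringE(7)[OF sub of_int[of a]] by (simp add: hom_distribs)
  qed
  fix x assume "x \<in> range (\<lambda>f :: int poly. poly (of_int_poly f) \<alpha>)"
  thus "x \<in> generate_ring complex_ring {\<alpha>}" using mem by auto
qed

lemma simple_extension_Rats_poly:
  assumes "x \<in> complex_ring.simple_extension \<rat> \<alpha>"
  obtains g where "x = eval_rat g \<alpha>"
  using assms
proof (induction arbitrary: thesis rule: complex_ring.simple_extension.induct)
  case zero
  show ?case by (rule zero[of 0]) simp
next
  case (lin k1 k2)
  obtain g where g: "k1 = eval_rat g \<alpha>" using lin.IH by blast
  obtain r where r: "k2 = of_rat r" using lin.hyps by (auto elim: Rats_cases)
  show ?case by (rule lin.prems[of "pCons r g"]) (simp add: g r hom_distribs mult.commute)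
qed

lemma complex_ring_nat_pow [simp]: "pow complex_ring (x :: complex) (n :: nat) = x ^ n"
  by (induction n) (simp_all add: mult.commute)

lemma simple_extension_Rats_pure_root:
  assumes "q > 0" "\<alpha> ^ q = of_nat p"
  shows "complex_ring.finite_dimension \<rat> (complex_ring.simple_extension \<rat> \<alpha>)"
    and "subfield (complex_ring.simple_extension \<rat> \<alpha>) complex_ring"
proof -
  let ?f = "1 # replicate (q - 1) 0 @ [- of_nat p] :: complex list"
  have ev_rep: "complex_ring.eval (replicate n 0 @ [c]) \<alpha> = c" for n c
    by (induction n) auto
  have "complex_ring.eval ?f \<alpha> = 0"
    using assms by (simp add: ev_rep)
  moreover have "?f \<in> carrier (univ_poly complex_ring \<rat>)"
    by (auto simp: univ_poly_carrier[symmetric] polynomial_def)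
  ultimately have alg: "((\<lambda>K x. \<not> complex_ring.transcendental K x) over \<rat>) \<alpha>"
    by (intro complex_ring.algebraicI[of ?f]) auto
  show "complex_ring.finite_dimension \<rat> (complex_ring.simple_extension \<rat> \<alpha>)"
    using complex_ring.finite_dimension_simple_extension[OF subfield_Rats, of \<alpha>] alg by simp
  show "subfield (complex_ring.simple_extension \<rat> \<alpha>) complex_ring"
    using complex_ring.simple_extension_is_subfield[OF subfield_Rats, of \<alpha>] alg by simp
qed

text \<open>
  The subfield contains the integers, hence the rationals, hence all rational polynomials in
  \<alpha>.
\<close>
lemma generate_field_eq_simple_extension:
  assumes "subfield (complex_ring.simple_extension \<rat> \<alpha>) complex_ring"
  shows "generate_field complex_ring {\<alpha>} = complex_ring.simple_extension \<rat> \<alpha>"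
proof
  have sr: "subring \<rat> complex_ring" using subfieldE(1)[OF subfield_Rats] .
  show "generate_field complex_ring {\<alpha>} \<subseteq> complex_ring.simple_extension \<rat> \<alpha>"
    using complex_ring.simple_extension_mem[OF sr]
    by (intro field.generate_field_min_subfield1[OF field_from_type_algebra] assms) auto
  have sf: "subfield (generate_field complex_ring {\<alpha>}) complex_ring"
    by (rule field.generate_field_is_subfield[OF field_from_type_algebra]) simp
  note sub = subfieldE(1)[OF sf]
  let ?K = "generate_field complex_ring {\<alpha>}"
  note of_int = of_int_in_subring[OF sub]
  have "\<rat> \<subseteq> ?K"
  proof
    fix x :: complex assume "x \<in> \<rat>"
    then obtain a b where x: "x = of_int a / of_int b" "b \<noteq> 0" by (auto elim: Rats_cases')
    have "inverse (of_int b) \<in> ?K" 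
      using generate_field.m_inv[OF of_int[of b]] x(2) by simp
    from subringE(6)[OF sub of_int[of a] this] show "x \<in> ?K" by (simp add: x divide_inverse)
  qed
  thus "complex_ring.simple_extension \<rat> \<alpha> \<subseteq> ?K"
    by (intro complex_ring.simple_extension_subring_incl sub) (auto intro: generate_field.incl)
qed

text \<open>
  The hypothesis says that q divides the norm p^q - p of p - \<alpha> exactly once, so every
  integer of the field is an integer polynomial in \<alpha>. The conjugates of \<alpha> are
  treated alike, as only \<alpha>^q = p enters.
\<close>
theorem monogenic_pure_poly:
  fixes p q :: nat
  assumes pq: "prime p" "prime q" "odd q" and nsq: "\<not> (int q)\<^sup>2 dvd int p ^ q - int p"
  shows "monogenic_poly (Polynomial.monom 1 q - [:int p:])"
  unfolding monogenic_poly_def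
proof (intro conjI allI impI)
  have q0: "q > 0" using pq prime_gt_0_nat by blast
  have degP: "Polynomial.degree (Polynomial.monom 1 q - [:int p:]) = q"
    by (rule degree_pure_poly[OF q0])
  show "Polynomial.lead_coeff (Polynomial.monom 1 q - [:int p:]) = 1"
    unfolding degP using q0 by (simp add: coeff_pCons split: nat.splits)
  show "irreducible (Polynomial.monom 1 q - [:int p:])"
    by (rule irreducible_pure_poly[OF pq(1) q0])
  fix \<alpha> :: complex
  assume "poly (of_int_poly (Polynomial.monom 1 q - [:int p:])) \<alpha> = 0"
  hence \<alpha>: "\<alpha> ^ q = of_nat p" by (simp add: hom_distribs poly_monom)
  note ext = simple_extension_Rats_pure_root[OF q0 \<alpha>]
  let ?K = "generate_field complex_ring {\<alpha>}"
  have K: "?K = complex_ring.simple_extension \<rat> \<alpha>"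
    using ext generate_field_eq_simple_extension by blast
  have int\<alpha>: "algebraic_int \<alpha>"
    by (rule algebraic_int_if_power[OF q0]) (simp add: \<alpha>)
  have \<alpha>K: "\<alpha> \<in> ?K" by (rule generate_field.incl) simp
  have ring_sub: "generate_ring complex_ring {\<alpha>} \<subseteq> ?K"
    using \<alpha>K by (intro complex_ring.generate_ring_min_subring1 subfieldE(1)) (use ext K in auto)
  have "ring_of_integers ?K = generate_ring complex_ring {\<alpha>}"
  proof (intro equalityI subsetI)
    fix x assume "x \<in> ring_of_integers ?K"
    hence x: "x \<in> complex_ring.simple_extension \<rat> \<alpha>" "algebraic_int x"
      by (auto simp: ring_of_integers_def K)
    obtain g where g: "x = eval_rat g \<alpha>" using simple_extension_Rats_poly[OF x(1)] .
    obtain f where "x = poly (of_int_poly f) \<alpha>"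
      using integral_element_in_int_polys[OF pq nsq \<alpha>, of g] x(2) g by metis
    thus "x \<in> generate_ring complex_ring {\<alpha>}" unfolding generate_ring_eq_int_polys by blast
  next
    fix x assume x: "x \<in> generate_ring complex_ring {\<alpha>}"
    hence "algebraic_int x" 
      unfolding generate_ring_eq_int_polys using algebraic_int_poly[OF int\<alpha>] by auto
    thus "x \<in> ring_of_integers ?K" using x ring_sub by (auto simp: ring_of_integers_def)
  qed
  moreover have "number_field ?K" using ext by (simp add: number_field_def K)
  moreover have "\<alpha> \<in> ring_of_integers ?K" using int\<alpha> \<alpha>K by (simp add: ring_of_integers_def)
  ultimately show "monogenic_field ?K" unfolding monogenic_field_def by blast
qed

section \<open>Powers n^(-s) and elementary estimates\<close>

text \<open>
  The power n^(-s). Through the exponential it is entire in s for every n, with the convention ln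
  0 = 0 giving npow 0 s = 1.
\<close>
definition npow :: "nat \<Rightarrow> complex \<Rightarrow> complex" where
  "npow n s = exp (- s * of_real (ln (real n)))"

lemma npow_1_left [simp]: "npow (Suc 0) s = 1" by (simp add: npow_def)

lemma npow_0_right [simp]: "npow n 0 = 1" by (simp add: npow_def)

lemma npow_add: "npow n (s + t) = npow n s * npow n t"
  by (simp add: npow_def ring_distribs flip: exp_add)

lemma npow_mult: "m > 0 \<Longrightarrow> n > 0 \<Longrightarrow> npow (m * n) s = npow m s * npow n s"
  by (simp add: npow_def ring_distribs ln_mult flip: exp_add)

lemma npow_1_right: "n > 0 \<Longrightarrow> npow n 1 = 1 / of_nat n"
proof -
  assume n: "n > 0"
  have "npow n 1 = of_real (exp (- ln (real n)))" by (simp add: npow_def flip: exp_of_real)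
  thus ?thesis using n by (simp add: exp_minus divide_simps)
qed

lemma norm_npow: "n > 0 \<Longrightarrow> norm (npow n s) = real n powr (- Re s)"
  by (simp add: npow_def powr_def)

lemma npow_of_real: "n > 0 \<Longrightarrow> npow n (of_real x) = of_real (real n powr (-x))"
  by (simp add: npow_def powr_def flip: exp_of_real)

lemma npow_has_field_derivative [derivative_intros]:
  assumes "(f has_field_derivative f') (at z within A)"
  shows "((\<lambda>z. npow n (f z)) has_field_derivative (- of_real (ln (real n)) * f' * npow n (f z))) (at z within A)"
  unfolding npow_def by (rule derivative_eq_intros assms refl | simp)+

lemma holomorphic_on_npow [holomorphic_intros]:
  "f holomorphic_on A \<Longrightarrow> (\<lambda>z. npow n (f z)) holomorphic_on A"
  unfolding npow_def by (intro holomorphic_intros)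

lemma continuous_on_npow [continuous_intros]:
  "continuous_on A f \<Longrightarrow> continuous_on A (\<lambda>z. npow n (f z))"
  unfolding npow_def by (intro continuous_intros)

text \<open>
  Mean value theorem for t^(-x) on the interval [n, n + 1]; summing over n bounds the tail of the
  zeta series without integrals.
\<close>
lemma powr_neg_telescope_le:
  assumes "x > 0" "n > 0"
  shows "x * real (Suc n) powr (-1-x) \<le> real n powr (-x) - real (Suc n) powr (-x)"
proof -
  have "\<exists>z. z > real n \<and> z < real (Suc n) \<and> 
       (\<lambda>t. t powr (-x)) (real (Suc n)) - (\<lambda>t. t powr (-x)) (real n) = (real (Suc n) - real n) * (-x * z powr (-x-1))"
    using assms by (intro MVT2) (auto intro!: derivative_eq_intros)
  then obtain z where z: "z > real n" "z < real (Suc n)"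
     "real (Suc n) powr (-x) - real n powr (-x) = -x * z powr (-x-1)" by auto
  have "real (Suc n) powr (-x-1) \<le> z powr (-x-1)"
    using z assms by (intro powr_mono2') auto
  hence "x * real (Suc n) powr (-x-1) \<le> x * z powr (-x-1)" using assms by simp
  hence "x * real (Suc n) powr (-x-1) \<le> real n powr (-x) - real (Suc n) powr (-x)"
    using z(3) by linarith
  moreover have "-1 - x = - x - 1" by simp
  ultimately show ?thesis by (simp only:)
qed

lemma sum_powr_neg_tail:
  assumes "x > 0" "N > 0"
  shows "summable (\<lambda>n. real (Suc (n + N)) powr (-1-x))"
    and "(\<Sum>n. real (Suc (n + N)) powr (-1-x)) \<le> real N powr (-x) / x"
proof -
  let ?t = "\<lambda>n. (real (n + N) powr (-x) - real (Suc n + N) powr (-x)) / x"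
  have "(\<lambda>n. real (n + N) powr (-x)) \<longlonglongrightarrow> 0"
    using assms by real_asymp
  from telescope_sums'[OF this] have "?t sums (real N powr (-x) / x)"
    by (intro sums_divide) simp
  note t = this
  have le: "real (Suc (n + N)) powr (-1-x) \<le> ?t n" for n
    using powr_neg_telescope_le[OF assms(1), of "n + N"] assms by (simp add: field_simps)
  show summ: "summable (\<lambda>n. real (Suc (n + N)) powr (-1-x))"
    by (rule summable_comparison_test_ev[OF always_eventually sums_summable[OF t]])
       (use le in \<open>auto simp: powr_nonneg_iff\<close>)
  show "(\<Sum>n. real (Suc (n + N)) powr (-1-x)) \<le> real N powr (-x) / x"
    using suminf_le[OF le summ sums_summable[OF t]] sums_unique[OF t] by simp
qed

text \<open>
  For x \<le> 1 the summand is at most the increment of t^x / x to its left, for x \<ge> 1 at most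
  the increment to its right; in the second case the last summand is estimated separately.
\<close>
lemma sum_powr_pos_le:
  assumes "x > 0" "N > 0"
  shows "(\<Sum>n<N. real (Suc n) powr (x-1)) \<le> real N powr x / x + real N powr (x-1)"
proof (cases "x \<le> 1")
  case True
  have le: "real (Suc n) powr (x-1) \<le> (real (Suc n) powr x - real n powr x) / x" for n
  proof (cases "n = 0")
    case False
    have "\<exists>z. z > real n \<and> z < real (Suc n) \<and> 
         (\<lambda>t. t powr x) (real (Suc n)) - (\<lambda>t. t powr x) (real n) = (real (Suc n) - real n) * (x * z powr (x-1))"
      using assms False by (intro MVT2) (auto intro!: derivative_eq_intros)
    then obtain z where z: "z > real n" "z < real (Suc n)"
       "real (Suc n) powr x - real n powr x = x * z powr (x-1)" by auto
    have "real (Suc n) powr (x-1) \<le> z powr (x-1)"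
      using z assms True by (intro powr_mono2') auto
    thus ?thesis using z(3) assms by (simp add: field_simps)
  qed (use assms True in auto)
  have "(\<Sum>n<N. real (Suc n) powr (x-1)) \<le> (\<Sum>n<N. (real (Suc n) powr x - real n powr x) / x)"
    by (intro sum_mono le)
  also have "\<dots> = real N powr x / x"
    by (subst sum_divide_distrib [symmetric], subst sum_lessThan_telescope) simp
  finally show ?thesis by (simp add: add_increasing2)
next
  case False
  have le: "real (Suc n) powr (x-1) \<le> (real (Suc (Suc n)) powr x - real (Suc n) powr x) / x" for n
  proof -
    have "\<exists>z. z > real (Suc n) \<and> z < real (Suc (Suc n)) \<and> 
         (\<lambda>t. t powr x) (real (Suc (Suc n))) - (\<lambda>t. t powr x) (real (Suc n)) = (real (Suc (Suc n)) - real (Suc n)) * (x * z powr (x-1))"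
      using assms by (intro MVT2) (auto intro!: derivative_eq_intros)
    then obtain z where z: "z > real (Suc n)" "z < real (Suc (Suc n))"
       "real (Suc (Suc n)) powr x - real (Suc n) powr x = x * z powr (x-1)" by auto
    have "real (Suc n) powr (x-1) \<le> z powr (x-1)"
      using z assms False by (intro powr_mono2) auto
    thus ?thesis using z(3) assms by (simp add: field_simps)
  qed
  obtain M where M: "N = Suc M" using assms by (cases N) auto
  have "(\<Sum>n<M. real (Suc n) powr (x-1)) \<le> (\<Sum>n<M. (real (Suc (Suc n)) powr x - real (Suc n) powr x) / x)"
    by (intro sum_mono le)
  also have "\<dots> = (real (Suc M) powr x - 1) / x"
    by (subst sum_divide_distrib [symmetric], subst sum_lessThan_telescope) simp
  also have "\<dots> \<le> real N powr x / x" using assms M by (simp add: divide_right_mono)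
  finally show ?thesis by (simp add: M)
qed

text \<open>
  A Riemann-Lebesgue lemma: on the imaginary axis N^z has absolute value 1, and its antiderivative
  N^z / ln N allows one integration by parts, which gains the factor 1 / ln N.
\<close>
lemma contour_integral_vertical_oscillating_tendsto_0:
  assumes hol: "\<psi> holomorphic_on U" "open U" and sub: "{z. Re z \<ge> 0} \<subseteq> U" and R: "R > 0"
  shows "(\<lambda>N. contour_integral (linepath (\<i> * of_real R) (- \<i> * of_real R)) (\<lambda>z. \<psi> z * npow N (- z))) \<longlonglongrightarrow> 0"
proof -
  let ?L = "linepath (\<i> * of_real R) (- \<i> * of_real R)"
  have ReL: "Re z = 0" if "z \<in> path_image ?L" for z
    using that by (auto simp: closed_segment_def)
  hence LU: "path_image ?L \<subseteq> U" using sub by auto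
  have hol': "deriv \<psi> holomorphic_on U" using hol by (rule holomorphic_deriv)
  have compact: "compact (path_image ?L)" by (rule compact_path_image) simp
  have "\<exists>M. \<forall>z\<in>path_image ?L. norm (\<psi> z) \<le> M"
    using compact_imp_bounded[OF compact_continuous_image[OF _ compact, of \<psi>]]
      holomorphic_on_imp_continuous_on[OF holomorphic_on_subset[OF hol(1) LU]]
    by (auto simp: bounded_iff)
  then obtain M where M: "\<And>z. z \<in> path_image ?L \<Longrightarrow> norm (\<psi> z) \<le> M" by blast
  have "\<exists>M. \<forall>z\<in>path_image ?L. norm (deriv \<psi> z) \<le> M"
    using compact_imp_bounded[OF compact_continuous_image[OF _ compact, of "deriv \<psi>"]]
      holomorphic_on_imp_continuous_on[OF holomorphic_on_subset[OF hol' LU]]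
    by (auto simp: bounded_iff)
  then obtain M' where M': "\<And>z. z \<in> path_image ?L \<Longrightarrow> norm (deriv \<psi> z) \<le> M'" by blast
  have ends: "\<i> * of_real R \<in> path_image ?L" "- \<i> * of_real R \<in> path_image ?L" by auto
  have M0: "M' \<ge> 0" using M'[OF ends(1)] norm_ge_zero order_trans by blast
  have nrm: "norm (npow N (- z)) = 1" if "z \<in> path_image ?L" "N > 0" for z N
    using ReL[OF that(1)] that(2) by (simp add: norm_npow)
  have bound: "norm (contour_integral ?L (\<lambda>z. \<psi> z * npow N (- z))) \<le> (2 * M + 2 * R * M') / ln (real N)"
    if N: "N > 1" for N
  proof -
    let ?l = "of_real (ln (real N)) :: complex"
    have l0: "?l \<noteq> 0" using N by simp
    let ?F = "\<lambda>z. \<psi> z * npow N (- z) / ?l"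
    have der: "(?F has_field_derivative (deriv \<psi> z * npow N (- z) / ?l + \<psi> z * npow N (- z))) (at z within path_image ?L)"
      if "z \<in> path_image ?L" for z
    proof -
      have "(\<psi> has_field_derivative deriv \<psi> z) (at z within path_image ?L)"
        using holomorphic_derivI[OF hol, of z] LU that by (auto intro: has_field_derivative_at_within)
      thus ?thesis using l0 by (auto intro!: derivative_eq_intros simp: field_simps)
    qed
    have total: "((\<lambda>z. deriv \<psi> z * npow N (- z) / ?l + \<psi> z * npow N (- z)) has_contour_integral
            ?F (- \<i> * of_real R) - ?F (\<i> * of_real R)) ?L"
      using contour_integral_primitive[OF der, of ?L] by simp
    have int': "(\<lambda>z. deriv \<psi> z * npow N (- z) / ?l) contour_integrable_on ?L"
      by (intro contour_integrable_continuous_linepath continuous_intros l0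
           holomorphic_on_imp_continuous_on holomorphic_on_subset[OF hol'])
         (use LU N in auto)
    have eq: "contour_integral ?L (\<lambda>z. \<psi> z * npow N (- z)) = 
        ?F (- \<i> * of_real R) - ?F (\<i> * of_real R) - contour_integral ?L (\<lambda>z. deriv \<psi> z * npow N (- z) / ?l)"
      using has_contour_integral_diff[OF total has_contour_integral_integral[OF int']]
      by (intro contour_integral_unique) simp
    have lpos: "ln (real N) > 0" using N by simp
    have 1: "norm (?F z) \<le> M / ln (real N)" if "z \<in> path_image ?L" for z
      using M[OF that] nrm[OF that] N lpos by (simp add: norm_mult norm_divide divide_right_mono)
    have 2: "norm (contour_integral ?L (\<lambda>z. deriv \<psi> z * npow N (- z) / ?l)) 
        \<le> M' / ln (real N) * norm (- \<i> * of_real R - \<i> * of_real R)"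
      using M0 lpos N nrm M'
      by (intro contour_integral_bound_linepath int')
         (auto simp: norm_mult norm_divide divide_right_mono)
    have "norm (- \<i> * of_real R - \<i> * of_real R) = 2 * R" 
    proof -
      have "- \<i> * of_real R - \<i> * of_real R = - 2 * \<i> * of_real R" by simp
      thus ?thesis using R by (simp only: norm_mult) simp
    qed
    with 2 have 2: "norm (contour_integral ?L (\<lambda>z. deriv \<psi> z * npow N (- z) / ?l)) \<le> M' / ln (real N) * (2 * R)"
      by simp
    have "norm (contour_integral ?L (\<lambda>z. \<psi> z * npow N (- z))) \<le> M / ln (real N) + M / ln (real N) + M' / ln (real N) * (2 * R)"
      unfolding eq by (intro norm_triangle_le_diff add_mono 1 2 ends)
    also have "\<dots> = (2 * M + 2 * R * M') / ln (real N)" by (simp add: add_divide_distrib)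
    finally show ?thesis .
  qed
  have "(\<lambda>N. (2 * M + 2 * R * M') / ln (real N)) \<longlonglongrightarrow> 0" by real_asymp
  moreover have "\<forall>\<^sub>F N in sequentially. norm (contour_integral ?L (\<lambda>z. \<psi> z * npow N (- z))) \<le> (2 * M + 2 * R * M') / ln (real N)"
    using eventually_gt_at_top[of 1] by eventually_elim (rule bound)
  ultimately show ?thesis by (rule Lim_null_comparison[rotated])
qed

section \<open>Newman's Tauberian theorem\<close>

abbreviation half_circle :: "real \<Rightarrow> real \<Rightarrow> complex" where
  "half_circle R \<equiv> part_circlepath 0 R (- pi / 2) (pi / 2)"

abbreviation imag_segment :: "real \<Rightarrow> real \<Rightarrow> complex" where
  "imag_segment R \<equiv> linepath (\<i> * of_real R) (- \<i> * of_real R)"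

lemma half_circle_ends:
  "pathstart (half_circle R) = - \<i> * of_real R" "pathfinish (half_circle R) = \<i> * of_real R"
proof -
  have "cis (- pi / 2) = - \<i>" "cis (pi / 2) = \<i>" by (auto simp: complex_eq_iff)
  thus "pathstart (half_circle R) = - \<i> * of_real R" "pathfinish (half_circle R) = \<i> * of_real R"
    by (simp_all add: cis_conv_exp)
qed

lemma in_half_circle:
  assumes "R > 0" "z \<in> path_image (half_circle R)"
  shows "norm z = R" "Re z \<ge> 0" "z \<noteq> 0"
proof -
  obtain x where x: "z = of_real R * exp (\<i> * of_real x)" "- pi / 2 \<le> x" "x \<le> pi / 2"
    using assms(2) by (subst (asm) path_image_part_circlepath) auto
  have z: "z = of_real R * cis x" using x by (simp add: cis_conv_exp)
  thus 1: "norm z = R" using assms by (simp add: norm_mult)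
  have "cos x \<ge> 0" using x by (intro cos_ge_zero) auto
  thus "Re z \<ge> 0" using z assms by simp
  show "z \<noteq> 0" using 1 assms by auto
qed

lemma in_imag_segment: "z \<in> path_image (imag_segment R) \<Longrightarrow> Re z = 0"
  by (auto simp: closed_segment_def)

text \<open>
  Cauchy's theorem for the closed half disk, the imaginary segment being run downwards.
\<close>
lemma half_circle_integral_eq_imag_segment:
  assumes hol: "f holomorphic_on U" "open U" and sub: "{z. Re z \<ge> 0} \<subseteq> U" and R: "R > 0"
  shows "contour_integral (half_circle R) f = - contour_integral (imag_segment R) f"
proof -
  have cont: "continuous_on {z. Re z \<ge> 0} f"
    using holomorphic_on_imp_continuous_on[OF holomorphic_on_subset[OF hol(1) sub]] .
  have imgs: "path_image (half_circle R) \<subseteq> {z. Re z \<ge> 0}" "path_image (imag_segment R) \<subseteq> {z. Re z \<ge> 0}"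
    by (auto intro: in_half_circle(2)[OF R] simp: closed_segment_def)
  have "(f has_contour_integral 0) (half_circle R +++ imag_segment R)"
  proof (rule Cauchy_theorem_convex[OF cont, where K = "{}"])
    show "convex {z. Re z \<ge> 0}" using convex_halfspace_Re_ge[of 0] by simp
    show "f field_differentiable at x" if "x \<in> interior {z. Re z \<ge> 0} - {}" for x
    proof -
      have "x \<in> U" using that interior_subset sub by blast
      thus ?thesis using hol by (metis holomorphic_on_imp_differentiable_at)
    qed
    show "path_image (half_circle R +++ imag_segment R) \<subseteq> {z. Re z \<ge> 0}"
      using imgs by (intro subset_path_image_join)
    show "valid_path (half_circle R +++ imag_segment R)" 
      by (intro valid_path_join valid_path_part_circlepath valid_path_linepath)
         (simp only: half_circle_ends pathstart_linepath)
    show "pathfinish (half_circle R +++ imag_segment R) = pathstart (half_circle R +++ imag_segment R)"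
      by (simp only: pathfinish_join pathstart_join half_circle_ends pathfinish_linepath)
  qed auto
  moreover have "contour_integral (half_circle R +++ imag_segment R) f = 
     contour_integral (half_circle R) f + contour_integral (imag_segment R) f"
    using imgs
    by (intro contour_integral_join contour_integrable_continuous_part_circlepath
         contour_integrable_continuous_linepath continuous_on_subset[OF cont]) auto
  ultimately show ?thesis
    using contour_integral_unique by (metis add_eq_0_iff2 add.commute)
qed

lemma imag_segment_integral_odd:
  assumes "f contour_integrable_on (imag_segment R)" "\<And>z. f (- z) = - f z"
  shows "contour_integral (imag_segment R) f = 0"
proof -
  let ?D = "imag_segment R"
  have "uminus \<circ> ?D = reversepath ?D"
    by (auto simp: fun_eq_iff linepath_def reversepath_def scaleR_conv_of_real algebra_simps)
  hence "contour_integral (reversepath ?D) f = - contour_integral ?D (\<lambda>x. f (- x))"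
    using contour_integral_negatepath[of ?D f] by simp
  also have "(\<lambda>x. f (- x)) = (\<lambda>x. - f x)" by (simp add: assms(2))
  also have "- contour_integral ?D (\<lambda>x. - f x) = contour_integral ?D f"
    by (simp add: contour_integral_neg)
  also have "contour_integral (reversepath ?D) f = - contour_integral ?D f"
    by (rule contour_integral_reversepath) simp
  finally show ?thesis by simp
qed

lemma half_circle_integral_kernel:
  assumes "R > 0"
  shows "contour_integral (half_circle R) (\<lambda>z. 1 / z + z / of_real R ^ 2) = of_real pi * \<i>"
proof -
  let ?F = "\<lambda>z. Ln z + z ^ 2 / (2 * of_real R ^ 2)"
  have nonpos: "z \<notin> \<real>\<^sub>\<le>\<^sub>0" if "z \<in> path_image (half_circle R)" for z
    using in_half_circle[OF assms that] by (auto simp: complex_nonpos_Reals_iff complex_eq_iff)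
  have "(?F has_field_derivative (1 / z + z / of_real R ^ 2)) (at z within path_image (half_circle R))"
    if "z \<in> path_image (half_circle R)" for z
  proof (rule DERIV_add)
    show "(Ln has_field_derivative 1 / z) (at z within path_image (half_circle R))"
      using has_field_derivative_at_within[OF has_field_derivative_Ln[OF nonpos[OF that]]]
      by (simp add: inverse_eq_divide)
    have "2 * z / (2 * of_real R ^ 2) = z / (of_real R ^ 2 :: complex)" by simp
    thus "((\<lambda>z. z ^ 2 / (2 * of_real R ^ 2)) has_field_derivative z / of_real R ^ 2) (at z within path_image (half_circle R))"
      using DERIV_cdivide[OF DERIV_power[OF DERIV_ident, where n = 2], where c = "2 * of_real R ^ 2"] by simp
  qed
  from contour_integral_primitive[OF this, of "half_circle R"]
  have "((\<lambda>z. 1 / z + z / of_real R ^ 2) has_contour_integral 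
     (?F (\<i> * of_real R) - ?F (- \<i> * of_real R))) (half_circle R)"
    unfolding half_circle_ends by simp
  also have "?F (\<i> * of_real R) - ?F (- \<i> * of_real R) = of_real pi * \<i>"
    using Ln_times_of_real[OF assms, of \<i>] Ln_times_of_real[OF assms, of "- \<i>"]
    by (simp add: mult.commute power_mult_distrib)
  finally show ?thesis by (rule contour_integral_unique)
qed

text \<open>
  On the circle of radius R the two halves of the kernel 1/z + z/R^2 are complex conjugates. The
  factor Re z compensates the loss of 1 / Re z in the estimates for the partial sums and tails of
  the series.
\<close>
lemma kernel_on_circle:
  assumes "R > 0" "norm z = R"
  shows "1 / z + z / of_real R ^ 2 = of_real (2 * Re z / R ^ 2)"
proof -
  have "z \<noteq> 0" using assms by auto
  have "z * cnj z = of_real R ^ 2" using assms by (simp add: complex_norm_square[symmetric])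
  hence "1 / z = cnj z / of_real R ^ 2" using \<open>z \<noteq> 0\<close> assms by (simp add: field_simps)
  hence "1 / z + z / of_real R ^ 2 = (z + cnj z) / of_real R ^ 2" by (simp add: add_divide_distrib)
  thus ?thesis by (simp add: complex_add_cnj)
qed

lemma holomorphic_remove_simple_zero:
  assumes "g holomorphic_on U" "open U" "g 0 = 0"
  shows "(\<lambda>z. if z = 0 then deriv g 0 else g z / z) holomorphic_on U"
  by (rule pole_theorem_open_0[OF assms(1,2), of 0]) (use assms(3) in auto)

text \<open>
  Write S for the N-th partial sum as an entire function of z, with the series for g shifted so
  that z = 0 is the point in question. The even function S(z) N^z + S(-z) N^(-z) recovers 2 S(0)
  when integrated over the half circle against the odd kernel 1/z + z/R^2, because the rest of the
  boundary contributes nothing. Subtracting g(z) N^z, whose integral moves to the imaginary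
  segment as g(z)/z is holomorphic at 0, leaves (S - g)(z) N^z + S(-z) N^(-z), and on the half
  circle both terms are at most about C / Re z in absolute value.
\<close>
lemma newman_estimate:
  fixes a :: "nat \<Rightarrow> complex"
  assumes bnd: "\<And>n. norm (a n) \<le> C"
    and hol: "g holomorphic_on U" "open U" and sub: "{z. Re z \<ge> 0} \<subseteq> U"
    and sums: "\<And>z. Re z > 0 \<Longrightarrow> (\<lambda>n. a n * npow (Suc n) (1 + z)) sums g z"
    and g0: "g 0 = 0" and R: "R > 0" and N: "N > 0"
  defines "\<psi> \<equiv> \<lambda>z. (if z = 0 then deriv g 0 else g z / z) * (1 + z ^ 2 / of_real R ^ 2)"
  shows "norm (\<Sum>n<N. a n / of_nat (Suc n)) \<le> C * (2 / R + 1 / real N) 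
           + norm (contour_integral (imag_segment R) (\<lambda>z. \<psi> z * npow N (- z)))"
proof -
  have C0: "C \<ge> 0" using bnd[of 0] norm_ge_zero order_trans by blast
  define S where "S z = (\<Sum>n<N. a n * npow (Suc n) (1 + z))" for z
  define K where "K z = 1 / z + z / of_real R ^ 2" for z :: complex
  \<comment> \<open>the even part that carries 2 S(0) as its constant term\<close>
  define E where "E z = S z * npow N (- z) + S (- z) * npow N z" for z
  define \<phi> where "\<phi> z = (if z = 0 then deriv (\<lambda>z. E z - 2 * S 0) 0 else (E z - 2 * S 0) / z) * (1 + z ^ 2 / of_real R ^ 2)" for z
  let ?A = "half_circle R" and ?D = "imag_segment R"
  have holS: "S holomorphic_on A" for A
    unfolding S_def by (intro holomorphic_intros)
  have holSm: "(\<lambda>z. S (- z)) holomorphic_on A" for A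
    unfolding S_def by (intro holomorphic_intros)
  have holE: "E holomorphic_on A" for A
    unfolding E_def by (intro holomorphic_intros holS holSm)
  have hol\<phi>: "\<phi> holomorphic_on UNIV"
    unfolding \<phi>_def 
    by (intro holomorphic_on_mult holomorphic_remove_simple_zero holomorphic_intros holE)
       (auto simp: E_def)
  have hol\<psi>: "\<psi> holomorphic_on U"
    unfolding \<psi>_def using R
    by (intro holomorphic_on_mult holomorphic_remove_simple_zero holomorphic_intros hol g0) auto
  have split: "(w / z) * (1 + z ^ 2 / of_real R ^ 2) = w * K z" if "z \<noteq> 0" for w z :: complex
    using that by (simp add: K_def distrib_left power2_eq_square)
  have intA: "f contour_integrable_on ?A" if "f holomorphic_on (UNIV - {0})" for f
    using in_half_circle[OF R]
    by (intro contour_integrable_continuous_part_circlepath holomorphic_on_imp_continuous_on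
         holomorphic_on_subset[OF that]) auto
  have holK: "K holomorphic_on (UNIV - {0})" 
    unfolding K_def using R by (intro holomorphic_intros) auto
  have phiK: "\<phi> z = E z * K z - 2 * S 0 * K z" if "z \<noteq> 0" for z
  proof -
    have "\<phi> z = (E z - 2 * S 0) / z * (1 + z ^ 2 / of_real R ^ 2)"
      unfolding \<phi>_def if_not_P[OF that] by (rule refl)
    thus ?thesis unfolding split[OF that] by (simp only: left_diff_distrib)
  qed
  have "contour_integral ?A \<phi> = - contour_integral ?D \<phi>"
    by (rule half_circle_integral_eq_imag_segment[OF hol\<phi>]) (use R in auto)
  also have "contour_integral ?D \<phi> = 0"
  proof (rule imag_segment_integral_odd)
    show "\<phi> contour_integrable_on ?D"
      by (intro contour_integrable_continuous_linepath holomorphic_on_imp_continuous_on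
            holomorphic_on_subset[OF hol\<phi>]) auto
    have Eeven: "E (- z) = E z" for z by (simp add: E_def)
    show "\<phi> (- z) = - \<phi> z" for z
    proof (cases "z = 0")
      case True
      have "((\<lambda>z. E z - 2 * S 0) has_field_derivative deriv (\<lambda>z. E z - 2 * S 0) 0) (at 0)"
        by (intro holomorphic_derivI[of _ UNIV] holomorphic_intros holE) auto
      note d = this
      have "((\<lambda>z. E (- z) - 2 * S 0) has_field_derivative deriv (\<lambda>z. E z - 2 * S 0) 0 * (- 1)) (at 0)"
        by (rule DERIV_chain'[where g = "\<lambda>z. E z - 2 * S 0"]) (use d in \<open>auto intro!: derivative_eq_intros\<close>)
      hence "deriv (\<lambda>z. E z - 2 * S 0) 0 = deriv (\<lambda>z. E z - 2 * S 0) 0 * (- 1)" (is "?d = _")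
        unfolding Eeven by (rule DERIV_unique[OF d])
      hence "?d + ?d = ?d + ?d * (- 1)" by (rule arg_cong)
      hence "?d = 0" by (simp flip: mult_2)
      thus ?thesis using True by (simp add: \<phi>_def)
    qed (simp add: \<phi>_def Eeven)
  qed
  finally have "0 = contour_integral ?A \<phi>" by simp
  also have "\<dots> = contour_integral ?A (\<lambda>z. E z * K z - 2 * S 0 * K z)"
    using in_half_circle(3)[OF R]
    by (intro contour_integral_cong phiK refl)
  also have "\<dots> = contour_integral ?A (\<lambda>z. E z * K z) - 2 * S 0 * (of_real pi * \<i>)"
    unfolding half_circle_integral_kernel[OF R, symmetric, folded K_def]
    by (subst contour_integral_diff, (intro intA holomorphic_intros holE holK)+,
        subst contour_integral_lmul, (intro intA holK), rule refl)
  finally have S0: "2 * of_real pi * \<i> * S 0 = contour_integral ?A (\<lambda>z. E z * K z)" by (simp add: algebra_simps)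
  have holpsiN: "(\<lambda>z. \<psi> z * npow N (- z)) holomorphic_on U"
    by (intro holomorphic_intros hol\<psi>)
  have psi: "contour_integral ?A (\<lambda>z. \<psi> z * npow N (- z)) = - contour_integral ?D (\<lambda>z. \<psi> z * npow N (- z))"
    by (rule half_circle_integral_eq_imag_segment[OF holpsiN hol(2) sub R])
  define H where "H z = E z * K z - \<psi> z * npow N (- z)" for z
  have AU: "path_image ?A \<subseteq> U" using in_half_circle[OF R] sub by auto
  have intpsi: "(\<lambda>z. \<psi> z * npow N (- z)) contour_integrable_on ?A"
    by (intro contour_integrable_continuous_part_circlepath holomorphic_on_imp_continuous_on
         holomorphic_on_subset[OF holpsiN] AU)
  have intEK: "(\<lambda>z. E z * K z) contour_integrable_on ?A" by (intro intA holomorphic_intros holE holK)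
  have intH: "H contour_integrable_on ?A"
    unfolding H_def by (intro contour_integrable_diff intEK intpsi)
  have "contour_integral ?A H = 2 * of_real pi * \<i> * S 0 + contour_integral ?D (\<lambda>z. \<psi> z * npow N (- z))"
    unfolding H_def contour_integral_diff[OF intEK intpsi] psi S0 by simp
  hence eq: "2 * of_real pi * \<i> * S 0 = contour_integral ?A H - contour_integral ?D (\<lambda>z. \<psi> z * npow N (- z))"
    by simp
  \<comment> \<open>for Re z = 0 the kernel vanishes; otherwise the tail and the head of the series are estimated separately\<close>
  have Hbound: "norm (H z) \<le> 2 * C / R ^ 2 * (2 + R / real N)" if z: "z \<in> path_image ?A" for z
  proof -
    note zA = in_half_circle[OF R z]
    have Kz: "K z = of_real (2 * Re z / R ^ 2)" unfolding K_def by (rule kernel_on_circle[OF R zA(1)])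
    have Hz: "H z = ((S z - g z) * npow N (- z) + S (- z) * npow N z) * K z"
    proof -
      have psiK: "\<psi> z = g z * K z"
        unfolding \<psi>_def if_not_P[OF zA(3)] by (rule split[OF zA(3)])
      have "(s * n + t * m) * k - g * k * n = ((s - g) * n + t * m) * k" for s n t m k g :: complex
        by (simp add: algebra_simps)
      thus ?thesis unfolding H_def E_def psiK .
    qed
    show ?thesis
    proof (cases "Re z = 0")
      case True
      hence "H z = 0" unfolding Hz Kz by simp
      thus ?thesis using C0 R N by simp
    next
      case False
      define x where "x = Re z"
      have x: "x > 0" using False zA(2) by (simp add: x_def)
      have xR: "x \<le> R" using complex_Re_le_cmod[of z] zA(1) by (simp add: x_def)
      have "(\<lambda>n. a (n + N) * npow (Suc (n + N)) (1 + z)) sums (g z - S z)"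
        unfolding S_def using sums_split_initial_segment[OF sums, of z N] x by (simp add: x_def)
      hence "norm (g z - S z) = norm (\<Sum>n. a (n + N) * npow (Suc (n + N)) (1 + z))"
        by (simp add: sums_iff)
      also have "\<dots> \<le> (\<Sum>n. C * real (Suc (n + N)) powr (- 1 - x))"
      proof (rule norm_suminf_le)
        fix n
        show "norm (a (n + N) * npow (Suc (n + N)) (1 + z)) \<le> C * real (Suc (n + N)) powr (- 1 - x)"
          unfolding norm_mult using bnd by (subst norm_npow) (auto simp: x_def intro!: mult_mono)
      qed (intro summable_mult sum_powr_neg_tail x N)
      also have "\<dots> \<le> C * (real N powr (- x) / x)"
        unfolding suminf_mult[OF sum_powr_neg_tail(1)[OF x N]]
        by (rule mult_left_mono[OF sum_powr_neg_tail(2)[OF x N] C0])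
      finally have tail: "norm (S z - g z) \<le> C * (real N powr (- x) / x)" by (simp add: norm_minus_commute)
      have "norm (S (- z)) \<le> (\<Sum>n<N. C * real (Suc n) powr (x - 1))"
        unfolding S_def
      proof (rule sum_norm_le)
        fix n
        show "norm (a n * npow (Suc n) (1 + - z)) \<le> C * real (Suc n) powr (x - 1)"
          unfolding norm_mult using bnd by (subst norm_npow) (auto simp: x_def intro!: mult_mono)
      qed
      also have "\<dots> \<le> C * (real N powr x / x + real N powr (x - 1))"
        unfolding sum_distrib_left[symmetric] using sum_powr_pos_le[OF x N] C0 by (rule mult_left_mono)
      finally have head: "norm (S (- z)) \<le> C * (real N powr x / x + real N powr (x - 1))" .
      have "real N powr (- x) * real N powr x = real N powr (- x + x)" by (simp only: powr_add)
      also have "\<dots> = 1" using N by simp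
      finally have Nx1: "real N powr (- x) * real N powr x = 1" .
      have "real N powr (x - 1) * real N powr (- x) = real N powr (x - 1 + - x)" by (simp only: powr_add)
      also have "x - 1 + - x = - 1" by simp
      also have "real N powr (- 1) = 1 / real N" using N by (simp add: powr_minus_divide)
      finally have Nx2: "real N powr (x - 1) * real N powr (- x) = 1 / real N" .
      have Kn: "norm (K z) = 2 * x / R ^ 2"
        unfolding Kz norm_of_real x_def[symmetric] using x by (intro abs_of_nonneg) simp
      have nN1: "norm (npow N (- z)) = real N powr x" and nN2: "norm (npow N z) = real N powr (- x)"
        using N by (simp_all add: norm_npow x_def)
      have "norm (H z) \<le> (C * (real N powr (- x) / x) * real N powr x + 
          C * (real N powr x / x + real N powr (x - 1)) * real N powr (- x)) * (2 * x / R ^ 2)"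
        unfolding Hz norm_mult[of _ "K z"]
      proof (intro mult_mono norm_triangle_le add_mono)
        show "norm ((S z - g z) * npow N (- z)) \<le> C * (real N powr (- x) / x) * real N powr x"
          unfolding norm_mult nN1 by (rule mult_right_mono[OF tail]) simp
        show "norm (S (- z) * npow N z) \<le> C * (real N powr x / x + real N powr (x - 1)) * real N powr (- x)"
          unfolding norm_mult nN2 by (rule mult_right_mono[OF head]) simp
        show "norm (K z) \<le> 2 * x / R ^ 2" unfolding Kn by (rule order_refl)
      qed (use C0 x in simp_all)
      also have "C * (real N powr (- x) / x) * real N powr x = C / x * (real N powr (- x) * real N powr x)"
        by simp
      also have "C * (real N powr x / x + real N powr (x - 1)) * real N powr (- x) = 
         C / x * (real N powr (- x) * real N powr x) + C * (real N powr (x - 1) * real N powr (- x))"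
        by (simp add: algebra_simps)
      also have "(C / x * (real N powr (- x) * real N powr x) + (C / x * (real N powr (- x) * real N powr x) +
         C * (real N powr (x - 1) * real N powr (- x)))) * (2 * x / R ^ 2) = 2 * C / R ^ 2 * (2 + x / real N)"
      proof -
        have "C / x * 1 + (C / x * 1 + C * (1 / real N)) = C / x * (2 + x / real N)"
          using x by (simp add: distrib_left)
        thus ?thesis unfolding Nx1 Nx2 using x by simp
      qed
      also have "\<dots> \<le> 2 * C / R ^ 2 * (2 + R / real N)"
        using xR C0 N by (intro mult_left_mono add_left_mono divide_right_mono) auto
      finally show ?thesis .
    qed
  qed
  have "norm (contour_integral ?A H) \<le> 2 * C / R ^ 2 * (2 + R / real N) * R * \<bar>pi / 2 - - pi / 2\<bar>"
    by (rule contour_integral_bound_part_circlepath[OF intH]) (use C0 R N Hbound in auto)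
  also have "\<dots> = 2 * pi * (C * (2 / R + 1 / real N))"
  proof -
    have "2 * C / R ^ 2 * (2 + R / real N) * R = 2 * C / R * (2 + R / real N)"
      using R by (simp add: power2_eq_square)
    also have "\<dots> = 2 * (C * (2 / R + 1 / real N))"
      using R by (simp add: distrib_left)
    finally show ?thesis by simp
  qed
  finally have A: "norm (contour_integral ?A H) \<le> 2 * pi * (C * (2 / R + 1 / real N))" .
  have "2 * pi * norm (S 0) = norm (2 * of_real pi * \<i> * S 0)" by (simp add: norm_mult)
  also have "\<dots> \<le> 2 * pi * (C * (2 / R + 1 / real N)) + norm (contour_integral ?D (\<lambda>z. \<psi> z * npow N (- z)))"
    unfolding eq by (intro norm_triangle_le_diff add_mono A) simp
  also have "\<dots> \<le> 2 * pi * (C * (2 / R + 1 / real N)) + 2 * pi * norm (contour_integral ?D (\<lambda>z. \<psi> z * npow N (- z)))"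
  proof -
    have "1 * norm (contour_integral ?D (\<lambda>z. \<psi> z * npow N (- z))) \<le> 2 * pi * norm (contour_integral ?D (\<lambda>z. \<psi> z * npow N (- z)))"
      using pi_gt3 by (intro mult_right_mono) auto
    thus ?thesis by simp
  qed
  finally have "2 * pi * norm (S 0) \<le> 2 * pi * (C * (2 / R + 1 / real N) + norm (contour_integral ?D (\<lambda>z. \<psi> z * npow N (- z))))"
    by (simp add: distrib_left)
  hence "norm (S 0) \<le> C * (2 / R + 1 / real N) + norm (contour_integral ?D (\<lambda>z. \<psi> z * npow N (- z)))"
    by simp
  moreover have "S 0 = (\<Sum>n<N. a n / of_nat (Suc n))"
    by (simp add: S_def npow_1_right)
  ultimately show ?thesis by simp
qed

text \<open>
  Given \<epsilon>, the radius R is chosen first so that 2 C / R < \<epsilon> / 2; then N tends to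
  infinity.
\<close>
lemma newman_tauberian_vanishing:
  fixes a :: "nat \<Rightarrow> complex"
  assumes bnd: "\<And>n. norm (a n) \<le> C"
    and hol: "g holomorphic_on U" "open U" and sub: "{z. Re z \<ge> 0} \<subseteq> U"
    and sums: "\<And>z. Re z > 0 \<Longrightarrow> (\<lambda>n. a n * npow (Suc n) (1 + z)) sums g z"
    and g0: "g 0 = 0"
  shows "(\<lambda>n. a n / of_nat (Suc n)) sums 0"
  unfolding sums_def
proof (rule LIMSEQ_I)
  fix e :: real assume e: "e > 0"
  have C0: "C \<ge> 0" using bnd[of 0] norm_ge_zero order_trans by blast
  \<comment> \<open>the summand 1 makes R positive also for C = 0\<close>
  define R where "R = 4 * C / e + 1"
  have R: "R > 0" using C0 e by (simp add: R_def add_nonneg_pos)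
  have "2 * C < e / 2 * R" using C0 e by (simp add: R_def field_simps)
  hence R2: "C * (2 / R) < e / 2" using R by (simp add: field_simps)
  define \<psi> where "\<psi> z = (if z = 0 then deriv g 0 else g z / z) * (1 + z ^ 2 / of_real R ^ 2)" for z
  define B where "B N = norm (contour_integral (imag_segment R) (\<lambda>z. \<psi> z * npow N (- z)))" for N
  have hol\<psi>: "\<psi> holomorphic_on U"
    unfolding \<psi>_def using R
    by (intro holomorphic_on_mult holomorphic_remove_simple_zero holomorphic_intros hol g0) auto
  have "B \<longlonglongrightarrow> 0"
    unfolding B_def
    using contour_integral_vertical_oscillating_tendsto_0[OF hol\<psi> hol(2) sub R] by (rule tendsto_norm_zero)
  moreover have "(\<lambda>N. C * (1 / real N)) \<longlonglongrightarrow> 0" by real_asymp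
  ultimately have "(\<lambda>N. C * (1 / real N) + B N) \<longlonglongrightarrow> 0 + 0" by (intro tendsto_add)
  hence "\<forall>\<^sub>F N in sequentially. C * (1 / real N) + B N < e / 2"
    using e by (intro order_tendstoD(2)) auto
  hence "\<forall>\<^sub>F N in sequentially. norm ((\<Sum>n<N. a n / of_nat (Suc n)) - 0) < e"
    using eventually_gt_at_top[of 0]
  proof eventually_elim
    case (elim N)
    have "norm (\<Sum>n<N. a n / of_nat (Suc n)) \<le> C * (2 / R + 1 / real N) + B N"
      unfolding B_def \<psi>_def by (rule newman_estimate[OF bnd hol sub sums g0 R elim(2)])
    also have "\<dots> < e" using elim(1) R2 by (simp only: distrib_left)
    finally show ?case by simp
  qed
  thus "\<exists>no. \<forall>n\<ge>no. norm ((\<Sum>n<n. a n / of_nat (Suc n)) - 0) < e"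
    by (simp add: eventually_sequentially)
qed

text \<open>
  Changing the first coefficient by G(1) makes the function vanish at s = 1. This turns G(s)/(s -
  1) into a holomorphic function, to which Cauchy's theorem on a half disk applies.
\<close>
theorem newman_tauberian:
  fixes a :: "nat \<Rightarrow> complex"
  assumes bnd: "\<And>n. norm (a n) \<le> C"
    and hol: "G holomorphic_on U" "open U" and sub: "{s. Re s \<ge> 1} \<subseteq> U"
    and sums: "\<And>s. Re s > 1 \<Longrightarrow> (\<lambda>n. a n * npow (Suc n) s) sums G s"
  shows "(\<lambda>n. a n / of_nat (Suc n)) sums G 1"
proof -
  define b where "b n = a n - (if n = 0 then G 1 else 0)" for n
  have one: "(\<lambda>n. if n = 0 then G 1 else 0) sums G 1"
    using sums_single[of 0 "\<lambda>_. G 1"] by (simp add: eq_commute[of 0])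
  have "(\<lambda>n. b n / of_nat (Suc n)) sums 0"
  proof (rule newman_tauberian_vanishing[where C = "C + norm (G 1)" and U = "(\<lambda>z. z - 1) ` U" and g = "\<lambda>z. G (1 + z) - G 1"])
    show "norm (b n) \<le> C + norm (G 1)" for n
      unfolding b_def using bnd[of n] by (intro norm_triangle_le_diff add_mono) auto
    have "(\<lambda>z. G (1 + z)) holomorphic_on (\<lambda>z. z - 1) ` U"
      by (rule holomorphic_on_compose_gen[OF _ hol(1), of "\<lambda>z. 1 + z", unfolded o_def])
         (auto intro!: holomorphic_intros simp del: add_uminus_conv_diff)
    thus "(\<lambda>z. G (1 + z) - G 1) holomorphic_on (\<lambda>z. z - 1) ` U" by (intro holomorphic_intros)
    show "open ((\<lambda>z. z - 1) ` U)" using open_translation_subtract[OF hol(2), of 1] by simp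
    show "{z. Re z \<ge> 0} \<subseteq> (\<lambda>z. z - 1) ` U"
    proof
      fix z :: complex assume "z \<in> {z. Re z \<ge> 0}"
      hence "z + 1 \<in> U" using sub by auto
      thus "z \<in> (\<lambda>z. z - 1) ` U" by (rule rev_image_eqI) simp
    qed
    fix z :: complex assume "Re z > 0"
    hence "(\<lambda>n. a n * npow (Suc n) (1 + z) - (if n = 0 then G 1 else 0)) sums (G (1 + z) - G 1)"
      by (intro sums_diff sums one) auto
    moreover have "(\<lambda>n. a n * npow (Suc n) (1 + z) - (if n = 0 then G 1 else 0)) = (\<lambda>n. b n * npow (Suc n) (1 + z))"
      by (auto simp: b_def fun_eq_iff algebra_simps)
    ultimately show "(\<lambda>n. b n * npow (Suc n) (1 + z)) sums (G (1 + z) - G 1)" by simp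
  qed simp
  from sums_add[OF this one]
  have "(\<lambda>n. b n / of_nat (Suc n) + (if n = 0 then G 1 else 0)) sums G 1" by simp
  also have "(\<lambda>n. b n / of_nat (Suc n) + (if n = 0 then G 1 else 0)) = (\<lambda>n. a n / of_nat (Suc n))"
    by (auto simp: b_def fun_eq_iff)
  finally show ?thesis .
qed

section \<open>Dirichlet series with bounded partial sums\<close>

lemma sum_by_parts:
  fixes a u :: "nat \<Rightarrow> 'a :: comm_ring"
  shows "(\<Sum>n<N. a n * u n) = (\<Sum>n<N. a n) * u N + (\<Sum>n<N. (\<Sum>k<Suc n. a k) * (u n - u (Suc n)))"
  by (induction N) (simp_all add: algebra_simps)

lemma norm_one_minus_exp_le:
  assumes "Re w \<ge> 0" shows "norm (1 - exp (- w)) \<le> norm (w :: complex)"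
proof -
  have "norm (exp (- 0) - exp (- w)) \<le> 1 * norm (0 - w)"
  proof (rule field_differentiable_bound[of "{z. Re z \<ge> 0}"])
    show "convex {z. Re z \<ge> 0}" using convex_halfspace_Re_ge[of 0] by simp
    show "((\<lambda>z. exp (- z)) has_field_derivative - exp (- z)) (at z within {z. Re z \<ge> 0})" for z :: complex
      by (auto intro!: derivative_eq_intros)
  qed (use assms in auto)
  thus ?thesis by simp
qed

text \<open>
  (n + 1)^(-s) = n^(-s) exp(-s \<delta>) with \<delta> = ln(1 + 1/n) \<le> 1/n.
\<close>
lemma norm_npow_diff_le:
  assumes "Re s > 0" "n > 0"
  shows "norm (npow n s - npow (Suc n) s) \<le> norm s * real n powr (- 1 - Re s)"
proof -
  define d where "d = ln (real (Suc n)) - ln (real n)"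
  have d0: "d \<ge> 0" using assms by (simp add: d_def)
  have "d = ln (1 + 1 / real n)" 
  proof -
    have "1 + 1 / real n = real (Suc n) / real n" using assms by (simp add: field_simps)
    thus ?thesis using assms by (simp add: d_def ln_div)
  qed
  also have "\<dots> \<le> 1 / real n" using assms by (intro ln_add_one_self_le_self) auto
  finally have d1: "d \<le> 1 / real n" .
  have "npow (Suc n) s = npow n s * exp (- (s * of_real d))"
    unfolding npow_def d_def by (simp add: exp_add[symmetric] algebra_simps)
  hence "npow n s - npow (Suc n) s = npow n s * (1 - exp (- (s * of_real d)))" by (simp add: algebra_simps)
  hence "norm (npow n s - npow (Suc n) s) = real n powr (- Re s) * norm (1 - exp (- (s * of_real d)))"
    using assms by (simp add: norm_mult norm_npow)
  also have "\<dots> \<le> real n powr (- Re s) * norm (s * of_real d)"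
    using assms d0 by (intro mult_left_mono norm_one_minus_exp_le) auto
  also have "\<dots> = norm s * (real n powr (- Re s) * d)" using d0 by (simp add: norm_mult)
  also have "\<dots> \<le> norm s * (real n powr (- Re s) * (1 / real n))"
    using d1 by (intro mult_left_mono) auto
  also have "real n powr (- Re s) * (1 / real n) = real n powr (- 1 - Re s)"
    using assms by (simp add: powr_diff powr_minus_divide field_simps)
  finally show ?thesis .
qed

text \<open>
  Summation by parts replaces the series by one whose n-th term is at most B |s| n^(-1 - Re s) in
  absolute value; this converges locally uniformly.
\<close>
lemma dirichlet_series_bounded_partial_sums:
  fixes a :: "nat \<Rightarrow> complex"
  assumes bnd: "\<And>N. norm (\<Sum>n<N. a n) \<le> B"
  shows "Re s > 0 \<Longrightarrow> summable (\<lambda>n. a n * npow (Suc n) s)"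
    and "(\<lambda>s. \<Sum>n. a n * npow (Suc n) s) holomorphic_on {s. Re s > 0}"
proof -
  have B0: "B \<ge> 0" using bnd[of 0] by simp
  let ?S = "{s. Re s > 0}"
  define f where "f n s = (\<Sum>k<Suc n. a k) * (npow (Suc n) s - npow (Suc (Suc n)) s)" for n s
  have op: "open ?S" using open_halfspace_Re_gt[of 0] by simp
  obtain g where g: "\<forall>x\<in>?S. ((\<lambda>n. f n x) sums g x) \<and> g field_differentiable (at x)"
  proof (rule series_differentiable_comparison_complex[OF op, of f])
    show "f n field_differentiable at x" if "x \<in> ?S" for n x
      unfolding f_def using op that 
      by (intro holomorphic_on_imp_differentiable_at[of _ UNIV] holomorphic_intros) auto
    fix x assume x: "x \<in> ?S"
    define d where "d = Re x / 2"
    have d: "d > 0" using x by (simp add: d_def)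
    define h where "h n = B * ((norm x + d) * real (Suc n) powr (- 1 - d))" for n
    have "summable (\<lambda>n. real (Suc n) powr (- 1 - d))"
      using sum_powr_neg_tail(1)[OF d, of 1] summable_iff_shift[of "\<lambda>n. real (Suc n) powr (- 1 - d)" 1] by simp
    hence "summable h" unfolding h_def by (intro summable_mult)
    moreover have "norm (f n y) \<le> h n" if y: "y \<in> ball x d \<inter> ?S" for n y
    proof -
      have dist: "norm (x - y) < d" using y by (simp add: dist_norm)
      have "Re x - Re y \<le> norm (x - y)" using complex_Re_le_cmod[of "x - y"] by simp
      hence Rey: "Re y \<ge> d" using dist unfolding d_def by linarith
      have ny: "norm y \<le> norm x + d" using dist norm_triangle_ineq2[of y x] by (simp add: norm_minus_commute)
      have "norm (f n y) \<le> B * (norm y * real (Suc n) powr (- 1 - Re y))"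
        unfolding f_def norm_mult using B0 y
        by (intro mult_mono bnd norm_npow_diff_le) auto
      also have "\<dots> \<le> B * ((norm x + d) * real (Suc n) powr (- 1 - d))"
        using B0 ny Rey d by (intro mult_left_mono mult_mono powr_mono) auto
      finally show ?thesis by (simp add: h_def)
    qed
    moreover have h0: "h n \<ge> 0" for n using B0 d by (simp add: h_def)
    ultimately have "0 < d \<and> summable (\<lambda>n. complex_of_real (h n)) \<and> range (\<lambda>n. complex_of_real (h n)) \<subseteq> \<real>\<^sub>\<ge>\<^sub>0 \<and>
       (\<forall>\<^sub>F n in sequentially. \<forall>y\<in>ball x d \<inter> ?S. norm (f n y) \<le> norm (complex_of_real (h n)))"
      using d unfolding norm_of_real by (auto simp: summable_of_real abs_of_nonneg)
    thus "\<exists>d h. 0 < d \<and> summable h \<and> range h \<subseteq> \<real>\<^sub>\<ge>\<^sub>0 \<and>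
       (\<forall>\<^sub>F n in sequentially. \<forall>y\<in>ball x d \<inter> ?S. norm (f n y) \<le> norm (h n :: complex))"
      by blast
  qed blast
  have sums: "(\<lambda>n. a n * npow (Suc n) s) sums g s" if s: "Re s > 0" for s
  proof -
    have "(\<lambda>N. norm (npow (Suc N) s)) \<longlonglongrightarrow> 0"
      using s by (simp add: norm_npow) real_asymp
    hence "(\<lambda>N. B * norm (npow (Suc N) s)) \<longlonglongrightarrow> B * 0" by (intro tendsto_mult tendsto_const)
    hence "(\<lambda>N. B * norm (npow (Suc N) s)) \<longlonglongrightarrow> 0" by simp
    hence "(\<lambda>N. (\<Sum>n<N. a n) * npow (Suc N) s) \<longlonglongrightarrow> 0"
      by (rule Lim_null_comparison[rotated]) 
         (auto simp: norm_mult intro!: always_eventually mult_right_mono bnd)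
    moreover have "(\<lambda>N. \<Sum>n<N. f n s) \<longlonglongrightarrow> g s" using g s by (auto simp: sums_def)
    ultimately have "(\<lambda>N. (\<Sum>n<N. a n) * npow (Suc N) s + (\<Sum>n<N. f n s)) \<longlonglongrightarrow> 0 + g s"
      by (rule tendsto_add)
    thus ?thesis unfolding sums_def sum_by_parts[of a "\<lambda>n. npow (Suc n) s"] f_def by simp
  qed
  show "Re s > 0 \<Longrightarrow> summable (\<lambda>n. a n * npow (Suc n) s)" for s
    using sums by (auto simp: sums_iff)
  have "g holomorphic_on ?S" 
    unfolding holomorphic_on_def using g by (blast intro: field_differentiable_at_within)
  moreover have "g s = (\<Sum>n. a n * npow (Suc n) s)" if "s \<in> ?S" for s
    using sums_unique[OF sums] that by blast
  ultimately show "(\<lambda>s. \<Sum>n. a n * npow (Suc n) s) holomorphic_on ?S"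
    by (rule holomorphic_transform)
qed

text \<open>
  Full periods cancel, so fewer than m summands remain.
\<close>
lemma norm_periodic_partial_sum_le:
  fixes f :: "nat \<Rightarrow> complex"
  assumes m: "m > 0" and per: "\<And>n. f (n + m) = f n" and le: "\<And>n. norm (f n) \<le> 1"
    and zero: "(\<Sum>n<m. f n) = 0"
  shows "norm (\<Sum>n<N. f n) \<le> real m"
proof (induction N rule: less_induct)
  case (less N)
  show ?case
  proof (cases "N \<le> m")
    case True
    have "norm (\<Sum>n<N. f n) \<le> (\<Sum>n<N. 1)" by (rule sum_norm_le) (rule le)
    thus ?thesis using True by simp
  next
    case False
    hence "(\<Sum>n<N. f n) = (\<Sum>n<m. f n) + (\<Sum>n<N-m. f (n + m))"
      using sum.atLeastLessThan_concat[of 0 m N f] sum.shift_bounds_nat_ivl[of f 0 m "N - m"] 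
      by (simp add: atLeast0LessThan)
    also have "\<dots> = (\<Sum>n<N-m. f n)" by (simp add: zero per)
    finally show ?thesis using less[of "N - m"] False m by simp
  qed
qed

lemma sum_periodic_shift:
  fixes f :: "nat \<Rightarrow> complex"
  assumes per: "\<And>n. f (n + m) = f n"
  shows "(\<Sum>n<m. f (Suc n)) = (\<Sum>n<m. f n)"
  using sum.lessThan_Suc_shift[of f m] sum.lessThan_Suc[of f m] per[of 0] by simp

section \<open>Euler products and nonvanishing on the line Re s = 1\<close>

text \<open>
  Multiplying by 1 - h p removes the multiples of p from the range of summation.
\<close>
lemma euler_product_partial:
  fixes h :: "nat \<Rightarrow> complex"
  assumes summ: "h summable_on {0<..}" and mult: "\<And>a b. h (a * b) = h a * h b"
    and A: "finite A" "\<And>p. p \<in> A \<Longrightarrow> prime p"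
  shows "(\<Prod>p\<in>A. 1 - h p) * infsum h {0<..} = infsum h {n. n > 0 \<and> (\<forall>p\<in>A. \<not> p dvd n)}"
  using A
proof (induction A rule: finite_induct)
  case empty
  have "{n :: nat. n > 0} = {0<..}" by auto
  thus ?case by simp
next
  case (insert p A)
  define S where "S = {n. n > 0 \<and> (\<forall>r\<in>A. \<not> r dvd n)}"
  have p: "prime p" "p > 0" using insert prime_gt_0_nat by auto
  have summS: "h summable_on T" if "T \<subseteq> S" for T
    by (rule summable_on_subset_banach[OF summ]) (use that in \<open>auto simp: S_def\<close>)
  have dvd_mult: "r dvd p * n \<longleftrightarrow> r dvd n" if "r \<in> A" for r n
  proof -
    have r: "prime r" "r \<noteq> p" using insert that by auto
    hence "\<not> r dvd p" using p(1) primes_dvd_imp_eq by blast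
    thus ?thesis using r(1) prime_dvd_mult_iff by blast
  qed
  have multiples: "{n\<in>S. p dvd n} = (*) p ` S"
  proof (intro equalityI subsetI)
    fix n assume n: "n \<in> {n\<in>S. p dvd n}"
    then obtain k where k: "n = p * k" by (auto elim: dvdE)
    have "k \<in> S" using n dvd_mult unfolding k S_def by simp
    thus "n \<in> (*) p ` S" using k by blast
  qed (use p(2) dvd_mult in \<open>auto simp: S_def\<close>)
  have "infsum h ({n\<in>S. \<not> p dvd n} \<union> {n\<in>S. p dvd n}) = infsum h {n\<in>S. \<not> p dvd n} + infsum h {n\<in>S. p dvd n}"
    by (intro infsum_Un_disjoint summS) auto
  also have "{n\<in>S. \<not> p dvd n} \<union> {n\<in>S. p dvd n} = S" by auto
  also have "infsum h {n\<in>S. p dvd n} = infsum (h \<circ> (*) p) S"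
    unfolding multiples using p(2) by (intro infsum_reindex) (auto simp: inj_on_def)
  also have "\<dots> = h p * infsum h S"
    unfolding o_def mult using summS[of S] by (intro infsum_cmult_right) auto
  finally have "infsum h S = infsum h {n\<in>S. \<not> p dvd n} + h p * infsum h S" .
  hence "(1 - h p) * infsum h S = infsum h {n\<in>S. \<not> p dvd n}"
    unfolding left_diff_distrib mult_1_left diff_eq_eq .
  moreover have "{n\<in>S. \<not> p dvd n} = {n. n > 0 \<and> (\<forall>r\<in>insert p A. \<not> r dvd n)}" by (auto simp: S_def)
  ultimately show ?case using insert by (simp add: S_def mult.assoc)
qed

lemma sums_Suc_imp_has_sum:
  fixes f :: "nat \<Rightarrow> 'a :: banach"
  assumes "summable (\<lambda>n. norm (f (Suc (n + N))))"
  shows "(f has_sum (\<Sum>n. f (Suc (n + N)))) {N<..}"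
proof -
  have "((\<lambda>n. f (Suc (n + N))) has_sum (\<Sum>n. f (Suc (n + N)))) UNIV"
    by (rule norm_summable_imp_has_sum[OF assms summable_sums[OF summable_norm_cancel[OF assms]]])
  moreover have "bij_betw (\<lambda>n. Suc (n + N)) UNIV {N<..}"
    by (rule bij_betwI[of _ _ _ "\<lambda>n. n - Suc N"]) auto
  from has_sum_reindex_bij_betw[OF this, of f "\<Sum>n. f (Suc (n + N))"] calculation show ?thesis by simp
qed

text \<open>
  A number n > 1 without prime factor up to N exceeds N, so what the sieve leaves besides n = 1 is
  a tail of the convergent series.
\<close>
lemma euler_product_tendsto:
  fixes h :: "nat \<Rightarrow> complex"
  assumes summ: "summable (\<lambda>n. norm (h (Suc n)))" and mult: "\<And>a b. h (a * b) = h a * h b"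
    and one: "h 1 = 1"
  shows "(\<lambda>N. (\<Prod>p | prime p \<and> p \<le> N. 1 - h p) * (\<Sum>n. h (Suc n))) \<longlonglongrightarrow> 1"
proof -
  have hs: "(h has_sum (\<Sum>n. h (Suc n))) {0<..}"
    using sums_Suc_imp_has_sum[of h 0] summ by simp
  have summN: "summable (\<lambda>n. norm (h (Suc (n + N))))" for N
    using summ summable_iff_shift[of "\<lambda>n. norm (h (Suc n))" N] by simp
  have hN: "((\<lambda>n. norm (h n)) has_sum (\<Sum>n. norm (h (Suc (n + N))))) {N<..}" for N
    using sums_Suc_imp_has_sum[of "\<lambda>n. norm (h n)" N] summN by simp
  have bound: "norm ((\<Prod>p | prime p \<and> p \<le> N. 1 - h p) * (\<Sum>n. h (Suc n)) - 1) \<le> (\<Sum>n. norm (h (Suc (n + N))))" 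
    if N: "N > 0" for N
  proof -
    let ?A = "{p. prime p \<and> p \<le> N}"
    let ?S = "{n. n > 0 \<and> (\<forall>p\<in>?A. \<not> p dvd n)}"
    define T where "T = ?S - {1}"
    have T: "T \<subseteq> {N<..}"
    proof
      fix n assume n: "n \<in> T"
      then obtain p where p: "prime p" "p dvd n" using prime_factor_nat[of n] by (auto simp: T_def)
      hence "\<not> p \<le> N" using n by (auto simp: T_def)
      moreover have "p \<le> n" using p n by (auto simp: T_def intro: dvd_imp_le)
      ultimately show "n \<in> {N<..}" by simp
    qed
    have ST: "?S = insert 1 T" by (auto simp: T_def)
    have sT: "(\<lambda>n. norm (h n)) summable_on T"
      by (rule summable_on_subset_banach[OF has_sum_imp_summable[OF hN] T])
    hence "h summable_on T" by (rule abs_summable_summable)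
    have "(\<Prod>p\<in>?A. 1 - h p) * (\<Sum>n. h (Suc n)) = infsum h ?S"
      unfolding infsumI[OF hs, symmetric]
      by (rule euler_product_partial[where h = h and A = ?A, OF has_sum_imp_summable[OF hs] mult]) auto
    also have "\<dots> = 1 + infsum h T"
      unfolding ST using \<open>h summable_on T\<close> one by (subst infsum_insert) (auto simp: T_def)
    finally have "norm ((\<Prod>p\<in>?A. 1 - h p) * (\<Sum>n. h (Suc n)) - 1) = norm (infsum h T)" by simp
    also have "\<dots> \<le> infsum (\<lambda>n. norm (h n)) T" using sT by (rule norm_infsum_bound)
    also have "\<dots> \<le> infsum (\<lambda>n. norm (h n)) {N<..}"
      using sT has_sum_imp_summable[OF hN] T by (intro infsum_mono2) auto
    also have "\<dots> = (\<Sum>n. norm (h (Suc (n + N))))" using hN by (rule infsumI)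
    finally show ?thesis .
  qed
  have "(\<lambda>N. (\<Sum>n. norm (h (Suc (n + N))))) \<longlonglongrightarrow> 0"
    using tendsto_diff[OF tendsto_const[of "\<Sum>n. norm (h (Suc n))"] summable_LIMSEQ[OF summ]]
    by (simp add: suminf_minus_initial_segment[OF summ])
  note tail = this
  have "\<forall>\<^sub>F N in sequentially. norm ((\<Prod>p | prime p \<and> p \<le> N. 1 - h p) * (\<Sum>n. h (Suc n)) - 1)
     \<le> (\<Sum>n. norm (h (Suc (n + N))))"
    using eventually_gt_at_top[of 0] by eventually_elim (rule bound)
  from Lim_null_comparison[OF this tail] show ?thesis by (rule LIM_zero_cancel)
qed

text \<open>
  For |u| = 1 this is 3 + 4 cos \<theta> + cos 2\<theta> = 2 (1 + cos \<theta>)^2. The version for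
  |u| \<le> 1 covers the primes at which the character vanishes.
\<close>
lemma three_four_one_real:
  assumes "norm (u :: complex) \<le> 1"
  shows "3 + 4 * Re u + Re (u ^ 2) \<ge> 0"
proof -
  have "(Re u)\<^sup>2 + (Im u)\<^sup>2 \<le> 1" using assms by (metis cmod_power2 norm_ge_zero power_le_one)
  moreover have "Re (u ^ 2) = (Re u)\<^sup>2 - (Im u)\<^sup>2" by (simp add: power2_eq_square)
  ultimately have "3 + 4 * Re u + Re (u ^ 2) \<ge> 2 * (1 + Re u)\<^sup>2" by (simp add: power2_eq_square algebra_simps)
  thus ?thesis by (meson order_trans zero_le_mult_iff zero_le_numeral zero_le_power2)
qed

text \<open>
  Minus the logarithm of the left hand side is the sum of r^n/n (3 + 4 Re u + Re u^2) with u =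
  z^n.
\<close>
lemma three_four_one_local:
  fixes r :: real and z :: complex
  assumes r: "0 \<le> r" "r < 1" and z: "norm z \<le> 1"
  shows "norm (1 - of_real r :: complex) ^ 3 * norm (1 - of_real r * z) ^ 4 * norm (1 - of_real r * z ^ 2) \<le> 1"
proof -
  have lt: "norm (of_real r * w) < 1" if "norm w \<le> 1" for w :: complex
  proof -
    have "norm (of_real r * w) \<le> r * 1" unfolding norm_mult using that r by (intro mult_mono) auto
    thus ?thesis using r by simp
  qed
  have ser: "(\<lambda>n. r ^ n / real n * Re (w ^ n)) sums (- Re (Ln (1 - of_real r * w)))" if w: "norm w \<le> 1" for w
  proof -
    have "(\<lambda>n. (-1) ^ Suc n / of_nat n * (- (of_real r * w)) ^ n) sums Ln (1 + - (of_real r * w))"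
      by (rule Ln_series) (use lt[OF w] in simp)
    note ln_sums = sums_Re[OF sums_minus[OF this]]
    have 1: "- ((-1) ^ Suc n / of_nat n * (- (of_real r * w)) ^ n) = of_real (r ^ n / real n) * w ^ n" for n
      by (simp add: power_minus[of "of_real r * w"] power_mult_distrib flip: power_add mult_2)
    have 2: "Re (of_real c * u) = c * Re u" for c u by simp
    show ?thesis using ln_sums unfolding 1 2 by simp
  qed
  define b where "b w = Re (Ln (1 - of_real r * w))" for w :: complex
  have expLn: "norm (1 - of_real r * w) = exp (b w)" if "norm w \<le> 1" for w
  proof -
    have "1 - of_real r * w \<noteq> 0" using lt[OF that] by auto
    thus ?thesis unfolding b_def by (metis exp_Ln norm_exp_eq_Re)
  qed
  have z2: "norm (z ^ 2) \<le> 1" using z by (simp add: norm_power power_le_one)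
  define s where "s = 3 * - b 1 + 4 * - b z + - b (z ^ 2)"
  have s_sums: "(\<lambda>n. 3 * (r ^ n / real n * Re (1 ^ n)) + 4 * (r ^ n / real n * Re (z ^ n)) + r ^ n / real n * Re ((z ^ 2) ^ n)) sums s"
    unfolding s_def b_def by (intro sums_add sums_mult ser z z2) auto
  have nonneg: "3 * (r ^ n / real n * Re (1 ^ n)) + 4 * (r ^ n / real n * Re (z ^ n)) + r ^ n / real n * Re ((z ^ 2) ^ n) \<ge> 0" for n
  proof -
    have "r ^ n / real n * (3 + 4 * Re (z ^ n) + Re ((z ^ n) ^ 2)) \<ge> 0"
      using r z by (intro mult_nonneg_nonneg three_four_one_real) (auto simp: norm_power power_le_one)
    moreover have "(z ^ 2) ^ n = (z ^ n) ^ 2" by (simp add: power_mult[symmetric] mult.commute)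
    moreover have "3 * (a * Re (1 ^ n)) + 4 * (a * x) + a * y = a * (3 + 4 * x + y)" for a x y :: real
      by (simp add: algebra_simps)
    ultimately show ?thesis by (simp only:)
  qed
  have "s \<ge> 0" by (rule sums_le[OF nonneg sums_zero s_sums])
  have n1: "norm (1 - of_real r :: complex) = exp (b 1)" using expLn[of 1] by simp
  have "exp (3 * y) = exp y ^ 3" "exp (4 * y) = exp y ^ 4" for y :: real
    using exp_of_nat_mult[of 3 y] exp_of_nat_mult[of 4 y] by simp_all
  hence "norm (1 - of_real r :: complex) ^ 3 * norm (1 - of_real r * z) ^ 4 * norm (1 - of_real r * z ^ 2)
      = exp (3 * b 1 + 4 * b z + b (z ^ 2))"
    unfolding n1 expLn[OF z] expLn[OF z2] by (simp add: exp_add)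
  also have "\<dots> = exp (- s)" by (simp add: s_def)
  also have "\<dots> \<le> 1" using \<open>s \<ge> 0\<close> by simp
  finally show ?thesis .
qed

lemma summable_norm_dirichlet:
  assumes "Re s > 1" "\<And>n. norm (a n) \<le> 1"
  shows "summable (\<lambda>n. norm (a n * npow (Suc n) s))"
proof (rule summable_comparison_test_ev[OF always_eventually], rule allI)
  have "summable (\<lambda>n. real (Suc (n + 1)) powr (- 1 - (Re s - 1)))"
    using assms by (intro sum_powr_neg_tail) auto
  thus "summable (\<lambda>n. real (Suc n) powr (- Re s))"
    using summable_iff_shift[of "\<lambda>n. real (Suc n) powr (- Re s)" 1] by simp
  fix n
  have "norm (a n) * real (Suc n) powr (- Re s) \<le> 1 * real (Suc n) powr (- Re s)"
    by (intro mult_right_mono assms) auto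
  thus "norm (norm (a n * npow (Suc n) s)) \<le> real (Suc n) powr (- Re s)"
    by (simp add: norm_mult norm_npow)
qed

lemma zeta_le:
  assumes "x > 1"
  shows "norm (\<Sum>n. npow (Suc n) (of_real x)) \<le> 1 + 1 / (x - 1)"
proof -
  have s: "summable (\<lambda>n. norm (npow (Suc n) (of_real x)))"
    using summable_norm_dirichlet[of "of_real x" "\<lambda>_. 1"] assms by simp
  have "norm (\<Sum>n. npow (Suc n) (of_real x)) \<le> (\<Sum>n. norm (npow (Suc n) (of_real x)))"
    by (rule summable_norm[OF s])
  also have "\<dots> = 1 + (\<Sum>n. norm (npow (Suc (n + 1)) (of_real x)))"
    using suminf_split_initial_segment[OF s, of 1] by simp
  also have "(\<Sum>n. norm (npow (Suc (n + 1)) (of_real x))) = (\<Sum>n. real (Suc (n + 1)) powr (- 1 - (x - 1)))"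
    by (subst norm_npow) auto
  also have "\<dots> \<le> real 1 powr (- (x - 1)) / (x - 1)" using assms by (intro sum_powr_neg_tail) auto
  finally show ?thesis by simp
qed

text \<open>
  A completely multiplicative periodic function such that both it and its square have mean zero
  over a period. This is what makes the L-series of both holomorphic for Re s > 0; for a Dirichlet
  character it says that the character is not real.
\<close>
locale nonreal_character =
  fixes chi :: "nat \<Rightarrow> complex" and m :: nat
  assumes m_pos: "m > 0"
    and chi_mult: "chi (a * b) = chi a * chi b"
    and chi_1: "chi 1 = 1"
    and norm_chi: "norm (chi n) \<le> 1"
    and chi_periodic: "chi (n + m) = chi n"
    and sum_chi: "(\<Sum>n<m. chi n) = 0"
    and sum_chi_sq: "(\<Sum>n<m. chi n ^ 2) = 0"
begin

definition L :: "complex \<Rightarrow> complex" where "L s = (\<Sum>n. chi (Suc n) * npow (Suc n) s)"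

definition Lsq :: "complex \<Rightarrow> complex" where "Lsq s = (\<Sum>n. chi (Suc n) ^ 2 * npow (Suc n) s)"

lemma norm_chi_sq: "norm (chi n ^ 2) \<le> 1"
  using norm_chi by (simp add: norm_power power_le_one)

lemma norm_sum_chi_le: "norm (\<Sum>n<N. chi (Suc n)) \<le> real m"
proof (rule norm_periodic_partial_sum_le[OF m_pos])
  show "chi (Suc (n + m)) = chi (Suc n)" for n using chi_periodic[of "Suc n"] by simp
  show "(\<Sum>n<m. chi (Suc n)) = 0" unfolding sum_periodic_shift[of chi, OF chi_periodic] by (rule sum_chi)
qed (rule norm_chi)

lemma norm_sum_chi_sq_le: "norm (\<Sum>n<N. chi (Suc n) ^ 2) \<le> real m"
proof (rule norm_periodic_partial_sum_le[OF m_pos])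
  show "chi (Suc (n + m)) ^ 2 = chi (Suc n) ^ 2" for n using chi_periodic[of "Suc n"] by simp
  have "(\<Sum>n<m. chi (Suc n) ^ 2) = (\<Sum>n<m. chi n ^ 2)"
    by (rule sum_periodic_shift[of "\<lambda>n. chi n ^ 2"]) (simp add: chi_periodic)
  thus "(\<Sum>n<m. chi (Suc n) ^ 2) = 0" using sum_chi_sq by simp
qed (rule norm_chi_sq)

lemma holomorphic_L: "L holomorphic_on {s. Re s > 0}"
  unfolding L_def[abs_def] by (rule dirichlet_series_bounded_partial_sums(2)[OF norm_sum_chi_le])

lemma holomorphic_Lsq: "Lsq holomorphic_on {s. Re s > 0}"
  unfolding Lsq_def[abs_def] by (rule dirichlet_series_bounded_partial_sums(2)[OF norm_sum_chi_sq_le])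

text \<open>
  By the Euler products, the right hand side becomes 1 in the limit when multiplied by the local
  factors of the primes up to N, each of which is at most 1.
\<close>
lemma three_four_one:
  assumes x: "x > 1"
  shows "1 \<le> norm (\<Sum>n. npow (Suc n) (of_real x)) ^ 3 * norm (L (Complex x t)) ^ 4 * norm (Lsq (Complex x (2 * t)))"
proof -
  define h where "h k n = (if n = 0 then 0 else chi n ^ k * npow n (Complex x (real k * t)))" for k n
  have cn: "norm (chi n ^ k) \<le> 1" for n k using norm_chi by (simp add: norm_power power_le_one)
  have conv: "(\<lambda>N. (\<Prod>p | prime p \<and> p \<le> N. 1 - h k p) * (\<Sum>n. h k (Suc n))) \<longlonglongrightarrow> 1" for k
  proof (rule euler_product_tendsto)
    show "summable (\<lambda>n. norm (h k (Suc n)))"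
      using summable_norm_dirichlet[of "Complex x (real k * t)" "\<lambda>n. chi (Suc n) ^ k"] x cn by (simp add: h_def)
    show "h k (a * b) = h k a * h k b" for a b
      by (simp add: h_def chi_mult npow_mult power_mult_distrib)
    show "h k 1 = 1" using chi_1 by (simp add: h_def)
  qed
  \<comment> \<open>k = 0, 1, 2 give the zeta series, L and the L-series of the square\<close>
  have H0: "(\<Sum>n. chi (Suc n) ^ 0 * npow (Suc n) (Complex x (real 0 * t))) = (\<Sum>n. npow (Suc n) (of_real x))"
    by (simp add: complex_of_real_def)
  let ?H = "\<lambda>k. \<Sum>n. h k (Suc n)"
  let ?P = "\<lambda>k N. \<Prod>p | prime p \<and> p \<le> N. 1 - h k p"
  have lim: "(\<lambda>N. norm (?P 0 N * ?H 0) ^ 3 * norm (?P 1 N * ?H 1) ^ 4 * norm (?P 2 N * ?H 2)) \<longlonglongrightarrow> 1"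
    using tendsto_mult[OF tendsto_mult[OF tendsto_power[OF tendsto_norm[OF conv[of 0]], of 3] 
        tendsto_power[OF tendsto_norm[OF conv[of 1]], of 4]] tendsto_norm[OF conv[of 2]]] by simp
  have "norm (?P 0 N * ?H 0) ^ 3 * norm (?P 1 N * ?H 1) ^ 4 * norm (?P 2 N * ?H 2) 
      \<le> norm (?H 0) ^ 3 * norm (?H 1) ^ 4 * norm (?H 2)" for N
  proof -
    have local_le: "norm (1 - h 0 p) ^ 3 * norm (1 - h 1 p) ^ 4 * norm (1 - h 2 p) \<le> 1" if "prime p" for p
    proof -
      have p: "p > 1" using prime_gt_1_nat[OF that] .
      define r where "r = real p powr (- x)"
      have r: "0 \<le> r" "r < 1" using p x by (auto simp: r_def powr_less_one)
      define z where "z = chi p * npow p (\<i> * of_real t)"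
      have np: "norm (npow p (\<i> * of_real t)) = 1" using p by (simp add: norm_npow)
      have z: "norm z \<le> 1" using norm_chi by (simp add: z_def norm_mult np)
      have npk: "npow p (Complex x (real k * t)) = of_real r * npow p (\<i> * of_real t) ^ k" for k
      proof -
        have "Complex x (real k * t) = of_real x + of_nat k * (\<i> * of_real t)" by (simp add: complex_eq_iff)
        moreover have "npow p (of_nat k * w) = npow p w ^ k" for w
          by (simp add: npow_def exp_of_nat_mult[symmetric] mult_ac)
        ultimately show ?thesis using p by (simp add: npow_add npow_of_real r_def)
      qed
      have hk: "h k p = of_real r * z ^ k" for k
        unfolding h_def npk z_def using p by (simp add: power_mult_distrib mult_ac)
      show ?thesis unfolding hk using three_four_one_local[OF r z] by simp
    qed
    have "norm (?P 0 N) ^ 3 * norm (?P 1 N) ^ 4 * norm (?P 2 N) 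
      = (\<Prod>p | prime p \<and> p \<le> N. norm (1 - h 0 p) ^ 3 * norm (1 - h 1 p) ^ 4 * norm (1 - h 2 p))"
      by (simp add: prod.distrib prod_power_distrib flip: prod_norm)
    also have "\<dots> \<le> 1" by (intro prod_le_1) (auto intro!: local_le[unfolded One_nat_def])
    finally have "(norm (?P 0 N) ^ 3 * norm (?P 1 N) ^ 4 * norm (?P 2 N)) * (norm (?H 0) ^ 3 * norm (?H 1) ^ 4 * norm (?H 2))
        \<le> 1 * (norm (?H 0) ^ 3 * norm (?H 1) ^ 4 * norm (?H 2))"
      by (intro mult_right_mono) auto
    thus ?thesis by (simp add: norm_mult power_mult_distrib mult_ac)
  qed
  hence "1 \<le> norm (?H 0) ^ 3 * norm (?H 1) ^ 4 * norm (?H 2)"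
    by (intro LIMSEQ_le_const2[OF lim]) auto
  thus ?thesis using H0 by (simp add: h_def L_def Lsq_def)
qed

text \<open>
  At a zero 1 + it the fourth power of L(1 + \<epsilon> + it) is O(\<epsilon>^4), which beats the
  growth \<epsilon>^(-3) of the cube of the zeta series, while the third factor stays bounded near
  1 + 2it. This contradicts the lower bound 1.
\<close>
lemma L_nonzero:
  assumes "Re s \<ge> 1" shows "L s \<noteq> 0"
proof (cases "Re s > 1")
  case True
  thus ?thesis using three_four_one[OF True, of "Im s"] by auto
next
  case False
  define t where "t = Im s"
  have s: "s = Complex 1 t" using False assms by (simp add: t_def complex_eq_iff)
  show ?thesis
  proof
    assume L0: "L s = 0"
    have op: "open {s. Re s > 0}" using open_halfspace_Re_gt[of 0] by simp
    have "(L has_field_derivative deriv L s) (at s)"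
      using holomorphic_derivI[OF holomorphic_L op] s by simp
    hence "((\<lambda>y. L (s + y) / y) \<longlongrightarrow> deriv L s) (at 0)" using L0 by (simp add: DERIV_def)
    moreover have "filterlim (\<lambda>e::real. of_real e :: complex) (at 0) (at_right 0)"
      by (auto simp: filterlim_at eventually_at_filter intro!: tendsto_eq_intros)
    ultimately have 1: "((\<lambda>e. L (s + of_real e) / of_real e) \<longlongrightarrow> deriv L s) (at_right 0)"
      by (rule filterlim_compose)
    define s2 where "s2 = Complex 1 (2 * t)"
    have "isCont Lsq s2"
      using holomorphic_on_imp_continuous_on[OF holomorphic_Lsq] op by (simp add: continuous_on_eq_continuous_at s2_def)
    moreover have "((\<lambda>e::real. s2 + of_real e) \<longlongrightarrow> s2) (at_right 0)" by (auto intro!: tendsto_eq_intros)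
    ultimately have 2: "((\<lambda>e. Lsq (s2 + of_real e)) \<longlongrightarrow> Lsq s2) (at_right 0)"
      by (rule isCont_tendsto_compose)
    have "((\<lambda>e. 8 * norm (L (s + of_real e) / of_real e) ^ 4 * (e * norm (Lsq (s2 + of_real e)))) \<longlongrightarrow> 
        8 * norm (deriv L s) ^ 4 * (0 * norm (Lsq s2))) (at_right 0)"
      by (intro tendsto_intros 1 2)
    hence "\<forall>\<^sub>F e in at_right 0. 8 * norm (L (s + of_real e) / of_real e) ^ 4 * (e * norm (Lsq (s2 + of_real e))) < 1"
      by (intro order_tendstoD(2)[of _ 0]) auto
    moreover have "\<forall>\<^sub>F e in at_right 0. e < (1::real)"
      using eventually_at_right_less[of 0] eventually_at_right_real[of 0 1] by (auto elim: eventually_mono)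
    moreover have "\<forall>\<^sub>F e in at_right 0. e > (0::real)" by (simp add: eventually_at_right_less)
    ultimately have "\<forall>\<^sub>F e::real in at_right 0. False"
    proof eventually_elim
      case (elim e)
      have e: "0 < e" "e < 1" using elim by auto
      let ?Z = "norm (\<Sum>n. npow (Suc n) (of_real (1 + e)))"
      have "?Z \<le> 1 + 1 / e" using zeta_le[of "1 + e"] e by simp
      also have "\<dots> \<le> 2 / e" using e by (simp add: field_simps)
      finally have Z: "?Z ^ 3 \<le> (2 / e) ^ 3" by (intro power_mono) auto
      have "1 \<le> ?Z ^ 3 * norm (L (Complex (1 + e) t)) ^ 4 * norm (Lsq (Complex (1 + e) (2 * t)))"
        using e by (intro three_four_one) auto
      also have "\<dots> \<le> (2 / e) ^ 3 * norm (L (Complex (1 + e) t)) ^ 4 * norm (Lsq (Complex (1 + e) (2 * t)))"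
        by (intro mult_right_mono Z) auto
      also have "Complex (1 + e) t = s + of_real e" by (simp add: s complex_eq_iff)
      also have "Complex (1 + e) (2 * t) = s2 + of_real e" by (simp add: s2_def complex_eq_iff)
      also have "(2 / e) ^ 3 * norm (L (s + of_real e)) ^ 4 * norm (Lsq (s2 + of_real e)) = 
         8 * norm (L (s + of_real e) / of_real e) ^ 4 * (e * norm (Lsq (s2 + of_real e)))"
        using e by (simp add: norm_divide power_divide power3_eq_cube power4_eq_xxxx)
      finally show False using elim(1) by simp
    qed
    thus False by simp
  qed
qed

end

section \<open>The Moebius function twisted by a character\<close>

definition moebius :: "nat \<Rightarrow> int" where
  "moebius n = (if squarefree n then (- 1) ^ card (prime_factors n) else 0)"

lemma abs_moebius_le: "\<bar>moebius n\<bar> \<le> 1"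
  by (simp add: moebius_def)

lemma moebius_prime_times:
  assumes p: "prime p" "\<not> p dvd k" "k > 0"
  shows "moebius (p * k) = - moebius k"
proof -
  have "coprime p k" using p by (simp add: prime_imp_coprime)
  hence sq: "squarefree (p * k) \<longleftrightarrow> squarefree k"
    using squarefree_mult_coprime[of p k] squarefree_prime[OF p(1)] squarefree_mono[of k "p * k"] by auto
  have "prime_factors (p * k) = insert p (prime_factors k)"
    using p prime_factors_product[of p k] prime_gt_0_nat[OF p(1)]
    by (simp add: prime_prime_factors)
  moreover have "p \<notin> prime_factors k" using p by auto
  ultimately show ?thesis using sq by (simp add: moebius_def)
qed

text \<open>
  For a prime p dividing n, pair each divisor d prime to p with p d: their contributions cancel,
  and the remaining divisors are divisible by p^2.
\<close>
lemma sum_moebius_divisors: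
  assumes "n > 0"
  shows "(\<Sum>d | d dvd n. moebius d) = (if n = 1 then 1 else 0)"
proof (cases "n = 1")
  case False
  then obtain p where p: "prime p" "p dvd n" using prime_factor_nat[of n] by blast
  define D where "D = {d. d dvd n}"
  define D1 where "D1 = {d\<in>D. \<not> p dvd d}"
  have finD: "finite D" unfolding D_def using assms by simp
  hence fin: "finite D1" by (simp add: D1_def)
  have pos: "d > 0" if "d \<in> D1" for d using that assms by (auto simp: D1_def D_def dvd_pos_nat)
  have img: "(*) p ` D1 \<subseteq> D - D1"
  proof
    fix x assume "x \<in> (*) p ` D1"
    then obtain d where d: "x = p * d" "d dvd n" "\<not> p dvd d" by (auto simp: D1_def D_def)
    have "coprime p d" using p d by (simp add: prime_imp_coprime)
    hence "p * d dvd n" using p d by (simp add: divides_mult)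
    thus "x \<in> D - D1" using d by (auto simp: D_def D1_def)
  qed
  have "(\<Sum>d\<in>D. moebius d) = (\<Sum>d\<in>D1. moebius d) + (\<Sum>d\<in>D - D1. moebius d)"
    using sum.subset_diff[of D1 D moebius] finD by (auto simp: D1_def)
  also have "(\<Sum>d\<in>D - D1. moebius d) = (\<Sum>d\<in>(*) p ` D1. moebius d)"
  proof (rule sum.mono_neutral_right)
    show "\<forall>d\<in>D - D1 - (*) p ` D1. moebius d = 0"
    proof
      fix d assume d: "d \<in> D - D1 - (*) p ` D1"
      hence "p dvd d" "d dvd n" by (auto simp: D1_def D_def)
      then obtain k where k: "d = p * k" by blast
      have "k dvd n" using \<open>d dvd n\<close> k by (metis dvd_mult_right)
      hence "p dvd k" using d k by (auto simp: D1_def D_def)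
      hence "p ^ 2 dvd d" by (simp add: k power2_eq_square mult_dvd_mono)
      hence "\<not> squarefree d" using p(1) not_squarefreeI[of p d] not_prime_unit by blast
      thus "moebius d = 0" by (simp add: moebius_def)
    qed
  qed (use finD img in auto)
  also have "\<dots> = (\<Sum>d\<in>D1. moebius (p * d))"
    using prime_gt_0_nat[OF p(1)] by (subst sum.reindex) (auto simp: inj_on_def)
  also have "\<dots> = (\<Sum>d\<in>D1. - moebius d)"
    using p(1) pos by (intro sum.cong moebius_prime_times) (auto simp: D1_def)
  finally show ?thesis using False by (simp add: D_def sum_negf)
qed (auto simp: moebius_def)

text \<open>
  Rearrange the absolutely convergent double series over pairs (a, b) by n = a b and d = a.
\<close>
lemma dirichlet_product:
  fixes f g :: "nat \<Rightarrow> complex"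
  assumes f: "(\<lambda>n. norm (f n)) summable_on {0<..}" and g: "(\<lambda>n. norm (g n)) summable_on {0<..}"
  shows "infsum f {0<..} * infsum g {0<..} = (\<Sum>\<^sub>\<infinity>n\<in>{0<..}. \<Sum>d | d dvd n. f d * g (n div d))"
proof -
  let ?N = "{0::nat<..}"
  let ?S = "Sigma ?N (\<lambda>n. {d. d dvd n})"
  let ?k = "\<lambda>(n, d). f d * g (n div d)"
  let ?p = "\<lambda>(a, b). f a * g b"
  have inner: "infsum (\<lambda>b. norm (?p (a, b))) ?N = norm (f a) * infsum (\<lambda>b. norm (g b)) ?N" for a
    unfolding prod.case norm_mult by (rule infsum_cmult_right') 
  have "(\<lambda>x. norm (?p x)) summable_on (?N \<times> ?N)"
    unfolding Infinite_Sum.abs_summable_on_Sigma_iff inner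
  proof (intro conjI ballI)
    fix a assume "a \<in> ?N"
    show "(\<lambda>b. norm (?p (a, b))) summable_on ?N"
      unfolding prod.case norm_mult by (rule summable_on_cmult_right[OF g])
  next
    have "norm (norm (f a) * c) = norm (f a) * \<bar>c\<bar>" for a and c :: real by (simp add: abs_mult)
    thus "(\<lambda>a. norm (norm (f a) * infsum (\<lambda>b. norm (g b)) ?N)) summable_on ?N"
      by (simp only: summable_on_cmult_left[OF f])
  qed
  hence summ: "(\<lambda>(a, b). f a * g b) summable_on (?N \<times> ?N)" by (rule abs_summable_summable)
  have bij: "bij_betw (\<lambda>(a, b). (a * b, a)) (?N \<times> ?N) ?S"
    by (rule bij_betwI[of _ _ _ "\<lambda>(n, d). (d, n div d)"]) (auto elim!: dvdE)
  have k: "?k ((\<lambda>(a, b). (a * b, a)) x) = (\<lambda>(a, b). f a * g b) x" if "x \<in> ?N \<times> ?N" for x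
    using that by auto
  have summk: "?k summable_on ?S"
    unfolding summable_on_reindex_bij_betw[OF bij, symmetric]
    using summ by (rule summable_on_cong[THEN iffD1, rotated]) (use k in auto)
  have "infsum f ?N * infsum g ?N = (\<Sum>\<^sub>\<infinity>a\<in>?N. \<Sum>\<^sub>\<infinity>b\<in>?N. f a * g b)"
    by (simp add: infsum_cmult_left' infsum_cmult_right')
  also have "\<dots> = infsum (\<lambda>(a, b). f a * g b) (?N \<times> ?N)" by (rule infsum_Sigma'_banach[OF summ])
  also have "\<dots> = infsum (\<lambda>x. ?k ((\<lambda>(a, b). (a * b, a)) x)) (?N \<times> ?N)"
    by (rule infsum_cong) (use k in auto)
  also have "\<dots> = infsum ?k ?S" by (rule infsum_reindex_bij_betw[OF bij])
  also have "\<dots> = (\<Sum>\<^sub>\<infinity>n\<in>?N. \<Sum>\<^sub>\<infinity>d\<in>{d. d dvd n}. f d * g (n div d))"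
    by (rule infsum_Sigma'_banach[symmetric]) (rule summk)
  also have "\<dots> = (\<Sum>\<^sub>\<infinity>n\<in>?N. \<Sum>d | d dvd n. f d * g (n div d))"
    by (intro infsum_cong infsum_finite) auto
  finally show ?thesis .
qed

lemma cesaro_mean_tendsto:
  fixes x :: "nat \<Rightarrow> 'a :: real_normed_vector"
  assumes "x \<longlonglongrightarrow> l"
  shows "(\<lambda>N. (\<Sum>n<N. x n) /\<^sub>R real N) \<longlonglongrightarrow> l"
proof -
  have null: "(\<lambda>N. (\<Sum>n<N. y n) /\<^sub>R real N) \<longlonglongrightarrow> 0" if y: "y \<longlonglongrightarrow> 0" for y :: "nat \<Rightarrow> 'a"
  proof (rule LIMSEQ_I)
    fix e :: real assume e: "e > 0"
    obtain n0 where n0: "\<And>n. n \<ge> n0 \<Longrightarrow> norm (y n) < e / 2"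
      using LIMSEQ_D[OF y, of "e / 2"] e by auto
    define C where "C = (\<Sum>n<n0. norm (y n))"
    have C0: "C \<ge> 0" by (simp add: C_def sum_nonneg)
    have "norm ((\<Sum>n<N. y n) /\<^sub>R real N - 0) < e" if N: "N > max n0 (nat \<lceil>2 * C / e\<rceil>)" for N
    proof -
      have "norm (\<Sum>n<N. y n) \<le> (\<Sum>n<N. norm (y n))" by (rule norm_sum)
      also have "(\<Sum>n<N. norm (y n)) = C + (\<Sum>n\<in>{n0..<N}. norm (y n))"
        unfolding C_def using N by (subst sum.union_disjoint[symmetric]) (auto intro!: sum.cong)
      also have "(\<Sum>n\<in>{n0..<N}. norm (y n)) \<le> (\<Sum>n\<in>{n0..<N}. e / 2)"
        using n0 by (intro sum_mono less_imp_le) auto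
      also have "\<dots> \<le> real N * (e / 2)" using e by (simp add: mult_right_mono)
      finally have 1: "norm (\<Sum>n<N. y n) \<le> C + real N * (e / 2)" by simp
      have "2 * C / e < real N" using N by linarith
      hence "C < real N * (e / 2)" using e by (simp add: field_simps)
      hence "norm (\<Sum>n<N. y n) < real N * e" using 1 by linarith
      moreover have "norm ((\<Sum>n<N. y n) /\<^sub>R real N) = norm (\<Sum>n<N. y n) / real N"
        by (simp add: divide_inverse mult.commute)
      ultimately show ?thesis using N by (simp add: field_simps)
    qed
    thus "\<exists>no. \<forall>N\<ge>no. norm ((\<Sum>n<N. y n) /\<^sub>R real N - 0) < e"
      by (metis Suc_le_lessD)
  qed
  have "(\<lambda>n. x n - l) \<longlonglongrightarrow> 0" using assms by (rule LIM_zero)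
  from null[OF this] have 0: "(\<lambda>N. (\<Sum>n<N. x n - l) /\<^sub>R real N) \<longlonglongrightarrow> 0" .
  have "\<forall>\<^sub>F N in sequentially. (\<Sum>n<N. x n - l) /\<^sub>R real N = (\<Sum>n<N. x n) /\<^sub>R real N - l"
    using eventually_gt_at_top[of 0]
    by eventually_elim (simp add: sum_subtractf scaleR_diff_right sum_constant_scaleR)
  from Lim_transform_eventually[OF 0 this] show ?thesis by (rule LIM_zero_cancel)
qed

text \<open>
  Kronecker's lemma: by partial summation the mean of the a n is the difference between the
  partial sums of the series of a n / (n + 1) and their Cesaro means, up to a factor tending to 1.
\<close>
lemma mean_tendsto_0_if_sums_divided:
  fixes a :: "nat \<Rightarrow> complex"
  assumes "(\<lambda>n. a n / of_nat (Suc n)) sums l"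
  shows "(\<lambda>N. (\<Sum>n<N. a n) / of_nat N) \<longlonglongrightarrow> 0"
proof -
  define S where "S N = (\<Sum>n<N. a n / of_nat (Suc n))" for N
  have S: "S \<longlonglongrightarrow> l" using assms unfolding sums_def S_def[symmetric] .
  have sum_a: "(\<Sum>n<N. a n) = S N * of_nat (Suc N) - (\<Sum>n<N. S (Suc n))" for N
  proof -
    have "(\<Sum>n<N. a n) = (\<Sum>n<N. a n / of_nat (Suc n) * of_nat (Suc n))"
      by (simp del: of_nat_Suc)
    also have "\<dots> = S N * of_nat (Suc N) + (\<Sum>n<N. S (Suc n) * (of_nat (Suc n) - of_nat (Suc (Suc n))))"
      unfolding S_def by (rule sum_by_parts)
    also have "(\<Sum>n<N. S (Suc n) * (of_nat (Suc n) - of_nat (Suc (Suc n)))) = - (\<Sum>n<N. S (Suc n))"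
      by (simp add: sum_negf[symmetric])
    finally show ?thesis by simp
  qed
  have eq: "(\<Sum>n<N. a n) / of_nat N = S N * (of_nat (Suc N) / of_nat N) - (\<Sum>n<N. S (Suc n)) /\<^sub>R real N" for N
  proof -
    have "(\<Sum>n<N. S (Suc n)) /\<^sub>R real N = (\<Sum>n<N. S (Suc n)) / of_nat N"
      by (simp add: scaleR_conv_of_real divide_inverse mult.commute)
    thus ?thesis by (simp only: sum_a diff_divide_distrib times_divide_eq_right)
  qed
  have ratio: "(\<lambda>N. of_nat (Suc N) / of_nat N :: complex) \<longlonglongrightarrow> 1"
  proof -
    have "(\<lambda>N. real (Suc N) / real N) \<longlonglongrightarrow> 1" by real_asymp
    hence "(\<lambda>N. complex_of_real (real (Suc N) / real N)) \<longlonglongrightarrow> of_real 1" by (rule tendsto_of_real)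
    thus ?thesis by simp
  qed
  have "(\<lambda>N. S N * (of_nat (Suc N) / of_nat N) - (\<Sum>n<N. S (Suc n)) /\<^sub>R real N) \<longlonglongrightarrow> l * 1 - l"
    by (intro tendsto_diff tendsto_mult S ratio cesaro_mean_tendsto LIMSEQ_Suc[OF S])
  thus ?thesis unfolding eq by simp
qed

context nonreal_character
begin

lemma norm_moebius_chi_le: "norm (of_int (moebius n) * chi n) \<le> 1"
  using mult_mono[OF _ norm_chi, of "norm (of_int (moebius n) :: complex)" 1 n] abs_moebius_le[of n]
  by (simp add: norm_mult flip: of_int_abs)

lemma moebius_series_sums_inverse_L:
  assumes s: "Re s > 1"
  shows "(\<lambda>n. (of_int (moebius (Suc n)) * chi (Suc n)) * npow (Suc n) s) sums (1 / L s)"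
proof -
  define f where "f n = of_int (moebius n) * chi n * npow n s" for n
  define g where "g n = chi n * npow n s" for n
  have sf: "summable (\<lambda>n. norm (f (Suc n)))" 
    unfolding f_def by (intro summable_norm_dirichlet s norm_moebius_chi_le)
  have sg: "summable (\<lambda>n. norm (g (Suc n)))"
    unfolding g_def by (intro summable_norm_dirichlet s norm_chi)
  have hf: "(f has_sum (\<Sum>n. f (Suc n))) {0<..}" "((\<lambda>n. norm (f n)) has_sum (\<Sum>n. norm (f (Suc n)))) {0<..}"
    using sums_Suc_imp_has_sum[of f 0] sums_Suc_imp_has_sum[of "\<lambda>n. norm (f n)" 0] sf by simp_all
  have hg: "(g has_sum (\<Sum>n. g (Suc n))) {0<..}" "((\<lambda>n. norm (g n)) has_sum (\<Sum>n. norm (g (Suc n)))) {0<..}"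
    using sums_Suc_imp_has_sum[of g 0] sums_Suc_imp_has_sum[of "\<lambda>n. norm (g n)" 0] sg by simp_all
  have "(\<Sum>n. f (Suc n)) * (\<Sum>n. g (Suc n)) = infsum f {0<..} * infsum g {0<..}"
    using infsumI[OF hf(1)] infsumI[OF hg(1)] by simp
  also have "\<dots> = (\<Sum>\<^sub>\<infinity>n\<in>{0<..}. \<Sum>d | d dvd n. f d * g (n div d))"
    by (rule dirichlet_product[OF has_sum_imp_summable[OF hf(2)] has_sum_imp_summable[OF hg(2)]])
  also have "\<dots> = (\<Sum>\<^sub>\<infinity>n\<in>{0::nat<..}. if n = 1 then 1 else 0)"
  proof (rule infsum_cong)
    fix n :: nat assume n: "n \<in> {0<..}"
    have "(\<Sum>d | d dvd n. f d * g (n div d)) = (\<Sum>d | d dvd n. of_int (moebius d) * g n)"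
    proof (rule sum.cong)
      fix d assume "d \<in> {d. d dvd n}"
      then obtain e where e: "n = d * e" by blast
      hence pos: "d > 0" "e > 0" using n by auto
      have "n div d = e" using e pos by simp
      thus "f d * g (n div d) = of_int (moebius d) * g n"
        using pos by (simp add: f_def g_def e chi_mult npow_mult)
    qed simp
    also have "\<dots> = of_int (\<Sum>d | d dvd n. moebius d) * g n" by (simp add: sum_distrib_right)
    also have "\<dots> = (if n = 1 then 1 else 0)"
      using n sum_moebius_divisors[of n] chi_1 by (auto simp: g_def)
    finally show "(\<Sum>d | d dvd n. f d * g (n div d)) = (if n = 1 then 1 else 0)" .
  qed
  also have "\<dots> = (\<Sum>\<^sub>\<infinity>n\<in>{1::nat}. (1 :: complex))"
    by (rule infsum_cong_neutral) auto
  finally have "(\<Sum>n. f (Suc n)) * L s = 1" by (simp add: L_def g_def)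
  hence "(\<Sum>n. f (Suc n)) = 1 / L s" by (metis divide_eq_eq mult_zero_right zero_neq_one)
  moreover have "(\<lambda>n. f (Suc n)) sums (\<Sum>n. f (Suc n))"
    by (rule summable_sums[OF summable_norm_cancel[OF sf]])
  ultimately show ?thesis by (simp add: f_def)
qed

text \<open>
  Newman's theorem applies to 1/L on the open set where Re s > 0 and L(s) is nonzero.
\<close>
lemma mean_moebius_chi_tendsto_0:
  "(\<lambda>N. (\<Sum>n<N. of_int (moebius (Suc n)) * chi (Suc n)) / of_nat N) \<longlonglongrightarrow> 0"
proof -
  define U where "U = {s. Re s > 0} \<inter> L -` (- {0})"
  have op: "open {s. Re s > 0}" using open_halfspace_Re_gt[of 0] by simp
  have U: "open U"
    unfolding U_def 
    by (rule continuous_open_preimage[OF holomorphic_on_imp_continuous_on[OF holomorphic_L] op]) auto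
  have "(\<lambda>n. (of_int (moebius (Suc n)) * chi (Suc n)) / of_nat (Suc n)) sums (1 / L 1)"
  proof (rule newman_tauberian[where C = 1 and U = U and G = "\<lambda>s. 1 / L s"])
    show "norm (of_int (moebius (Suc n)) * chi (Suc n)) \<le> 1" for n
      by (rule norm_moebius_chi_le)
    show "(\<lambda>s. 1 / L s) holomorphic_on U"
      by (intro holomorphic_intros holomorphic_on_subset[OF holomorphic_L]) (auto simp: U_def)
    show "{s. Re s \<ge> 1} \<subseteq> U" using L_nonzero by (auto simp: U_def)
  qed (rule U moebius_series_sums_inverse_L | assumption)+
  thus ?thesis by (rule mean_tendsto_0_if_sums_divided)
qed

end

section \<open>The von Mangoldt function twisted by a character\<close>

lemma sum_divisor_pairs:
  fixes F :: "nat \<Rightarrow> nat \<Rightarrow> 'a :: comm_monoid_add"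
  shows "(\<Sum>n\<in>{1..N}. \<Sum>a | a dvd n. F a (n div a)) = (\<Sum>a\<in>{1..N}. \<Sum>b\<in>{1..N div a}. F a b)"
proof -
  have "(\<Sum>n\<in>{1..N}. \<Sum>a | a dvd n. F a (n div a)) = (\<Sum>(n, a)\<in>(SIGMA n:{1..N}. {a. a dvd n}). F a (n div a))"
    by (rule sum.Sigma) auto
  also have "\<dots> = (\<Sum>(a, b)\<in>(SIGMA a:{1..N}. {1..N div a}). F a b)"
  proof (rule sum.reindex_bij_witness[of _ "\<lambda>(a, b). (a * b, a)" "\<lambda>(n, a). (a, n div a)"], goal_cases)
    case (2 x)
    then obtain n a where x: "x = (n, a)" "n > 0" "n \<le> N" "a dvd n" by (auto simp: Suc_le_eq)
    then obtain b where b: "n = a * b" by blast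
    have pos: "a > 0" "b > 0" using x b by auto
    have "a \<le> N" using le_trans[of a "a * b" N] pos x(3) b by simp
    moreover have "b * a \<le> N" using x(3) unfolding b by (simp add: mult.commute)
    hence "b \<le> N div a" using pos by (simp add: less_eq_div_iff_mult_less_eq)
    ultimately show ?case using x b pos by simp
  next
    case (4 x)
    then obtain a b where x: "x = (a, b)" "a > 0" "b > 0" "b \<le> N div a" by (auto simp: Suc_le_eq)
    hence "b * a \<le> N" by (simp add: less_eq_div_iff_mult_less_eq)
    thus ?case using x by (simp add: mult.commute Suc_le_eq)
  qed (auto elim!: dvdE simp: less_eq_div_iff_mult_less_eq mult.commute Suc_le_eq)
  also have "\<dots> = (\<Sum>a\<in>{1..N}. \<Sum>b\<in>{1..N div a}. F a b)"
    by (rule sum.Sigma[symmetric]) auto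
  finally show ?thesis .
qed

text \<open>
  Moebius inversion of the identity that the sum of \<Lambda>(d) over the divisors d of n is log
  n.
\<close>
lemma mangoldt_eq_sum_moebius_ln:
  assumes "n > 0"
  shows "(mangoldt n :: complex) = (\<Sum>d | d dvd n. of_int (moebius d) * of_real (ln (real (n div d))))"
proof -
  have "(\<Sum>d | d dvd n. of_int (moebius d) * of_real (ln (real (n div d))))
     = (\<Sum>d | d dvd n. \<Sum>e | e dvd n div d. of_int (moebius d) * (mangoldt e :: complex))"
  proof (rule sum.cong)
    fix d assume "d \<in> {d. d dvd n}"
    hence "n div d \<noteq> 0" using assms by (auto elim!: dvdE)
    thus "of_int (moebius d) * of_real (ln (real (n div d))) = (\<Sum>e | e dvd n div d. of_int (moebius d) * (mangoldt e :: complex))"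
      by (simp add: mangoldt_sum[symmetric] sum_distrib_left)
  qed simp
  also have "\<dots> = (\<Sum>(d, e)\<in>(SIGMA d:{d. d dvd n}. {e. e dvd n div d}). of_int (moebius d) * mangoldt e)"
    using assms by (intro sum.Sigma) (auto elim!: dvdE)
  also have "\<dots> = (\<Sum>(e, d)\<in>(SIGMA e:{e. e dvd n}. {d. d dvd n div e}). of_int (moebius d) * mangoldt e)"
    by (rule sum.reindex_bij_witness[of _ "\<lambda>(e, d). (d, e)" "\<lambda>(d, e). (e, d)"])
       (use assms in \<open>auto elim!: dvdE\<close>)
  also have "\<dots> = (\<Sum>e | e dvd n. \<Sum>d | d dvd n div e. of_int (moebius d) * mangoldt e)"
    using assms by (intro sum.Sigma[symmetric]) (auto elim!: dvdE)
  also have "\<dots> = (\<Sum>e | e dvd n. if e = n then mangoldt n else 0)"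
  proof (rule sum.cong)
    fix e assume "e \<in> {e. e dvd n}"
    then obtain k where k: "n = e * k" by blast
    hence pos: "e > 0" "k > 0" using assms by auto
    hence "n div e = k" using k by simp
    moreover have "k = 1 \<longleftrightarrow> e = n" using k pos by auto
    moreover have "(\<Sum>d | d dvd k. of_int (moebius d) * (mangoldt e :: complex)) = of_int (\<Sum>d | d dvd k. moebius d) * mangoldt e"
      by (simp add: sum_distrib_right)
    ultimately show "(\<Sum>d | d dvd n div e. of_int (moebius d) * mangoldt e) = (if e = n then mangoldt n else (0 :: complex))"
      using sum_moebius_divisors[OF pos(2)] by auto
  qed simp
  also have "\<dots> = mangoldt n" using assms by simp
  finally show ?thesis by simp
qed

lemma ln_le_2_sqrt:
  assumes "x > 0" shows "ln x \<le> 2 * sqrt x"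
proof -
  have "ln x = 2 * ln (sqrt x)" using assms by (simp add: ln_sqrt)
  moreover have "ln (sqrt x) \<le> sqrt x - 1" using assms by (intro ln_le_minus_one) simp
  ultimately show ?thesis by simp
qed

lemma sum_inverse_sqrt_le: "(\<Sum>k\<in>{1..K}. 1 / sqrt (real k)) \<le> 2 * sqrt (real K)"
proof (induction K)
  case (Suc K)
  define u where "u = sqrt (real K)"
  define v where "v = sqrt (real (Suc K))"
  have v: "v > 0" "u \<ge> 0" "v * v = u * u + 1" by (simp_all add: u_def v_def)
  have "0 \<le> (v - u) * (v - u)" by simp
  hence "2 * u * v + 1 \<le> 2 * (v * v)" using v(3) by (simp add: algebra_simps)
  hence "2 * u + 1 / v \<le> 2 * v" using v(1) by (simp add: field_simps)
  thus ?case using Suc.IH by (simp add: u_def v_def)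
qed simp

context nonreal_character
begin

text \<open>
  Summation by parts gives 2 m ln (N + 1). The weaker bound by the square root of N leads to sums
  over a that are easy to estimate below.
\<close>
lemma norm_sum_chi_ln_le:
  assumes "N > 0"
  shows "norm (\<Sum>b\<in>{1..N}. chi b * of_real (ln (real b))) \<le> 8 * real m * sqrt (real N)"
proof -
  let ?u = "\<lambda>n. complex_of_real (ln (real (Suc n)))"
  have "(\<Sum>b\<in>{1..N}. chi b * of_real (ln (real b))) = (\<Sum>n<N. chi (Suc n) * ?u n)"
    by (rule sum.reindex_bij_witness[of _ Suc "\<lambda>b. b - 1"]) auto
  also have "\<dots> = (\<Sum>n<N. chi (Suc n)) * ?u N + (\<Sum>n<N. (\<Sum>k<Suc n. chi (Suc k)) * (?u n - ?u (Suc n)))"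
    by (rule sum_by_parts)
  also have "norm \<dots> \<le> real m * ln (real (Suc N)) + (\<Sum>n<N. real m * (ln (real (Suc (Suc n))) - ln (real (Suc n))))"
  proof (intro norm_triangle_le add_mono sum_norm_le)
    show "norm ((\<Sum>n<N. chi (Suc n)) * ?u N) \<le> real m * ln (real (Suc N))"
      unfolding norm_mult norm_of_real by (intro mult_mono norm_sum_chi_le) auto
    fix n
    have "norm (?u n - ?u (Suc n)) = ln (real (Suc (Suc n))) - ln (real (Suc n))"
      by (subst of_real_diff[symmetric], subst norm_of_real) simp
    thus "norm ((\<Sum>k<Suc n. chi (Suc k)) * (?u n - ?u (Suc n))) \<le> real m * (ln (real (Suc (Suc n))) - ln (real (Suc n)))"
      unfolding norm_mult by (intro mult_mono norm_sum_chi_le) auto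
  qed
  also have "(\<Sum>n<N. real m * (ln (real (Suc (Suc n))) - ln (real (Suc n)))) = real m * ln (real (Suc N))"
    unfolding sum_distrib_left[symmetric] by (subst sum_lessThan_telescope) simp
  also have "real m * ln (real (Suc N)) + real m * ln (real (Suc N)) \<le> 8 * real m * sqrt (real N)"
  proof -
    have "ln (real (Suc N)) \<le> 2 * sqrt (real (Suc N))" by (rule ln_le_2_sqrt) simp
    also have "sqrt (real (Suc N)) \<le> sqrt (4 * real N)" using assms by (intro real_sqrt_le_mono) simp
    also have "\<dots> = 2 * sqrt (real N)" by (simp add: real_sqrt_mult)
    finally have "ln (real (Suc N)) \<le> 4 * sqrt (real N)" by simp
    from mult_left_mono[OF this, of "real m"] show ?thesis by simp
  qed
  finally show ?thesis .
qed

definition M :: "nat \<Rightarrow> complex" where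
  "M N = (\<Sum>a\<in>{1..N}. of_int (moebius a) * chi a)"

lemma M_over_N_tendsto_0: "(\<lambda>N. norm (M N) / real N) \<longlonglongrightarrow> 0"
proof -
  have "M N = (\<Sum>n<N. of_int (moebius (Suc n)) * chi (Suc n))" for N
    unfolding M_def by (rule sum.reindex_bij_witness[of _ Suc "\<lambda>b. b - 1"]) auto
  thus ?thesis using tendsto_norm_zero[OF mean_moebius_chi_tendsto_0] by (simp add: norm_divide)
qed

text \<open>
  The hyperbola method for \<chi>(n) \<Lambda>(n), the sum of \<mu>(a) \<chi>(a) \<chi>(b) ln b
  over a b = n. Pairs with b \<le> B are collected by b and give the sums M(N div b). In the
  others a \<le> N/B, and the sum over b is bounded by the mean-zero property of \<chi>.
\<close>
lemma norm_sum_chi_mangoldt_le: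
  assumes B: "B > 0" and N: "N > 0"
  shows "norm (\<Sum>n\<in>{1..N}. chi n * mangoldt n)
     \<le> (\<Sum>b\<in>{1..B}. ln (real b) * norm (M (N div b))) + 32 * real m * real N / sqrt (real B)"
proof -
  define l where "l b = chi b * complex_of_real (ln (real b))" for b
  define f where "f a = of_int (moebius a) * chi a" for a
  define V where "V y = (\<Sum>b\<in>{1..y}. l b)" for y
  have "(\<Sum>n\<in>{1..N}. chi n * mangoldt n) = (\<Sum>n\<in>{1..N}. \<Sum>a | a dvd n. f a * l (n div a))"
  proof (rule sum.cong)
    fix n assume n: "n \<in> {1..N}"
    have "chi n * mangoldt n = (\<Sum>d | d dvd n. chi n * (of_int (moebius d) * of_real (ln (real (n div d)))))"
      using n by (subst mangoldt_eq_sum_moebius_ln) (auto simp: sum_distrib_left)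
    also have "\<dots> = (\<Sum>a | a dvd n. f a * l (n div a))"
    proof (rule sum.cong)
      fix d assume "d \<in> {d. d dvd n}"
      then obtain k where k: "n = d * k" by blast
      hence "n div d = k" using n by auto
      thus "chi n * (of_int (moebius d) * of_real (ln (real (n div d)))) = f d * l (n div d)"
        by (simp add: f_def l_def k chi_mult mult_ac)
    qed simp
    finally show "chi n * mangoldt n = (\<Sum>a | a dvd n. f a * l (n div a))" .
  qed simp
  also have "\<dots> = (\<Sum>a\<in>{1..N}. \<Sum>b\<in>{1..N div a}. f a * l b)" by (rule sum_divisor_pairs)
  \<comment> \<open>split the inner sum at b = B\<close>
  also have "\<dots> = (\<Sum>a\<in>{1..N}. f a * V (min B (N div a)) + f a * (V (N div a) - V (min B (N div a))))"
    unfolding V_def by (simp add: sum_distrib_left algebra_simps)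
  also have "\<dots> = (\<Sum>a\<in>{1..N}. f a * V (min B (N div a))) + (\<Sum>a\<in>{1..N}. f a * (V (N div a) - V (min B (N div a))))"
    by (rule sum.distrib)
  also have "(\<Sum>a\<in>{1..N}. f a * V (min B (N div a))) = (\<Sum>b\<in>{1..B}. l b * M (N div b))"
  proof -
    have "(\<Sum>a\<in>{1..N}. f a * V (min B (N div a))) = (\<Sum>(a, b)\<in>(SIGMA a:{1..N}. {1..min B (N div a)}). f a * l b)"
      unfolding V_def sum_distrib_left by (rule sum.Sigma) auto
    also have "\<dots> = (\<Sum>(b, a)\<in>(SIGMA b:{1..B}. {1..N div b}). f a * l b)"
    proof (rule sum.reindex_bij_witness[of _ "\<lambda>(b, a). (a, b)" "\<lambda>(a, b). (b, a)"], goal_cases)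
      case (2 x)
      thus ?case by (auto simp: less_eq_div_iff_mult_less_eq mult.commute Suc_le_eq)
    next
      case (4 x)
      then obtain b a where x: "x = (b, a)" "b > 0" "b \<le> B" "a > 0" "a * b \<le> N"
        by (auto simp: less_eq_div_iff_mult_less_eq Suc_le_eq)
      have "a \<le> N" using le_trans[of a "a * b" N] x by simp
      thus ?case using x by (auto simp: less_eq_div_iff_mult_less_eq mult.commute Suc_le_eq)
    qed auto
    also have "\<dots> = (\<Sum>b\<in>{1..B}. \<Sum>a\<in>{1..N div b}. f a * l b)"
      by (rule sum.Sigma[symmetric]) auto
    also have "\<dots> = (\<Sum>b\<in>{1..B}. l b * M (N div b))"
      by (simp add: M_def f_def sum_distrib_left mult_ac)
    finally show ?thesis .
  qed
  also have "(\<Sum>a\<in>{1..N}. f a * (V (N div a) - V (min B (N div a)))) = 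
     (\<Sum>a\<in>{1..N div B}. f a * (V (N div a) - V (min B (N div a))))"
  proof (rule sum.mono_neutral_right)
    show "\<forall>a\<in>{1..N} - {1..N div B}. f a * (V (N div a) - V (min B (N div a))) = 0"
    proof
      fix a assume a: "a \<in> {1..N} - {1..N div B}"
      hence "\<not> a * B \<le> N" using B by (auto simp: less_eq_div_iff_mult_less_eq)
      hence "N div a < B" using a by (auto simp: div_less_iff_less_mult mult.commute)
      thus "f a * (V (N div a) - V (min B (N div a))) = 0" by simp
    qed
    show "{1..N div B} \<subseteq> {1..N}" using div_le_dividend[of N B] by auto
  qed auto
  also have "norm ((\<Sum>b\<in>{1..B}. l b * M (N div b)) + (\<Sum>a\<in>{1..N div B}. f a * (V (N div a) - V (min B (N div a)))))
     \<le> (\<Sum>b\<in>{1..B}. ln (real b) * norm (M (N div b))) + (\<Sum>a\<in>{1..N div B}. 16 * real m * sqrt (real N) * (1 / sqrt (real a)))"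
  proof (intro norm_triangle_le add_mono sum_norm_le)
    fix b assume b: "b \<in> {1..B}"
    have "norm (l b) \<le> 1 * ln (real b)"
      unfolding l_def norm_mult using norm_chi b by (intro mult_mono) auto
    thus "norm (l b * M (N div b)) \<le> ln (real b) * norm (M (N div b))"
      unfolding norm_mult by (intro mult_right_mono) auto
  next
    fix a assume a: "a \<in> {1..N div B}"
    have aB: "a * B \<le> N" using a B by (auto simp: less_eq_div_iff_mult_less_eq)
    have "B \<le> N div a" using a aB by (auto simp: less_eq_div_iff_mult_less_eq mult.commute)
    have Vle: "norm (V y) \<le> 8 * real m * sqrt (real y)" if "y > 0" for y
      unfolding V_def l_def using norm_sum_chi_ln_le[OF that] .
    have "norm (V (N div a) - V (min B (N div a))) \<le> 8 * real m * sqrt (real (N div a)) + 8 * real m * sqrt (real B)"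
      using \<open>B \<le> N div a\<close> B by (intro norm_triangle_le_diff add_mono) (auto intro!: Vle simp: min_def)
    also have "\<dots> \<le> 8 * real m * sqrt (real (N div a)) + 8 * real m * sqrt (real (N div a))"
      using \<open>B \<le> N div a\<close> by (intro add_left_mono mult_left_mono) auto
    also have "\<dots> = 16 * real m * sqrt (real (N div a))" by simp
    also have "\<dots> \<le> 16 * real m * sqrt (real N / real a)"
      by (intro mult_left_mono real_sqrt_le_mono of_nat_div_le_of_nat) auto
    also have "\<dots> = 16 * real m * sqrt (real N) * (1 / sqrt (real a))" by (simp add: real_sqrt_divide)
    finally have "norm (V (N div a) - V (min B (N div a))) \<le> 16 * real m * sqrt (real N) * (1 / sqrt (real a))" .
    moreover have "norm (f a) \<le> 1" unfolding f_def by (rule norm_moebius_chi_le)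
    ultimately have "norm (f a) * norm (V (N div a) - V (min B (N div a))) \<le> 1 * (16 * real m * sqrt (real N) * (1 / sqrt (real a)))"
      by (intro mult_mono) auto
    thus "norm (f a * (V (N div a) - V (min B (N div a)))) \<le> 16 * real m * sqrt (real N) * (1 / sqrt (real a))"
      by (simp add: norm_mult)
  qed
  also have "(\<Sum>a\<in>{1..N div B}. 16 * real m * sqrt (real N) * (1 / sqrt (real a))) \<le> 32 * real m * real N / sqrt (real B)"
  proof -
    have "(\<Sum>a\<in>{1..N div B}. 16 * real m * sqrt (real N) * (1 / sqrt (real a))) 
       \<le> 16 * real m * sqrt (real N) * (2 * sqrt (real (N div B)))"
      unfolding sum_distrib_left[symmetric] by (intro mult_left_mono sum_inverse_sqrt_le) auto
    also have "\<dots> \<le> 16 * real m * sqrt (real N) * (2 * sqrt (real N / real B))"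
      by (intro mult_left_mono real_sqrt_le_mono of_nat_div_le_of_nat) auto
    also have "\<dots> = 32 * real m * (sqrt (real N) * sqrt (real N)) / sqrt (real B)" by (simp add: real_sqrt_divide)
    finally show ?thesis by simp
  qed
  finally show ?thesis by simp
qed

text \<open>
  The parameter B is fixed so large that the second term of the hyperbola estimate stays below
  \<epsilon> / 2; then the finitely many values M(N div b) / N tend to 0.
\<close>
theorem mean_chi_mangoldt_tendsto_0:
  "(\<lambda>N. norm (\<Sum>n\<in>{1..N}. chi n * mangoldt n) / real N) \<longlonglongrightarrow> 0"
proof (rule LIMSEQ_I)
  fix e :: real assume e: "e > 0"
  \<comment> \<open>chosen so that 32 m / sqrt B < e / 2\<close>
  define B where "B = nat \<lceil>(64 * real m / e) ^ 2\<rceil> + 1"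
  have B: "B > 0" by (simp add: B_def)
  have "(64 * real m / e) ^ 2 < real B" unfolding B_def by linarith
  hence "sqrt ((64 * real m / e) ^ 2) < sqrt (real B)" by (rule real_sqrt_less_mono)
  hence "64 * real m / e < sqrt (real B)" using e by simp
  hence tail: "32 * real m / sqrt (real B) < e / 2" using e B by (simp add: field_simps)
  have head: "(\<lambda>N. \<Sum>b\<in>{1..B}. ln (real b) * (norm (M (N div b)) / real N)) \<longlonglongrightarrow> (\<Sum>b\<in>{1..B}. ln (real b) * 0)"
  proof (intro tendsto_sum tendsto_mult tendsto_const)
    fix b assume b: "b \<in> {1..B}"
    have lim: "filterlim (\<lambda>N. N div b) at_top sequentially"
      unfolding filterlim_at_top
    proof
      fix Z show "\<forall>\<^sub>F N in sequentially. Z \<le> N div b"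
        using eventually_ge_at_top[of "Z * b"] by eventually_elim (use b in \<open>auto simp: less_eq_div_iff_mult_less_eq\<close>)
    qed
    have "(\<lambda>N. norm (M (N div b)) / real (N div b)) \<longlonglongrightarrow> 0"
      using filterlim_compose[OF M_over_N_tendsto_0 lim] .
    moreover have "\<forall>\<^sub>F N in sequentially. norm (norm (M (N div b)) / real N) \<le> norm (M (N div b)) / real (N div b)"
      using eventually_ge_at_top[of b]
    proof eventually_elim
      case (elim N)
      hence "N div b > 0" using b by (simp add: div_greater_zero_iff)
      moreover have "N div b \<le> N" by simp
      ultimately show ?case by (simp add: frac_le)
    qed
    ultimately show "(\<lambda>N. norm (M (N div b)) / real N) \<longlonglongrightarrow> 0" by (rule Lim_null_comparison[rotated])
  qed
  hence "\<forall>\<^sub>F N in sequentially. (\<Sum>b\<in>{1..B}. ln (real b) * (norm (M (N div b)) / real N)) < e / 2"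
    using e by (intro order_tendstoD(2)[OF head]) auto
  hence "\<forall>\<^sub>F N in sequentially. norm (norm (\<Sum>n\<in>{1..N}. chi n * mangoldt n) / real N - 0) < e"
    using eventually_gt_at_top[of 0]
  proof eventually_elim
    case (elim N)
    have "norm (\<Sum>n\<in>{1..N}. chi n * mangoldt n) / real N \<le> 
       ((\<Sum>b\<in>{1..B}. ln (real b) * norm (M (N div b))) + 32 * real m * real N / sqrt (real B)) / real N"
      by (intro divide_right_mono norm_sum_chi_mangoldt_le B elim) auto
    also have "\<dots> = (\<Sum>b\<in>{1..B}. ln (real b) * (norm (M (N div b)) / real N)) + 32 * real m / sqrt (real B)"
      using elim(2) by (simp add: add_divide_distrib sum_divide_distrib)
    also have "\<dots> < e" using elim(1) tail by linarith
    finally show ?case by simp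
  qed
  thus "\<exists>no. \<forall>N\<ge>no. norm (norm (\<Sum>n\<in>{1..N}. chi n * mangoldt n) / real N - 0) < e"
    by (simp add: eventually_sequentially)
qed

end

section \<open>Characters built from the Fermat quotient, and Chebyshev bounds\<close>

text \<open>
  Multiplication by g permutes the residues modulo m, so the sum equals f g times itself.
\<close>
lemma sum_multiplicative_periodic_eq_0:
  fixes f :: "nat \<Rightarrow> complex"
  assumes m: "m > 0" and mult: "\<And>a b. f (a * b) = f a * f b" and per: "\<And>n. f (n + m) = f n"
    and g: "coprime g m" "f g \<noteq> 1"
  shows "(\<Sum>n<m. f n) = 0"
proof -
  have per_k: "f (n + k * m) = f n" for n k
    by (induction k) (simp_all add: per add.assoc[symmetric] add.commute[of m] flip: add.assoc)
  have mod: "f (n mod m) = f n" for n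
    using per_k[of "n mod m" "n div m"] by simp
  have inj: "inj_on (\<lambda>n. g * n mod m) {..<m}"
  proof (rule inj_onI)
    fix x y assume "x \<in> {..<m}" "y \<in> {..<m}" "g * x mod m = g * y mod m"
    moreover from this have "[x = y] (mod m)" 
      using cong_mult_lcancel_nat[OF g(1), of x y] by (simp add: unique_euclidean_semiring_class.cong_def)
    ultimately show "x = y" by (simp add: unique_euclidean_semiring_class.cong_def)
  qed
  have "(\<lambda>n. g * n mod m) ` {..<m} = {..<m}"
    using m by (intro endo_inj_surj inj) auto
  hence "(\<Sum>n<m. f n) = (\<Sum>n\<in>(\<lambda>n. g * n mod m) ` {..<m}. f n)" by simp
  also have "\<dots> = (\<Sum>n<m. f (g * n mod m))" by (subst sum.reindex[OF inj]) simp
  also have "\<dots> = f g * (\<Sum>n<m. f n)" by (simp add: mod mult sum_distrib_left)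
  finally have "(1 - f g) * (\<Sum>n<m. f n) = 0" by (simp add: left_diff_distrib)
  thus ?thesis using g(2) by simp
qed

definition fermat_quotient :: "nat \<Rightarrow> nat \<Rightarrow> nat" where
  "fermat_quotient q n = (n ^ (q - 1) - 1) div q"

lemma power_eq_fermat_quotient:
  assumes "prime q" "\<not> q dvd n"
  shows "n ^ (q - 1) = 1 + q * fermat_quotient q n"
proof -
  have "n > 0" using assms(2) by (cases n) auto
  hence ge: "n ^ (q - 1) \<ge> 1" by simp
  have "[n ^ (q - 1) = 1] (mod q)" using fermat_theorem[OF assms] .
  hence "q dvd n ^ (q - 1) - 1" using ge by (simp add: cong_altdef_nat cong_sym)
  thus ?thesis using ge by (simp add: fermat_quotient_def)
qed

lemma fermat_quotient_mult:
  assumes "prime q" "\<not> q dvd a" "\<not> q dvd b"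
  shows "[fermat_quotient q (a * b) = fermat_quotient q a + fermat_quotient q b] (mod q)"
proof -
  have q0: "q > 0" using assms prime_gt_0_nat by blast
  have ab: "\<not> q dvd a * b" using assms prime_dvd_mult_iff by blast
  define A B where "A = fermat_quotient q a" and "B = fermat_quotient q b"
  have "1 + q * fermat_quotient q (a * b) = (1 + q * A) * (1 + q * B)"
    using power_eq_fermat_quotient[OF assms(1)] assms ab unfolding A_def B_def by (metis power_mult_distrib)
  hence "q * fermat_quotient q (a * b) = q * (A + B + q * (A * B))" by (simp add: algebra_simps)
  hence "fermat_quotient q (a * b) = A + B + q * (A * B)" using q0 by (metis mult_left_cancel less_irrefl)
  thus ?thesis by (simp add: A_def B_def unique_euclidean_semiring_class.cong_def)
qed

lemma cong_cancel_mult_modulus: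
  fixes q :: nat
  assumes "q > 0" "[q * a = q * b] (mod q * q)"
  shows "[a = b] (mod q)"
  using assms unfolding unique_euclidean_semiring_class.cong_def mult_mod_right[symmetric] by simp

lemma fermat_quotient_cong:
  assumes q: "prime q" "\<not> q dvd a" "\<not> q dvd b" and ab: "[a = b] (mod q * q)"
  shows "[fermat_quotient q a = fermat_quotient q b] (mod q)"
proof -
  have q0: "q > 0" using assms prime_gt_0_nat by blast
  have "[a ^ (q - 1) = b ^ (q - 1)] (mod q * q)" using ab by (rule cong_pow)
  hence "[1 + q * fermat_quotient q a = 1 + q * fermat_quotient q b] (mod q * q)"
    using power_eq_fermat_quotient[OF q(1)] q by metis
  hence "[q * fermat_quotient q a = q * fermat_quotient q b] (mod q * q)"
    by (simp only: cong_add_lcancel_nat)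
  thus ?thesis by (rule cong_cancel_mult_modulus[OF q0])
qed

text \<open>
  (1 + q)^(q-1) is congruent to 1 + q (q - 1) modulo q^2. This provides a number coprime to q on
  which the characters are nontrivial.
\<close>
lemma fermat_quotient_Suc_q:
  assumes "prime q"
  shows "[fermat_quotient q (1 + q) = q - 1] (mod q)"
proof -
  have q: "q > 1" using assms prime_gt_1_nat by blast
  have nd: "\<not> q dvd 1 + q" using q by (metis dvd_add_left_iff dvd_refl nat_dvd_1_iff_1 less_irrefl)
  have "[(1 + q) ^ k = 1 + q * k] (mod q * q)" for k
  proof (induction k)
    case (Suc k)
    have "[(1 + q) * (1 + q) ^ k = (1 + q) * (1 + q * k)] (mod q * q)" by (rule cong_scalar_left[OF Suc])
    also have "(1 + q) * (1 + q * k) = 1 + q * Suc k + q * q * k" by (simp add: algebra_simps)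
    also have "[1 + q * Suc k + q * q * k = 1 + q * Suc k] (mod q * q)" by (simp add: unique_euclidean_semiring_class.cong_def)
    finally show ?case by simp
  qed simp
  hence "[1 + q * fermat_quotient q (1 + q) = 1 + q * (q - 1)] (mod q * q)"
    using power_eq_fermat_quotient[OF assms nd] by metis
  hence "[q * fermat_quotient q (1 + q) = q * (q - 1)] (mod q * q)" by (simp only: cong_add_lcancel_nat)
  thus ?thesis by (rule cong_cancel_mult_modulus[rotated]) (use q in simp)
qed

lemma power_root_of_unity_eq_1_iff:
  assumes "q > 0"
  shows "cis (2 * pi / real q) ^ k = 1 \<longleftrightarrow> q dvd k"
proof -
  let ?w = "cis (2 * pi / real q)"
  have wq: "?w ^ q = 1" using cis_root_of_unity[OF assms, of 1] by simp
  have "?w ^ k = ?w ^ (q * (k div q) + k mod q)" by simp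
  also have "\<dots> = (?w ^ q) ^ (k div q) * ?w ^ (k mod q)" by (simp only: power_add power_mult)
  finally have red: "?w ^ k = ?w ^ (k mod q)" by (simp add: wq)
  have inj: "inj_on (\<lambda>k. cis (2 * pi * real k / real q)) {..<q}"
    using bij_betw_imp_inj_on[OF Complex.bij_betw_roots_unity[OF assms]] .
  have pw: "cis (2 * pi * real k / real q) = ?w ^ k" for k
    unfolding Complex.DeMoivre by (rule arg_cong[of _ _ cis]) simp
  have "k mod q = 0" if "?w ^ (k mod q) = 1"
    by (rule inj_onD[OF inj]) (use that assms pw in auto)
  thus ?thesis using red wq by (auto simp: mod_eq_0_iff_dvd)
qed

text \<open>
  The character of order dividing q modulo q^2 that sends n to \<omega>^(j K(n)), where \<omega> =
  exp(2 \<pi> i / q) and K is the Fermat quotient.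
\<close>
definition fermat_char :: "nat \<Rightarrow> nat \<Rightarrow> nat \<Rightarrow> complex" where
  "fermat_char q j n = (if q dvd n then 0 else cis (2 * pi / real q) ^ (j * fermat_quotient q n))"

lemma power_root_of_unity_cong:
  assumes "q > 0" "[a = b] (mod q)"
  shows "cis (2 * pi / real q) ^ (j * a) = cis (2 * pi / real q) ^ (j * b)"
proof -
  let ?w = "cis (2 * pi / real q)"
  have wq: "?w ^ q = 1" using cis_root_of_unity[OF assms(1), of 1] by simp
  have red: "?w ^ (j * a) = (?w ^ (a mod q)) ^ j" for a
  proof -
    have "?w ^ a = ?w ^ (q * (a div q) + a mod q)" by simp
    also have "\<dots> = (?w ^ q) ^ (a div q) * ?w ^ (a mod q)" by (simp only: power_add power_mult)
    finally have "?w ^ a = ?w ^ (a mod q)" by (simp add: wq)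
    thus ?thesis by (metis power_mult mult.commute)
  qed
  show ?thesis using assms(2) unfolding red by (simp add: unique_euclidean_semiring_class.cong_def)
qed

lemma fermat_char_mult:
  assumes "prime q"
  shows "fermat_char q j (a * b) = fermat_char q j a * fermat_char q j b"
proof (cases "q dvd a \<or> q dvd b")
  case False
  hence ab: "\<not> q dvd a * b" using assms prime_dvd_mult_iff by blast
  have "cis (2 * pi / real q) ^ (j * fermat_quotient q (a * b)) 
     = cis (2 * pi / real q) ^ (j * (fermat_quotient q a + fermat_quotient q b))"
    using False assms by (intro power_root_of_unity_cong fermat_quotient_mult prime_gt_0_nat) auto
  thus ?thesis using False ab by (simp add: fermat_char_def distrib_left power_add)
qed (auto simp: fermat_char_def)

lemma nonreal_character_fermat_char:
  assumes q: "prime q" "odd q" and j: "\<not> q dvd j"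
  shows "nonreal_character (fermat_char q j) (q * q)"
proof
  have q1: "q > 1" using q prime_gt_1_nat by blast
  show "q * q > 0" using q1 by simp
  show mult: "fermat_char q j (a * b) = fermat_char q j a * fermat_char q j b" for a b
    by (rule fermat_char_mult[OF q(1)])
  show "fermat_char q j 1 = 1" using q1 by (simp add: fermat_char_def fermat_quotient_def)
  show "norm (fermat_char q j n) \<le> 1" for n by (simp add: fermat_char_def norm_power)
  show per: "fermat_char q j (n + q * q) = fermat_char q j n" for n
  proof (cases "q dvd n")
    case False
    hence nd: "\<not> q dvd n + q * q" by (metis dvd_add_left_iff dvd_triv_left)
    have "cis (2 * pi / real q) ^ (j * fermat_quotient q (n + q * q)) = cis (2 * pi / real q) ^ (j * fermat_quotient q n)"
      using q1 by (intro power_root_of_unity_cong fermat_quotient_cong[OF q(1) nd False]) (auto simp: unique_euclidean_semiring_class.cong_def)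
    thus ?thesis using False nd by (simp add: fermat_char_def)
  qed (auto simp: fermat_char_def)
  have nd: "\<not> q dvd 1 + q" using q1 by (metis dvd_add_left_iff dvd_refl nat_dvd_1_iff_1 less_irrefl)
  have cop: "coprime (1 + q) (q * q)" using nd q(1) by (metis coprime_commute coprime_mult_right_iff prime_imp_coprime)
  have g: "fermat_char q j (1 + q) = cis (2 * pi / real q) ^ (j * (q - 1))"
    using nd q1 power_root_of_unity_cong[OF _ fermat_quotient_Suc_q[OF q(1)], of j] by (simp add: fermat_char_def)
  have nd1: "\<not> q dvd q - 1" using q1 by (metis diff_less dvd_imp_le less_numeral_extra(1) not_less zero_less_diff order.strict_trans zero_less_one)
  hence nd2: "\<not> q dvd j * (q - 1)" using j q(1) prime_dvd_mult_iff by blast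
  have "\<not> q dvd 2" using q by (metis prime_nat_iff' even_numeral two_is_prime_nat primes_dvd_imp_eq)
  hence nd3: "\<not> q dvd j * (q - 1) * 2" using nd2 q(1) prime_dvd_mult_iff by blast
  show "(\<Sum>n<q * q. fermat_char q j n) = 0"
  proof (rule sum_multiplicative_periodic_eq_0[where f = "fermat_char q j" and g = "1 + q", OF _ mult per cop])
    show "fermat_char q j (1 + q) \<noteq> 1"
      unfolding g using q1 nd2 by (subst power_root_of_unity_eq_1_iff) auto
  qed (use q1 in simp)
  show "(\<Sum>n<q * q. (fermat_char q j n)\<^sup>2) = 0"
  proof (rule sum_multiplicative_periodic_eq_0[where f = "\<lambda>n. (fermat_char q j n)\<^sup>2" and g = "1 + q"])
    show "(fermat_char q j (1 + q))\<^sup>2 \<noteq> 1"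
      unfolding g power_mult[symmetric] using q1 nd3 by (subst power_root_of_unity_eq_1_iff) auto
  qed (use q1 cop per mult in \<open>auto simp: power_mult_distrib\<close>)
qed

text \<open>
  Orthogonality: the characters for j < q detect the n with n^(q-1) congruent to 1 modulo q^2.
\<close>
lemma sum_fermat_char:
  assumes "prime q"
  shows "(\<Sum>j<q. fermat_char q j n) = (if \<not> q dvd n \<and> q dvd fermat_quotient q n then of_nat q else 0)"
proof (cases "q dvd n")
  case False
  have q0: "q > 0" using assms prime_gt_0_nat by blast
  let ?w = "cis (2 * pi / real q) ^ fermat_quotient q n"
  have "(\<Sum>j<q. fermat_char q j n) = (\<Sum>j<q. ?w ^ j)"
    using False by (simp add: fermat_char_def flip: power_mult) (simp add: mult.commute)
  also have "\<dots> = (if q dvd fermat_quotient q n then of_nat q else 0)"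
  proof (cases "q dvd fermat_quotient q n")
    case True
    hence "?w = 1" using power_root_of_unity_eq_1_iff[OF q0] by blast
    thus ?thesis using True by simp
  next
    case nd: False
    hence "?w \<noteq> 1" using power_root_of_unity_eq_1_iff[OF q0] by blast
    moreover have "cis (2 * pi / real q) ^ q = 1" using cis_root_of_unity[OF q0, of 1] by simp
    hence "?w ^ q = 1" by (metis power_mult mult.commute power_one)
    ultimately show ?thesis using nd by (simp add: geometric_sum)
  qed
  finally show ?thesis using False by simp
qed (simp add: fermat_char_def)

definition psi :: "nat \<Rightarrow> real" where "psi N = (\<Sum>n\<in>{1..N}. mangoldt n)"

text \<open>
  Each prime p \<le> N contributes ln p once for each of its powers up to N, in total at most ln
  N.
\<close>
lemma psi_le_card_primes_ln:
  assumes "N > 0"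
  shows "psi N \<le> real (card {p. prime p \<and> p \<le> N}) * ln (real N)"
proof -
  let ?A = "{n\<in>{1..N}. primepow n}" and ?P = "{p. prime p \<and> p \<le> N}"
  have finP: "finite ?P" by simp
  have sub: "aprimedivisor ` ?A \<subseteq> ?P"
  proof
    fix p assume "p \<in> aprimedivisor ` ?A"
    then obtain n where n: "p = aprimedivisor n" "n \<le> N" "primepow n" "n > 0" by auto
    have "n > 1" using n(3) by (metis n(4) One_nat_def Suc_lessI not_primepow_Suc_0_nat)
    have "prime p" using \<open>n > 1\<close> n(1) by (auto intro: prime_aprimedivisor')
    moreover have "p dvd n" using \<open>n > 1\<close> n(1) by (auto intro: aprimedivisor_dvd')
    hence "p \<le> N" using n dvd_imp_le[of p n] by linarith
    ultimately show "p \<in> ?P" by simp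
  qed
  have "psi N = (\<Sum>n\<in>?A. ln (real (aprimedivisor n)))"
    unfolding psi_def mangoldt_def of_real_eq_id id_apply by (rule sum.inter_filter[symmetric]) simp
  also have "\<dots> = (\<Sum>p\<in>?P. \<Sum>n | n \<in> ?A \<and> aprimedivisor n = p. ln (real (aprimedivisor n)))"
    by (rule sum.group[symmetric]) (use sub finP in auto)
  also have "\<dots> \<le> (\<Sum>p\<in>?P. ln (real N))"
  proof (rule sum_mono)
    fix p assume "p \<in> ?P"
    hence p: "prime p" "p > 1" using prime_gt_1_nat by auto
    define K where "K = nat \<lfloor>ln (real N) / ln (real p)\<rfloor>"
    have lnp: "ln (real p) > 0" using p by simp
    have "{n. n \<in> ?A \<and> aprimedivisor n = p} \<subseteq> (\<lambda>k. p ^ k) ` {1..K}"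
    proof
      fix n assume n: "n \<in> {n. n \<in> ?A \<and> aprimedivisor n = p}"
      then obtain r k where rk: "prime r" "k > 0" "n = r ^ k" by (auto simp: primepow_def)
      hence r: "r = p" using n by (simp add: aprimedivisor_prime_power)
      have "real (p ^ k) \<le> real N" using n rk r by (simp del: of_nat_power)
      hence "ln (real (p ^ k)) \<le> ln (real N)" using p assms by (subst ln_le_cancel_iff) auto
      hence "real k * ln (real p) \<le> ln (real N)" using p by (simp add: ln_realpow)
      hence "real k \<le> ln (real N) / ln (real p)" using lnp by (simp add: field_simps)
      hence "k \<le> K" unfolding K_def by (simp add: le_nat_floor)
      thus "n \<in> (\<lambda>k. p ^ k) ` {1..K}" using rk r by (intro image_eqI[of _ _ k]) auto
    qed
    hence "card {n. n \<in> ?A \<and> aprimedivisor n = p} \<le> card ((\<lambda>k. p ^ k) ` {1..K})" by (intro card_mono) auto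
    also have "\<dots> \<le> K" using card_image_le[of "{1..K}" "\<lambda>k. p ^ k"] by simp
    finally have card: "card {n. n \<in> ?A \<and> aprimedivisor n = p} \<le> K" .
    have "(\<Sum>n | n \<in> ?A \<and> aprimedivisor n = p. ln (real (aprimedivisor n))) = real (card {n. n \<in> ?A \<and> aprimedivisor n = p}) * ln (real p)"
      by simp
    also have "\<dots> \<le> real K * ln (real p)" using card lnp by (intro mult_right_mono) auto
    also have "\<dots> \<le> (ln (real N) / ln (real p)) * ln (real p)"
      using assms lnp unfolding K_def by (intro mult_right_mono of_nat_floor) auto
    finally show "(\<Sum>n | n \<in> ?A \<and> aprimedivisor n = p. ln (real (aprimedivisor n))) \<le> ln (real N)" using lnp by simp
  qed
  finally show ?thesis by simp
qed

lemma ln_fact_eq_sum_mangoldt: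
  "ln (fact N :: real) = (\<Sum>d\<in>{1..N}. real (N div d) * mangoldt d)"
proof -
  have "ln (fact N :: real) = (\<Sum>n\<in>{1..N}. ln (real n))"
  proof -
    have "ln (fact N :: real) = ln (\<Prod>n\<in>{1..N}. real n)" by (simp add: fact_prod)
    also have "\<dots> = (\<Sum>n\<in>{1..N}. ln (real n))" by (rule ln_prod) auto
    finally show ?thesis .
  qed
  also have "\<dots> = (\<Sum>n\<in>{1..N}. \<Sum>d | d dvd n. mangoldt d)"
    by (intro sum.cong refl) (subst mangoldt_sum, auto)
  also have "\<dots> = (\<Sum>d\<in>{1..N}. \<Sum>b\<in>{1..N div d}. mangoldt d)" by (rule sum_divisor_pairs)
  finally show ?thesis by simp
qed

text \<open>
  Chebyshev's argument: the multiplicity with which \<Lambda>(d) occurs in the logarithm of the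
  central binomial coefficient is 0 or 1, and this coefficient is at least 4^n / (2 n).
\<close>
lemma psi_double_ge: 
  assumes "n > 0"
  shows "real n * ln 4 - ln (2 * real n) \<le> psi (2 * n)"
proof -
  have "fact n * fact (2 * n - n) * ((2 * n) choose n) = (fact (2 * n) :: nat)"
    by (rule binomial_fact_lemma) simp
  moreover have "2 * n - n = n" by simp
  ultimately have "real (fact n * fact n * ((2 * n) choose n)) = real (fact (2 * n))" by (simp only:)
  hence "fact n * fact n * real ((2 * n) choose n) = (fact (2 * n) :: real)"
    by (simp only: of_nat_mult of_nat_fact)
  hence "ln (fact n * fact n * real ((2 * n) choose n)) = ln (fact (2 * n) :: real)" by simp
  hence "ln (real ((2 * n) choose n)) = ln (fact (2 * n) :: real) - 2 * ln (fact n :: real)"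
    by (simp add: ln_mult)
  also have "ln (fact n :: real) = (\<Sum>d\<in>{1..2 * n}. real (n div d) * mangoldt d)"
    unfolding ln_fact_eq_sum_mangoldt by (rule sum.mono_neutral_left) auto
  also have "ln (fact (2 * n) :: real) - 2 * (\<Sum>d\<in>{1..2 * n}. real (n div d) * mangoldt d)
     = (\<Sum>d\<in>{1..2 * n}. (real (2 * n div d) - 2 * real (n div d)) * mangoldt d)"
    unfolding ln_fact_eq_sum_mangoldt by (simp add: sum_distrib_left sum_subtractf algebra_simps)
  also have "\<dots> \<le> (\<Sum>d\<in>{1..2 * n}. 1 * mangoldt d)"
  proof (intro sum_mono mult_right_mono mangoldt_nonneg)
    fix d assume d: "d \<in> {1..2 * n}"
    have "2 * n < (2 * (n div d) + 2) * d"
      using d dividend_less_div_times[of d n] by (simp add: algebra_simps)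
    hence "2 * n div d < 2 * (n div d) + 2" using d by (simp add: div_less_iff_less_mult)
    thus "real (2 * n div d) - 2 * real (n div d) \<le> 1" by linarith
  qed
  also have "\<dots> = psi (2 * n)" by (simp add: psi_def)
  finally have "ln (real ((2 * n) choose n)) \<le> psi (2 * n)" .
  moreover have "real n * ln 4 - ln (2 * real n) = ln (4 ^ n / (2 * real n))"
    using assms by (simp add: ln_div ln_realpow)
  moreover have "\<dots> \<le> ln (real ((2 * n) choose n))"
    using central_binomial_lower_bound[OF assms] assms by (subst ln_le_cancel_iff) auto
  ultimately show ?thesis by simp
qed

lemma eventually_psi_ge: "\<forall>\<^sub>F N in sequentially. psi N \<ge> real N / 4"
proof -
  have "ln (exp 1) < ln (4 :: real)" using exp_le by (subst ln_less_cancel_iff) auto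
  hence ln4: "ln 4 > (1 :: real)" by simp
  have "\<forall>\<^sub>F N in sequentially. (real N - 1) / 2 - ln (real N) \<ge> real N / 4" by real_asymp
  thus ?thesis using eventually_ge_at_top[of 2]
  proof eventually_elim
    case (elim N)
    define n where "n = N div 2"
    have n: "n > 0" "2 * n \<le> N" "real N \<le> 2 * real n + 1" using elim(2) by (auto simp: n_def)
    have "(real N - 1) / 2 * 1 \<le> real n * ln 4" using n(3) ln4 by (intro mult_mono) auto
    moreover have "ln (2 * real n) \<le> ln (real N)" using n by (subst ln_le_cancel_iff) auto
    moreover note psi_double_ge[OF n(1)]
    moreover have "psi (2 * n) \<le> psi N" unfolding psi_def using n by (intro sum_mono2) (auto simp: mangoldt_nonneg)
    ultimately show ?case using elim(1) by linarith
  qed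
qed

section \<open>Density of the primes in the kernel\<close>

text \<open>
  The n prime to q with n^(q-1) congruent to 1 modulo q^2.
\<close>
definition fermat_kernel :: "nat \<Rightarrow> nat set" where
  "fermat_kernel q = {n. \<not> q dvd n \<and> q dvd fermat_quotient q n}"

definition psi_kernel :: "nat \<Rightarrow> nat \<Rightarrow> real" where
  "psi_kernel q N = (\<Sum>n | n \<in> {1..N} \<and> n \<in> fermat_kernel q. mangoldt n)"

text \<open>
  The contribution of the characters fermat_char q j other than the principal one (j = 0).
\<close>
definition psi_error :: "nat \<Rightarrow> nat \<Rightarrow> real" where
  "psi_error q N = (\<Sum>j\<in>{1..<q}. norm (\<Sum>n\<in>{1..N}. fermat_char q j n * mangoldt n))"

lemma psi_error_nonneg: "psi_error q N \<ge> 0"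
  by (simp add: psi_error_def sum_nonneg)

lemma psi_error_tendsto_0:
  assumes "prime q" "odd q"
  shows "(\<lambda>N. psi_error q N / real N) \<longlonglongrightarrow> 0"
proof -
  have "(\<lambda>N. \<Sum>j\<in>{1..<q}. norm (\<Sum>n\<in>{1..N}. fermat_char q j n * mangoldt n) / real N) \<longlonglongrightarrow> (\<Sum>j\<in>{1..<q}. 0)"
  proof (rule tendsto_sum)
    fix j assume "j \<in> {1..<q}"
    hence "\<not> q dvd j" by (auto dest: dvd_imp_le)
    then interpret nonreal_character "fermat_char q j" "q * q"
      by (rule nonreal_character_fermat_char[OF assms])
    show "(\<lambda>N. norm (\<Sum>n\<in>{1..N}. fermat_char q j n * mangoldt n) / real N) \<longlonglongrightarrow> 0"
      by (rule mean_chi_mangoldt_tendsto_0)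
  qed
  thus ?thesis by (simp add: psi_error_def sum_divide_distrib)
qed

lemma psi_kernel_le:
  assumes "prime q"
  shows "real q * psi_kernel q N \<le> psi N + psi_error q N"
proof -
  let ?T = "\<lambda>j. \<Sum>n\<in>{1..N}. fermat_char q j n * (mangoldt n :: complex)"
  have q0: "q > 0" using assms prime_gt_0_nat by blast
  have "(\<Sum>j<q. ?T j) = (\<Sum>n\<in>{1..N}. (\<Sum>j<q. fermat_char q j n) * mangoldt n)"
    unfolding sum_distrib_right by (rule sum.swap)
  also have "\<dots> = (\<Sum>n\<in>{1..N}. if n \<in> fermat_kernel q then of_real (real q * mangoldt n) else 0)"
    by (intro sum.cong refl) (auto simp: sum_fermat_char[OF assms] fermat_kernel_def)
  also have "\<dots> = (\<Sum>n | n \<in> {1..N} \<and> n \<in> fermat_kernel q. of_real (real q * mangoldt n))"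
    by (rule sum.inter_filter[symmetric]) simp
  also have "\<dots> = of_real (real q * psi_kernel q N)"
    unfolding psi_kernel_def sum_distrib_left of_real_sum ..
  finally have eq: "of_real (real q * psi_kernel q N) = (\<Sum>j<q. ?T j)" by simp
  have "real q * psi_kernel q N \<le> norm (of_real (real q * psi_kernel q N) :: complex)"
    unfolding norm_of_real by (rule abs_ge_self)
  also have "\<dots> \<le> (\<Sum>j<q. norm (?T j))" unfolding eq by (rule norm_sum)
  also have "{..<q} = insert 0 {1..<q}" using q0 by auto
  also have "(\<Sum>j\<in>insert 0 {1..<q}. norm (?T j)) = norm (?T 0) + psi_error q N"
    unfolding psi_error_def by (subst sum.insert) auto
  also have "norm (?T 0) \<le> psi N"
    unfolding psi_def
  proof (rule sum_norm_le)
    fix n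
    have "norm (fermat_char q 0 n) \<le> 1" by (simp add: fermat_char_def)
    hence "norm (fermat_char q 0 n) * mangoldt n \<le> 1 * (mangoldt n :: real)"
      by (intro mult_right_mono mangoldt_nonneg)
    thus "norm (fermat_char q 0 n * mangoldt n) \<le> (mangoldt n :: real)"
      by (simp add: norm_mult)
  qed
  finally show ?thesis by simp
qed

definition primes_upto :: "nat \<Rightarrow> nat set" where
  "primes_upto N = {p. prime p \<and> p \<le> N}"

lemma finite_primes_upto [simp]: "finite (primes_upto N)"
  by (simp add: primes_upto_def)

text \<open>
  The primes above N^(1-e) have logarithm at least (1 - e) ln N; there are at most N^(1-e) smaller
  ones.
\<close>
lemma card_kernel_primes_le:
  assumes N: "N > 1" and e: "0 < e" "e < 1"
  shows "(real (card (primes_upto N \<inter> fermat_kernel q)) - real N powr (1 - e)) * ((1 - e) * ln (real N)) \<le> psi_kernel q N"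
proof -
  let ?H = "primes_upto N \<inter> fermat_kernel q"
  define y where "y = real N powr (1 - e)"
  define S where "S = {p \<in> ?H. real p > y}"
  have "card ?H \<le> card (S \<union> {1..nat \<lfloor>y\<rfloor>})"
  proof (rule card_mono)
    show "?H \<subseteq> S \<union> {1..nat \<lfloor>y\<rfloor>}"
    proof
      fix p assume p: "p \<in> ?H"
      hence "p > 0" by (auto simp: primes_upto_def prime_gt_0_nat)
      moreover have "p \<le> nat \<lfloor>y\<rfloor>" if "\<not> real p > y" using that by (intro le_nat_floor) simp
      ultimately show "p \<in> S \<union> {1..nat \<lfloor>y\<rfloor>}" using p by (auto simp: S_def)
    qed
  qed (simp add: S_def)
  also have "\<dots> \<le> card S + card {1..nat \<lfloor>y\<rfloor>}" by (rule card_Un_le)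
  finally have "real (card ?H) \<le> real (card S) + real (nat \<lfloor>y\<rfloor>)" by simp
  also have "real (nat \<lfloor>y\<rfloor>) \<le> y" by (rule of_nat_floor) (simp add: y_def)
  finally have "real (card ?H) - y \<le> real (card S)" by simp
  hence "(real (card ?H) - y) * ((1 - e) * ln (real N)) \<le> real (card S) * ((1 - e) * ln (real N))"
    using e N by (intro mult_right_mono) auto
  also have "\<dots> = (\<Sum>p\<in>S. (1 - e) * ln (real N))" by simp
  also have "\<dots> \<le> (\<Sum>p\<in>S. mangoldt p)"
  proof (rule sum_mono)
    fix p assume p: "p \<in> S"
    hence pp: "prime p" by (simp add: S_def primes_upto_def)
    have "(1 - e) * ln (real N) = ln y" using N by (simp add: y_def ln_powr)
    also have "\<dots> \<le> ln (real p)" using p N prime_gt_0_nat[OF pp] by (subst ln_le_cancel_iff) (auto simp: S_def y_def)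
    finally show "(1 - e) * ln (real N) \<le> mangoldt p" using pp by simp
  qed
  also have "\<dots> \<le> psi_kernel q N"
    unfolding psi_kernel_def
    by (rule sum_mono2) (auto simp: S_def primes_upto_def mangoldt_nonneg Suc_le_eq dest: prime_gt_0_nat)
  finally show ?thesis by (simp add: y_def)
qed

text \<open>
  Dividing the count by P ln N, where P is the number of primes up to N, makes all errors small
  because P ln N \<ge> \<psi>(N) \<ge> N/4. The loss factor 1 - e is absorbed by choosing e small
  compared to d. The summand 1 leaves room for the prime q itself.
\<close>
lemma eventually_density_kernel_primes:
  assumes q: "prime q" "odd q" and d: "d > 0"
  shows "\<forall>\<^sub>F N in sequentially. primes_upto N \<noteq> {} \<and>
     (real (card (primes_upto N \<inter> fermat_kernel q)) + 1) / real (card (primes_upto N)) < 1 / real q + d"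
proof -
  define c where "c = 1 / real q + d"
  have c0: "c > 0" using d by (simp add: c_def add_nonneg_pos)
  \<comment> \<open>e c \<le> d / 4, so (1 - e) c still exceeds 1/q + d/2\<close>
  define e where "e = min (1 / 2) (d / 4 / c)"
  have e: "0 < e" "e < 1" using d c0 by (auto simp: e_def)
  have "e * c \<le> d / 4 / c * c" using c0 by (intro mult_right_mono) (auto simp: e_def)
  also have "\<dots> = d / 4" using c0 by simp
  finally have "c - e * c > 1 / real q + d / 2" using d unfolding c_def by linarith
  hence ec: "(1 - e) * c > 1 / real q + d / 2" by (simp only: left_diff_distrib mult_1_left)
  have q0: "real q > 0" using prime_gt_0_nat[OF q(1)] by simp
  have "(\<lambda>N. 4 * (psi_error q N / real N) + 4 * (real N powr (- e) * ln (real N)) + 4 * (ln (real N) / real N)) 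
     \<longlonglongrightarrow> 4 * 0 + 4 * 0 + 4 * 0"
  proof (intro tendsto_add tendsto_mult tendsto_const psi_error_tendsto_0 q)
    show "(\<lambda>N. real N powr (- e) * ln (real N)) \<longlonglongrightarrow> 0" using e by real_asymp
    show "(\<lambda>N. ln (real N) / real N) \<longlonglongrightarrow> 0" by real_asymp
  qed
  hence "\<forall>\<^sub>F N in sequentially. 4 * (psi_error q N / real N) + 4 * (real N powr (- e) * ln (real N)) + 4 * (ln (real N) / real N) < d / 2"
    using d by (intro order_tendstoD(2)) auto
  thus ?thesis using eventually_psi_ge eventually_gt_at_top[of 1]
  proof eventually_elim
    case (elim N)
    define P where "P = real (card (primes_upto N))"
    define h where "h = real (card (primes_upto N \<inter> fermat_kernel q))"
    define l where "l = ln (real N)"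
    have N: "N > 1" and l: "l > 0" using elim by (auto simp: l_def)
    have psiP: "psi N \<le> P * l"
      unfolding P_def l_def primes_upto_def using N by (intro psi_le_card_primes_ln) simp
    have Pl: "P * l \<ge> real N / 4" using psiP elim(2) by linarith
    hence "P * l > 0" using N by linarith
    hence P: "P > 0" using l by (simp add: zero_less_mult_iff)
    have ratio: "x / (P * l) \<le> 4 * (x / real N)" if "x \<ge> 0" for x
    proof -
      have "x / (P * l) \<le> x / (real N / 4)" using that Pl N by (intro divide_left_mono mult_pos_pos) (auto simp: P l)
      thus ?thesis by (simp add: mult.commute)
    qed
    have "(h - real N powr (1 - e)) * ((1 - e) * l) \<le> psi_kernel q N"
      unfolding h_def l_def by (rule card_kernel_primes_le[OF N e])
    also have "\<dots> \<le> (psi N + psi_error q N) / real q"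
      using psi_kernel_le[OF q(1), of N] q0 by (simp add: field_simps)
    also have "\<dots> \<le> (P * l) / real q + psi_error q N"
    proof -
      have "psi_error q N / real q \<le> psi_error q N / 1"
        using psi_error_nonneg[of q N] prime_gt_0_nat[OF q(1)] by (intro divide_left_mono) auto
      moreover have "psi N / real q \<le> P * l / real q" using psiP q0 by (intro divide_right_mono) auto
      ultimately show ?thesis by (simp add: add_divide_distrib)
    qed
    finally have 1: "(h - real N powr (1 - e)) * ((1 - e) * l) \<le> (P * l) / real q + psi_error q N" .
    have 2: "(1 - e) * (h + 1) * l = (h - real N powr (1 - e)) * ((1 - e) * l) + (1 - e) * (real N powr (1 - e) * l + l)"
      by (simp add: algebra_simps)
    have 3: "(1 - e) * (real N powr (1 - e) * l + l) \<le> 1 * (real N powr (1 - e) * l + l)"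
      using e l by (intro mult_right_mono) auto
    have "(1 - e) * (h + 1) * l \<le> (P * l) / real q + (psi_error q N + real N powr (1 - e) * l + l)"
      unfolding 2 by (rule order_trans[OF add_mono[OF 1 3]]) simp
    hence "(1 - e) * (h + 1) * l / (P * l) \<le> ((P * l) / real q + (psi_error q N + real N powr (1 - e) * l + l)) / (P * l)"
      using \<open>P * l > 0\<close> by (intro divide_right_mono) auto
    also have "\<dots> = 1 / real q + (psi_error q N + real N powr (1 - e) * l + l) / (P * l)"
      using P l by (subst add_divide_distrib) simp
    also have "(psi_error q N + real N powr (1 - e) * l + l) / (P * l) \<le> 4 * ((psi_error q N + real N powr (1 - e) * l + l) / real N)"
      using psi_error_nonneg[of q N] l by (intro ratio add_nonneg_nonneg) auto
    also have "\<dots> = 4 * (psi_error q N / real N) + 4 * (real N powr (- e) * l) + 4 * (l / real N)"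
    proof -
      have "real N powr (1 - e) / real N = real N powr (- e)" using N by (simp add: powr_diff powr_minus_divide)
      hence "real N powr (1 - e) * l / real N = real N powr (- e) * l" by (metis times_divide_eq_left)
      thus ?thesis by (simp add: add_divide_distrib)
    qed
    also have "\<dots> < d / 2" using elim(1) by (simp add: l_def)
    finally have "(1 - e) * (h + 1) * l / (P * l) < 1 / real q + d / 2" by simp
    also have "(1 - e) * (h + 1) * l / (P * l) = (1 - e) * ((h + 1) / P)" using l by simp
    also note ec
    finally have "(h + 1) / P < c" using e by (subst (asm) mult_less_cancel_left_pos) auto
    thus ?case using P by (auto simp: P_def h_def c_def)
  qed
qed

lemma monogenic_poly_if_not_in_fermat_kernel:
  fixes p q :: nat
  assumes "prime p" "prime q" "odd q" "p \<noteq> q" "p \<notin> fermat_kernel q"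
  shows "monogenic_poly (monom 1 q - [:int p:])"
proof (rule monogenic_pure_poly[OF assms(1-3)])
  have q0: "q > 0" using assms prime_gt_0_nat by blast
  have nd: "\<not> q dvd p" using assms primes_dvd_imp_eq by blast
  have "p ^ q = p * p ^ (q - 1)" using q0 by (metis power_minus_mult mult.commute)
  also have "\<dots> = p + p * (q * fermat_quotient q p)"
    using power_eq_fermat_quotient[OF assms(2) nd] by simp
  finally have eq: "int p ^ q - int p = int (q * (p * fermat_quotient q p))"
    by (simp add: mult_ac flip: of_nat_power)
  show "\<not> (int q)\<^sup>2 dvd int p ^ q - int p"
  proof
    assume "(int q)\<^sup>2 dvd int p ^ q - int p"
    hence "q * q dvd q * (p * fermat_quotient q p)"
      unfolding eq power2_eq_square of_nat_mult[symmetric] of_nat_dvd_iff .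
    hence "q dvd p * fermat_quotient q p" using q0 by simp
    hence "q dvd fermat_quotient q p" using assms(2) nd prime_dvd_mult_iff by blast
    thus False using assms(5) nd by (simp add: fermat_kernel_def)
  qed
qed

theorem theorem1:
  fixes q :: nat
  assumes "prime q" and "q \<ge> 3"
  shows "Liminf at_top (\<lambda>x::real. ereal
           (real (card {p::nat. prime p \<and> real p \<le> x \<and>
                        monogenic_poly (monom 1 q - [:int p:])}) / real (prime_pi x)))
         \<ge> ereal ((real q - 1) / real q)"
  unfolding le_Liminf_iff
proof (intro allI impI)
  let ?good = "\<lambda>x::real. {p::nat. prime p \<and> real p \<le> x \<and> monogenic_poly (monom 1 q - [:int p:])}"
  have odd: "odd q" using assms prime_odd_nat by simp
  have q0: "real q > 0" using assms by simp
  fix y assume y: "y < ereal ((real q - 1) / real q)"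
  have "\<exists>d>0. y \<le> ereal (1 - 1 / real q - d)"
  proof (cases y)
    case (real r)
    thus ?thesis using y q0 by (intro exI[of _ "1 - 1 / real q - r"]) (auto simp: field_simps)
  next
    case MInf
    thus ?thesis by (intro exI[of _ 1]) simp
  qed (use y in auto)
  then obtain d where d: "d > 0" "y \<le> ereal (1 - 1 / real q - d)" by blast
  obtain N0 where N0: "\<And>N. N \<ge> N0 \<Longrightarrow> primes_upto N \<noteq> {} \<and>
     (real (card (primes_upto N \<inter> fermat_kernel q)) + 1) / real (card (primes_upto N)) < 1 / real q + d"
    using eventually_density_kernel_primes[OF assms(1) odd d(1)] by (auto simp: eventually_sequentially)
  have "y < ereal (real (card (?good x)) / real (prime_pi x))" if x: "x > max 2 (real N0)" for x
  proof -
    define N where "N = nat \<lfloor>x\<rfloor>"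
    have "N \<ge> N0" using x unfolding N_def by (intro le_nat_floor) simp
    note N = N0[OF this]
    have le_N: "p \<le> N \<longleftrightarrow> real p \<le> x" for p
      using x unfolding N_def by (auto simp: le_nat_iff le_floor_iff)
    define P where "P = real (card (primes_upto N))"
    define h where "h = real (card (primes_upto N \<inter> fermat_kernel q))"
    have P: "P > 0" using N by (simp add: P_def card_gt_0_iff)
    have "prime_pi x \<le> card (primes_upto N)"
      unfolding prime_pi_def by (rule card_mono[OF finite_primes_upto]) (auto simp: primes_upto_def le_N)
    hence piP: "real (prime_pi x) \<le> P" by (simp add: P_def)
    have "{p. prime p \<and> real p < x} \<subseteq> primes_upto N" by (auto simp: primes_upto_def le_N)
    hence "finite {p. prime p \<and> real p < x}" by (rule finite_subset) simp
    moreover have "2 \<in> {p::nat. prime p \<and> real p < x}" using x by simp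
    ultimately have "prime_pi x > 0" unfolding prime_pi_def by (metis card_gt_0_iff empty_iff)
    hence pi0: "real (prime_pi x) > 0" by simp
    have "card (primes_upto N) \<le> card (?good x \<union> (primes_upto N \<inter> fermat_kernel q \<union> {q}))"
    proof (rule card_mono)
      have "?good x \<subseteq> primes_upto N" by (auto simp: primes_upto_def le_N)
      hence "finite (?good x)" by (rule finite_subset) simp
      thus "finite (?good x \<union> (primes_upto N \<inter> fermat_kernel q \<union> {q}))" by (rule finite_UnI) simp
      show "primes_upto N \<subseteq> ?good x \<union> (primes_upto N \<inter> fermat_kernel q \<union> {q})"
        using monogenic_poly_if_not_in_fermat_kernel[OF _ assms(1) odd] by (auto simp: primes_upto_def le_N)
    qed
    also have "\<dots> \<le> card (?good x) + card (primes_upto N \<inter> fermat_kernel q \<union> {q})" by (rule card_Un_le)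
    also have "card (primes_upto N \<inter> fermat_kernel q \<union> {q}) \<le> card (primes_upto N \<inter> fermat_kernel q) + card {q}"
      by (rule card_Un_le)
    finally have good: "P - (h + 1) \<le> real (card (?good x))" by (simp add: P_def h_def)
    have "1 - 1 / real q - d < 1 - (h + 1) / P" using N by (simp add: P_def h_def)
    also have "\<dots> = (P - (h + 1)) / P" using P by (simp add: diff_divide_distrib)
    also have "\<dots> \<le> real (card (?good x)) / P" using good P by (intro divide_right_mono) auto
    also have "\<dots> \<le> real (card (?good x)) / real (prime_pi x)"
      using piP pi0 P by (intro divide_left_mono mult_pos_pos) auto
    finally have "ereal (1 - 1 / real q - d) < ereal (real (card (?good x)) / real (prime_pi x))" by simp
    thus ?thesis using d(2) by (rule order_le_less_trans[rotated])
  qed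
  thus "\<forall>\<^sub>F x in at_top. y < ereal (real (card (?good x)) / real (prime_pi x))"
    using eventually_gt_at_top[of "max 2 (real N0)"] by (rule eventually_mono[rotated])
qed

end
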